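(* Let $Z=(T_i,U_i)_{i\ge1}$ be a marked point process with marks in $\mathbb{R}^d$, with associated random measure $\mu(ds,dx)$ whose $\mathbb{P}$-compensator is $\nu(t,dx)\,dt$, and let $W$ be a one-dimensional $\mathbb{P}$-Brownian motion independent of $Z$ under $\mathbb{P}$. Let $m\in\mathbb{R}$, $\sigma>0$, let $G(t,x)=G(0,x)+\int_0^tg(s,x)\,ds$, and let the stock price process be $$X_t=X_0\exp\Big(mt+\sigma W_t-\frac{\sigma^2t}{2}+\int_0^t\sum_{T_i\le s}g(s-T_i,U_i)\,ds+\sum_{T_i\le t}G(0,U_i)\Big),\qquad t\ge0.$$ Let $r$ be a progressively measurable short rate process with $\int_0^tr_s\,ds<\infty$ $\mathbb{P}$-a.s. for all $t\ge0$. Let $\mathbb{P}'\sim\mathbb{P}$, let $\nu'(t,dx)\,dt=Y(t,x)\,\nu(t,dx)\,dt$ be the compensator of $\mu$ under $\mathbb{P}'$, and let $\xi$ be the process such that $W'=W+\int_0^{\cdot}\xi_s\,ds$ is a $\mathbb{P}'$-Brownian motion. Then the equivalent measure $\mathbb{P}'$ is a (local) martingale measure if $$r_t=m-\sigma\xi_t+\int_0^t\int_{\mathbb{R}^d}g(t-s,x)\,\mu(ds,dx)+\int_{\mathbb{R}^d}\big(e^{G(0,x)}-1\big)\,\nu'(t,dx)$$ $d\mathbb{P}\otimes dt$-almost surely for all $t\ge0$.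
   Context: $(\Omega,\mathcal{F},\mathbb{F},\mathbb{P})$ is a filtered probability space with $\mathbb{F}=(\mathcal{F}_t)_{t\ge0}$ satisfying the usual conditions, $\mathcal{F}=\mathcal{F}_{\infty-}$ (the $\sigma$-field generated by $\bigcup_{t\ge0}\mathcal{F}_t$), and $\mathbb{F}$ is the smallest filtration for which $\mu$ is optional, $W$ is adapted, and $\mathcal{H}\subset\mathcal{F}_0$, where $\mathcal{H}$ is a given initial $\sigma$-field. $\mathcal{P}$ is the predictable $\sigma$-field. A marked point process $Z=(T_i,U_i)_{i\ge1}$ consists of an increasing sequence of stopping times $0<T_1<T_2<\dots$ (non-explosive: $T_n\to\infty$ a.s.) and a sequence of $\mathbb{R}^d$-valued random variables $U_1,U_2,\dots$. Its random measure is $\mu([0,t]\times A)=\sum_{i\ge1}\mathbf{1}_{\{U_i\in A\}}\mathbf{1}_{\{T_i\le t\}}$. The compensator of $\mu$ under a probability measure is the unique $\mathbb{F}$-predictable random measure $\nu$ with $\mathbb{E}[\int W\,d\mu]=\mathbb{E}[\int W\,d\nu]$ for every non-negative $\mathcal{P}\otimes\mathcal{B}(\mathbb{R}^d)$-measurable $W$ under that measure; it is assumed absolutely continuous in time under $\mathbb{P}$, $\nu(dt,dx)=\nu(t,dx)\,dt$. $Y$ is the non-negative $\mathcal{P}\otimes\mathcal{B}(\mathbb{R}^d)$-measurable function for which the $\mathbb{P}'$-compensator of $\mu$ is $Y(t,x)\,\nu(t,dx)\,dt$. $X_0>0$ is the initial price; $G:\mathbb{R}_+\times\mathbb{R}^d\to\mathbb{R}$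 and $g$ are measurable and the sums and integrals appearing in the definition of $X$ are well defined. Discounting takes place via the bank account $\exp(\int_0^tr_s\,ds)$. $\mathbb{P}'$ is a (local) martingale measure if the discounted price process $\exp(-\int_0^tr_s\,ds)X_t$, $t\ge0$, is a local martingale under $\mathbb{P}'$. *)

theory Defs
  imports "HOL-Probability.Probability"
begin

text \<open>
  Time runs over the half-line \<open>{0..}\<close> of the reals. So that the library notions
  \<^const>\<open>filtration\<close> and \<^const>\<open>stopping_time\<close> apply, filtrations are indexed by all reals and
  extended by \<open>F t = F 0\<close> for \<open>t < 0\<close>; nothing else depends on negative times.
  Processes are written \<open>X t \<omega>\<close>.
\<close>

definition usual_filtration :: "'a measure \<Rightarrow> (real \<Rightarrow> 'a measure) \<Rightarrow> bool" where
  "usual_filtration M F \<longleftrightarrow>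
     filtration (space M) F \<and> (\<forall>t. subalgebra M (F t)) \<and> (\<forall>t<0. sets (F t) = sets (F 0)) \<and>
     complete_measure M \<and> null_sets M \<subseteq> sets (F 0) \<and>
     (\<forall>t\<ge>0. sets (F t) = (\<Inter>s\<in>{t<..}. sets (F s)))"

definition adapted :: "(real \<Rightarrow> 'a measure) \<Rightarrow> (real \<Rightarrow> 'a \<Rightarrow> real) \<Rightarrow> bool" where
  "adapted F X \<longleftrightarrow> (\<forall>t\<ge>0. X t \<in> borel_measurable (F t))"

definition progressive :: "(real \<Rightarrow> 'a measure) \<Rightarrow> (real \<Rightarrow> 'a \<Rightarrow> real) \<Rightarrow> bool" where
  "progressive F X \<longleftrightarrow>
     (\<forall>t\<ge>0. (\<lambda>(\<omega>, s). X s \<omega>) \<in> borel_measurable (F t \<Otimes>\<^sub>M restrict_space borel {0..t}))"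

definition cadlag :: "(real \<Rightarrow> real) \<Rightarrow> bool" where
  "cadlag f \<longleftrightarrow> (\<forall>t\<ge>0. continuous (at_right t) f) \<and> (\<forall>t>0. \<exists>l. (f \<longlongrightarrow> l) (at_left t))"

definition optional_sigma :: "'a measure \<Rightarrow> (real \<Rightarrow> 'a measure) \<Rightarrow> ('a \<times> real) measure" where
  "optional_sigma M F = sigma (space M \<times> {0..})
     {{(\<omega>, t). \<omega> \<in> space M \<and> 0 \<le> t \<and> X t \<omega> \<in> B} | X B.
        adapted F X \<and> (\<forall>\<omega>\<in>space M. cadlag (\<lambda>t. X t \<omega>)) \<and> B \<in> sets borel}"

definition predictable_sigma :: "'a measure \<Rightarrow> (real \<Rightarrow> 'a measure) \<Rightarrow> ('a \<times> real) measure" where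
  "predictable_sigma M F = sigma (space M \<times> {0..})
     {{(\<omega>, t). \<omega> \<in> space M \<and> 0 \<le> t \<and> X t \<omega> \<in> B} | X B.
        adapted F X \<and> (\<forall>\<omega>\<in>space M. \<forall>t>0. continuous (at_left t) (\<lambda>s. X s \<omega>)) \<and> B \<in> sets borel}"


text \<open>Random measures on \<open>{0..} \<times> E\<close>, with \<open>\<mu>(\<omega>; {0} \<times> E) = 0\<close> as is customary.\<close>

definition random_measure :: "'a measure \<Rightarrow> ('a \<Rightarrow> (real \<times> 'e::euclidean_space) measure) \<Rightarrow> bool" where
  "random_measure M K \<longleftrightarrow>
     (\<forall>\<omega>\<in>space M. sets (K \<omega>) = sets borel \<and> emeasure (K \<omega>) ({..0} \<times> UNIV) = 0)"

definition rm_integral ::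
    "('a \<Rightarrow> (real \<times> 'e) measure) \<Rightarrow> (('a \<times> real) \<times> 'e \<Rightarrow> ennreal) \<Rightarrow> real set \<Rightarrow> 'a \<Rightarrow> ennreal" where
  "rm_integral K V I \<omega> = (\<integral>\<^sup>+(s, x). V ((\<omega>, s), x) * indicator I s \<partial>K \<omega>)"

definition optional_random_measure ::
    "'a measure \<Rightarrow> (real \<Rightarrow> 'a measure) \<Rightarrow> ('a \<Rightarrow> (real \<times> 'e::euclidean_space) measure) \<Rightarrow> bool" where
  "optional_random_measure M F K \<longleftrightarrow> random_measure M K \<and>
     (\<forall>V \<in> borel_measurable (optional_sigma M F \<Otimes>\<^sub>M borel).
        (\<lambda>(\<omega>, t). rm_integral K V {0..t} \<omega>) \<in> borel_measurable (optional_sigma M F))"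

definition predictable_random_measure ::
    "'a measure \<Rightarrow> (real \<Rightarrow> 'a measure) \<Rightarrow> ('a \<Rightarrow> (real \<times> 'e::euclidean_space) measure) \<Rightarrow> bool" where
  "predictable_random_measure M F K \<longleftrightarrow> random_measure M K \<and>
     (\<forall>V \<in> borel_measurable (predictable_sigma M F \<Otimes>\<^sub>M borel).
        (\<lambda>(\<omega>, t). rm_integral K V {0..t} \<omega>) \<in> borel_measurable (predictable_sigma M F))"

definition compensator ::
    "'a measure \<Rightarrow> (real \<Rightarrow> 'a measure) \<Rightarrow> ('a \<Rightarrow> (real \<times> 'e::euclidean_space) measure) \<Rightarrow>
     ('a \<Rightarrow> (real \<times> 'e) measure) \<Rightarrow> bool" where
  "compensator M F \<mu> N \<longleftrightarrow> predictable_random_measure M F N \<and>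
     (\<forall>V \<in> borel_measurable (predictable_sigma M F \<Otimes>\<^sub>M borel).
        (\<integral>\<^sup>+\<omega>. rm_integral \<mu> V {0..} \<omega> \<partial>M) = (\<integral>\<^sup>+\<omega>. rm_integral N V {0..} \<omega> \<partial>M))"

definition predictable_kernel ::
    "'a measure \<Rightarrow> (real \<Rightarrow> 'a measure) \<Rightarrow> ('a \<Rightarrow> real \<Rightarrow> 'e::euclidean_space measure) \<Rightarrow> bool" where
  "predictable_kernel M F \<nu> \<longleftrightarrow>
     (\<forall>\<omega>\<in>space M. \<forall>t\<ge>0. sets (\<nu> \<omega> t) = sets borel) \<and>
     (\<forall>A\<in>sets borel. (\<lambda>(\<omega>, t). emeasure (\<nu> \<omega> t) A) \<in> borel_measurable (predictable_sigma M F))"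

text \<open>\<open>kernel_dt k\<close> is the measure \<open>k(t, dx) dt\<close> on \<open>{0..} \<times> E\<close>. As always with \<^const>\<open>measure_of\<close>, it is
  the null measure should the set function fail to be countably additive; this does not happen
  if \<open>k t\<close> is a finite measure for almost every \<open>t\<close> and \<open>t \<mapsto> k(t, A)\<close> is measurable.\<close>

definition kernel_dt :: "(real \<Rightarrow> 'e::euclidean_space measure) \<Rightarrow> (real \<times> 'e) measure" where
  "kernel_dt k = measure_of UNIV (sets borel)
     (\<lambda>B. \<integral>\<^sup>+t\<in>{0..}. emeasure (k t) (Pair t -` B) \<partial>lborel)"


text \<open>Marked point processes. The sequences are indexed from \<open>0\<close>: the pair \<open>(T i, U i)\<close> is the
  \<open>(i+1)\<close>-st point.\<close>

definition marked_point_process ::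
    "'a measure \<Rightarrow> (real \<Rightarrow> 'a measure) \<Rightarrow> (nat \<Rightarrow> 'a \<Rightarrow> real) \<Rightarrow> (nat \<Rightarrow> 'a \<Rightarrow> 'e::euclidean_space) \<Rightarrow> bool" where
  "marked_point_process M F T U \<longleftrightarrow>
     (\<forall>i. stopping_time F (T i)) \<and> (\<forall>i. U i \<in> borel_measurable M) \<and>
     (\<forall>\<omega>\<in>space M. 0 < T 0 \<omega> \<and> (\<forall>i. T i \<omega> < T (Suc i) \<omega>)) \<and>
     (AE \<omega> in M. filterlim (\<lambda>i. T i \<omega>) at_top sequentially)"

definition mpp_measure ::
    "(nat \<Rightarrow> 'a \<Rightarrow> real) \<Rightarrow> (nat \<Rightarrow> 'a \<Rightarrow> 'e::euclidean_space) \<Rightarrow> 'a \<Rightarrow> (real \<times> 'e) measure" where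
  "mpp_measure T U \<omega> = distr (count_space UNIV) borel (\<lambda>i. (T i \<omega>, U i \<omega>))"

lemma emeasure_mpp_measure:
  assumes "A \<in> sets borel" "\<And>i. 0 < T i \<omega>"
  shows "emeasure (mpp_measure T U \<omega>) ({0..t} \<times> A) =
           (\<Sum>i. indicator A (U i \<omega>) * indicator {..t} (T i \<omega>))"
proof -
  let ?Z = "\<lambda>i. (T i \<omega>, U i \<omega>)"
  have Z: "?Z \<in> measurable (count_space UNIV) borel" by simp
  have B: "{0..t} \<times> A \<in> sets borel"
    using assms(1) by (simp add: borel_prod[symmetric])
  have "emeasure (mpp_measure T U \<omega>) ({0..t} \<times> A) =
        (\<integral>\<^sup>+z. indicator ({0..t} \<times> A) z \<partial>distr (count_space UNIV) borel ?Z)"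
    using B by (simp add: mpp_measure_def)
  also have "\<dots> = (\<integral>\<^sup>+i. indicator ({0..t} \<times> A) (?Z i) \<partial>count_space UNIV)"
    using B by (intro nn_integral_distr[OF Z]) simp
  also have "\<dots> = (\<Sum>i. indicator ({0..t} \<times> A) (?Z i))"
    by (rule nn_integral_count_space_nat)
  also have "\<dots> = (\<Sum>i. indicator A (U i \<omega>) * indicator {..t} (T i \<omega>))"
    using assms(2) by (intro suminf_cong) (auto simp: indicator_def less_imp_le)
  finally show ?thesis .
qed

text \<open>Minimality is understood among the filtrations satisfying the usual conditions.\<close>

definition smallest_filtration ::
    "'a measure \<Rightarrow> (real \<Rightarrow> 'a measure) \<Rightarrow> ('a \<Rightarrow> (real \<times> 'e::euclidean_space) measure) \<Rightarrow>
     (real \<Rightarrow> 'a \<Rightarrow> real) \<Rightarrow> 'a measure \<Rightarrow> bool" where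
  "smallest_filtration M F \<mu> W H \<longleftrightarrow>
     (let C = (\<lambda>F'. usual_filtration M F' \<and> optional_random_measure M F' \<mu> \<and> adapted F' W \<and>
                    sets H \<subseteq> sets (F' 0))
      in C F \<and> (\<forall>F'. C F' \<longrightarrow> (\<forall>t\<ge>0. sets (F t) \<subseteq> sets (F' t))))"


text \<open>Brownian motion relative to the filtration: increments are independent of the past \<open>F s\<close>.\<close>

definition brownian_motion :: "'a measure \<Rightarrow> (real \<Rightarrow> 'a measure) \<Rightarrow> (real \<Rightarrow> 'a \<Rightarrow> real) \<Rightarrow> bool" where
  "brownian_motion M F B \<longleftrightarrow> adapted F B \<and>
     (AE \<omega> in M. B 0 \<omega> = 0) \<and> (AE \<omega> in M. continuous_on {0..} (\<lambda>t. B t \<omega>)) \<and>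
     (\<forall>s t. 0 \<le> s \<and> s < t \<longrightarrow>
        distributed M lborel (\<lambda>\<omega>. B t \<omega> - B s \<omega>) (normal_density 0 (sqrt (t - s))) \<and>
        prob_space.indep_set M (sets (F s))
          (sets (vimage_algebra (space M) (\<lambda>\<omega>. B t \<omega> - B s \<omega>) borel)))"

definition independent_of_mpp ::
    "'a measure \<Rightarrow> (real \<Rightarrow> 'a \<Rightarrow> real) \<Rightarrow> (nat \<Rightarrow> 'a \<Rightarrow> real) \<Rightarrow> (nat \<Rightarrow> 'a \<Rightarrow> 'e::euclidean_space) \<Rightarrow> bool" where
  "independent_of_mpp M W T U \<longleftrightarrow>
     prob_space.indep_set M
       (sets (vimage_algebra (space M) (\<lambda>\<omega>. \<lambda>t\<in>{0..}. W t \<omega>) (\<Pi>\<^sub>M t\<in>{0..}. borel)))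
       (sets (vimage_algebra (space M) (\<lambda>\<omega> i. (T i \<omega>, U i \<omega>)) (\<Pi>\<^sub>M i\<in>UNIV. borel)))"

definition martingale :: "'a measure \<Rightarrow> (real \<Rightarrow> 'a measure) \<Rightarrow> (real \<Rightarrow> 'a \<Rightarrow> real) \<Rightarrow> bool" where
  "martingale M F X \<longleftrightarrow> adapted F X \<and> (\<forall>t\<ge>0. integrable M (X t)) \<and>
     (\<forall>s t. 0 \<le> s \<and> s \<le> t \<longrightarrow> (AE \<omega> in M. real_cond_exp M (F s) (X t) \<omega> = X s \<omega>))"

text \<open>Real-valued localizing times lose no generality: \<open>min (\<tau> n) n\<close> localizes if \<open>\<tau> n\<close> does.\<close>

definition local_martingale :: "'a measure \<Rightarrow> (real \<Rightarrow> 'a measure) \<Rightarrow> (real \<Rightarrow> 'a \<Rightarrow> real) \<Rightarrow> bool" where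
  "local_martingale M F X \<longleftrightarrow> adapted F X \<and> (AE \<omega> in M. cadlag (\<lambda>t. X t \<omega>)) \<and>
     (\<exists>\<tau> :: nat \<Rightarrow> 'a \<Rightarrow> real.
        (\<forall>n. stopping_time F (\<tau> n)) \<and> (\<forall>n. \<forall>\<omega>\<in>space M. 0 \<le> \<tau> n \<omega>) \<and>
        (AE \<omega> in M. incseq (\<lambda>n. \<tau> n \<omega>) \<and> filterlim (\<lambda>n. \<tau> n \<omega>) at_top sequentially) \<and>
        (\<forall>n. martingale M F (\<lambda>t \<omega>. X (min t (\<tau> n \<omega>)) \<omega>)))"

definition equivalent_prob :: "'a measure \<Rightarrow> 'a measure \<Rightarrow> bool" where
  "equivalent_prob M M' \<longleftrightarrow> prob_space M \<and> prob_space M' \<and> sets M = sets M' \<and>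
     absolutely_continuous M M' \<and> absolutely_continuous M' M"

definition locally_integrable :: "(real \<Rightarrow> real) \<Rightarrow> bool" where
  "locally_integrable f \<longleftrightarrow> (\<forall>t\<ge>0. set_integrable lborel {0..t} f)"

text \<open>The index sets below are finite outside the null set on which the point process explodes; on
  that null set a sum over an infinite index set is \<open>0\<close> by convention.\<close>

definition stock_price ::
    "real \<Rightarrow> real \<Rightarrow> real \<Rightarrow> (real \<Rightarrow> 'e \<Rightarrow> real) \<Rightarrow> (real \<Rightarrow> 'e \<Rightarrow> real) \<Rightarrow> (real \<Rightarrow> 'a \<Rightarrow> real) \<Rightarrow>
     (nat \<Rightarrow> 'a \<Rightarrow> real) \<Rightarrow> (nat \<Rightarrow> 'a \<Rightarrow> 'e) \<Rightarrow> real \<Rightarrow> 'a \<Rightarrow> real" where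
  "stock_price X\<^sub>0 m \<sigma> G g W T U t \<omega> = X\<^sub>0 * exp (m * t + \<sigma> * W t \<omega> - \<sigma>\<^sup>2 * t / 2 +
     (LINT s:{0..t}|lborel. (\<Sum>i | T i \<omega> \<le> s. g (s - T i \<omega>) (U i \<omega>))) +
     (\<Sum>i | T i \<omega> \<le> t. G 0 (U i \<omega>)))"

definition local_martingale_measure ::
    "'a measure \<Rightarrow> (real \<Rightarrow> 'a measure) \<Rightarrow> (real \<Rightarrow> 'a \<Rightarrow> real) \<Rightarrow> (real \<Rightarrow> 'a \<Rightarrow> real) \<Rightarrow> bool" where
  "local_martingale_measure M' F r X \<longleftrightarrow>
     local_martingale M' F (\<lambda>t \<omega>. exp (- (LINT s:{0..t}|lborel. r s \<omega>)) * X t \<omega>)"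

end

theory Submission
  imports Defs
begin

text \<open>
  Under \<open>P'\<close> the drift condition turns the discounted price into \<open>L t * S t\<close>, where \<open>L\<close> is the
  exponential martingale of the \<open>P'\<close>-Brownian motion and \<open>S\<close> is the exponential of the jump sum
  of \<open>G 0\<close> minus the time integral of \<open>\<integral>(exp (G 0 x) - 1) \<nu>'(t, dx)\<close>. Pathwise,
  \<open>S v - S s\<close> is an integral of \<open>S (u-) * (exp (G 0 x) - 1)\<close> against \<open>\<mu> - \<nu>'\<close>. No stochastic
  integral is needed for the product: optional sampling replaces \<open>L (T i)\<close> by \<open>L t\<close> at every jump,
  and the martingale property does the same in the time integral, so that the compensator identity
  for the predictable integrand \<open>L u * S (u-)\<close> shows that \<open>L t\<close> weights the jumps and the
  compensator equally. The localizing times bound a left-continuous increasing process that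
  dominates \<open>ln (S (u-))\<close> and the total variation of the drift; hence the indicator of the stopped
  interval is predictable. Local integrability of the drift in time comes out of the drift condition: the
  negative part of \<open>exp (G 0 x) - 1\<close> is bounded by one and \<open>\<nu>'\<close> is finite up to each jump
  time, so that the condition controls the positive part.
\<close>

section \<open>Filtrations, predictable and optional processes\<close>

text \<open>Under \<open>P'\<close> the Brownian motion and the point process need not be
  independent, since \<open>\<xi>\<close> and \<open>Y\<close> may depend on both; so the product
  \<open>L t * S t\<close> cannot be treated by conditioning on one factor. What remains available
  is that \<open>L\<close> is continuous and adapted, hence predictable, while the jumps of
  \<open>S\<close> sit at stopping times.

  A compensator is characterized by non-negative predictable integrands only. For this reason
  \<open>exp (G 0 x) - 1\<close> is split into its positive and its negative part, whose
  compensators have time densities \<open>p\<close> and \<open>q\<close>, and the path equation for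
  \<open>S\<close> is arranged with non-negative terms on both sides and read in
  \<open>ennreal\<close>. Expectations may then be infinite until the very last step, where equal
  terms are cancelled. Only the time integrals of \<open>p\<close> and \<open>q\<close> have to be
  estimated for this: they are bounded up to the localizing time, whereas the jump of
  \<open>S\<close> at that time may be arbitrarily large and is never bounded.\<close>

lemma floor_grid:
  fixes u :: real
  shows "(\<lambda>n. \<lfloor>2 ^ n * u\<rfloor> / 2 ^ n) \<longlonglongrightarrow> u" "\<lfloor>2 ^ n * u\<rfloor> / 2 ^ n \<le> u"
    "0 \<le> u \<Longrightarrow> 0 \<le> \<lfloor>2 ^ n * u\<rfloor> / 2 ^ n"
proof -
  show le: "\<lfloor>2 ^ n * u\<rfloor> / 2 ^ n \<le> u" for n
    by (simp add: divide_le_eq mult.commute)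
  have ge: "u - 1 / 2 ^ n \<le> \<lfloor>2 ^ n * u\<rfloor> / 2 ^ n" for n
  proof -
    have "2 ^ n * u - 1 \<le> \<lfloor>2 ^ n * u\<rfloor>" by linarith
    then have "(2 ^ n * u - 1) / 2 ^ n \<le> \<lfloor>2 ^ n * u\<rfloor> / 2 ^ n"
      by (intro divide_right_mono) auto
    then show ?thesis by (simp add: diff_divide_distrib)
  qed
  have L: "(\<lambda>n. u - 1 / 2 ^ n) \<longlonglongrightarrow> u - 0"
    by (intro tendsto_diff tendsto_const) (simp add: LIMSEQ_divide_realpow_zero)
  then show "(\<lambda>n. \<lfloor>2 ^ n * u\<rfloor> / 2 ^ n) \<longlonglongrightarrow> u"
    using ge le by (intro real_tendsto_sandwich[OF _ _ L[simplified] tendsto_const]) auto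
  show "0 \<le> u \<Longrightarrow> 0 \<le> \<lfloor>2 ^ n * u\<rfloor> / 2 ^ n" by simp
qed

text \<open>Grid points strictly to the right serve right-continuous paths; strictness also leaves
  an interval to the right of \<open>u\<close> on which the floor does not change.\<close>

lemma floor_grid_strict:
  fixes u :: real
  shows "(\<lambda>n. (\<lfloor>2 ^ n * u\<rfloor> + 1) / 2 ^ n) \<longlonglongrightarrow> u" "u < (\<lfloor>2 ^ n * u\<rfloor> + 1) / 2 ^ n"
proof -
  have "(\<lambda>n. \<lfloor>2 ^ n * u\<rfloor> / 2 ^ n + 1 / 2 ^ n) \<longlonglongrightarrow> u + 0"
    by (intro tendsto_add floor_grid) (simp add: LIMSEQ_divide_realpow_zero)
  then show "(\<lambda>n. (\<lfloor>2 ^ n * u\<rfloor> + 1) / 2 ^ n) \<longlonglongrightarrow> u"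
    by (simp add: add_divide_distrib)
  have "2 ^ n * u < \<lfloor>2 ^ n * u\<rfloor> + 1" by linarith
  then show "u < (\<lfloor>2 ^ n * u\<rfloor> + 1) / 2 ^ n"
    by (simp add: less_divide_eq mult.commute)
qed

lemma continuous_at_left_LIMSEQ:
  fixes f :: "real \<Rightarrow> real"
  assumes f: "continuous (at_left u) f" and a: "a \<longlonglongrightarrow> u" "\<And>n. a n \<le> u"
  shows "(\<lambda>n. f (a n)) \<longlonglongrightarrow> f u"
proof (rule topological_tendstoI)
  fix S assume S: "open S" "f u \<in> S"
  have "(f \<longlongrightarrow> f u) (at_left u)" using f by (simp add: continuous_within)
  from topological_tendstoD[OF this S] obtain b where b: "b < u" "\<And>y. b < y \<Longrightarrow> y < u \<Longrightarrow> f y \<in> S"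
    by (auto simp: eventually_at_left_field)
  from order_tendstoD(1)[OF a(1) b(1)] show "\<forall>\<^sub>F n in sequentially. f (a n) \<in> S"
  proof eventually_elim
    case (elim n)
    \<comment> \<open>The filter \<open>at_left u\<close> omits \<open>u\<close> itself, but the
      sequence may hit it; there membership in \<open>S\<close> is immediate.\<close>
    then show ?case using a(2)[of n] b(2)[of "a n"] S by (cases "a n = u") auto
  qed
qed

lemma continuous_at_right_LIMSEQ:
  fixes f :: "real \<Rightarrow> real"
  assumes f: "continuous (at_right u) f" and a: "a \<longlonglongrightarrow> u" "\<And>n. u \<le> a n"
  shows "(\<lambda>n. f (a n)) \<longlonglongrightarrow> f u"
proof (rule topological_tendstoI)
  fix S assume S: "open S" "f u \<in> S"
  have "(f \<longlongrightarrow> f u) (at_right u)" using f by (simp add: continuous_within)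
  from topological_tendstoD[OF this S] obtain b where b: "u < b" "\<And>y. u < y \<Longrightarrow> y < b \<Longrightarrow> f y \<in> S"
    by (auto simp: eventually_at_right_field)
  from order_tendstoD(2)[OF a(1) b(1)] show "\<forall>\<^sub>F n in sequentially. f (a n) \<in> S"
  proof eventually_elim
    case (elim n)
    then show ?case using a(2)[of n] b(2)[of "a n"] S by (cases "a n = u") auto
  qed
qed

lemma continuous_on_sides:
  assumes "continuous_on {0..} f"
  shows "0 < t \<Longrightarrow> continuous (at_left t) f" "0 \<le> t \<Longrightarrow> continuous (at_right t) (f :: real \<Rightarrow> real)"
proof -
  show "continuous (at_left t) f" if "0 < t"
  proof -
    have "continuous_on {0<..} f" by (rule continuous_on_subset[OF assms]) auto
    then have "continuous (at t) f"
      using that continuous_on_eq_continuous_at[OF open_greaterThan] by blast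
    then show ?thesis by (rule continuous_at_imp_continuous_within)
  qed
  show "continuous (at_right t) f" if "0 \<le> t"
  proof -
    have "continuous (at t within {0..}) f"
      using assms that by (simp add: continuous_on_eq_continuous_within)
    then show ?thesis by (rule continuous_within_subset) (use that in auto)
  qed
qed

text \<open>The floor is locally constant on either side of \<open>t\<close>, so this is a step
  function whatever \<open>f\<close> is. The left limit sits at the index
  \<open>\<lceil>2 ^ n * t\<rceil> - 1\<close>, which differs from the floor exactly when
  \<open>t\<close> is a grid point.\<close>

lemma cadlag_floor_grid: "cadlag (\<lambda>t. f (\<lfloor>2 ^ n * t\<rfloor> / 2 ^ n))"
proof -
  have R: "\<forall>\<^sub>F s in at_right t. \<lfloor>2 ^ n * s\<rfloor> = \<lfloor>2 ^ n * t\<rfloor>" for t :: real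
  proof -
    have "\<lfloor>2 ^ n * s\<rfloor> = \<lfloor>2 ^ n * t\<rfloor>" if "t < s" "s < (\<lfloor>2 ^ n * t\<rfloor> + 1) / 2 ^ n" for s
    proof -
      have "2 ^ n * t < 2 ^ n * s" "2 ^ n * s < \<lfloor>2 ^ n * t\<rfloor> + 1"
        using that by (simp_all add: less_divide_eq mult.commute)
      then show ?thesis by linarith
    qed
    then show ?thesis
      using floor_grid_strict(2)[of t n] by (auto simp: eventually_at_right_field)
  qed
  have L: "\<forall>\<^sub>F s in at_left t. \<lfloor>2 ^ n * s\<rfloor> = \<lceil>2 ^ n * t\<rceil> - 1" for t :: real
  proof -
    have "\<lfloor>2 ^ n * s\<rfloor> = \<lceil>2 ^ n * t\<rceil> - 1" if "s < t" "(\<lceil>2 ^ n * t\<rceil> - 1) / 2 ^ n < s" for s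
    proof -
      have "2 ^ n * s < 2 ^ n * t" "\<lceil>2 ^ n * t\<rceil> - 1 < 2 ^ n * s"
        using that by (simp_all add: divide_less_eq mult.commute)
      then show ?thesis by linarith
    qed
    moreover have "(\<lceil>2 ^ n * t\<rceil> - 1) / 2 ^ n < t"
      by (simp add: divide_less_eq mult.commute) linarith
    ultimately show ?thesis by (auto simp: eventually_at_left_field)
  qed
  show ?thesis
    unfolding cadlag_def continuous_within
  proof (intro conjI allI impI)
    fix t :: real
    show "((\<lambda>t. f (\<lfloor>2 ^ n * t\<rfloor> / 2 ^ n)) \<longlongrightarrow> f (\<lfloor>2 ^ n * t\<rfloor> / 2 ^ n)) (at_right t)"
      by (rule tendsto_eventually) (use R[of t] in eventually_elim, simp)
    show "\<exists>l. ((\<lambda>t. f (\<lfloor>2 ^ n * t\<rfloor> / 2 ^ n)) \<longlongrightarrow> l) (at_left t)"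
      by (intro exI[of _ "f (real_of_int (\<lceil>2 ^ n * t\<rceil> - 1) / 2 ^ n)"] tendsto_eventually)
         (use L[of t] in eventually_elim, simp)
  qed
qed

text \<open>These are exactly the processes that generate \<open>predictable_sigma\<close>.\<close>

definition left_process :: "'a measure \<Rightarrow> (real \<Rightarrow> 'a measure) \<Rightarrow> (real \<Rightarrow> 'a \<Rightarrow> real) \<Rightarrow> bool" where
  "left_process M F X \<longleftrightarrow>
     adapted F X \<and> (\<forall>\<omega>\<in>space M. \<forall>t>0. continuous (at_left t) (\<lambda>s. X s \<omega>))"

section \<open>Filtrations under the usual conditions\<close>

locale stochastic_basis = prob_space M for M :: "'a measure" +
  fixes F :: "real \<Rightarrow> 'a measure"
  assumes usual: "usual_filtration M F"
begin

lemma filtration_F: "filtration (space M) F"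
  using usual unfolding usual_filtration_def by (elim conjE)

lemma subalgebra_F: "subalgebra M (F t)"
  using usual unfolding usual_filtration_def by (elim conjE allE)

lemma space_F [simp]: "space (F t) = space M"
  by (rule filtration.space_F[OF filtration_F])

lemma sets_F_subset: "sets (F t) \<subseteq> sets M"
  using subalgebra_F by (simp add: subalgebra_def)

lemma sets_F_mono: "s \<le> t \<Longrightarrow> sets (F s) \<subseteq> sets (F t)"
  by (rule filtration.sets_F_mono[OF filtration_F])

lemma measurable_F_mono: "f \<in> measurable (F s) N \<Longrightarrow> s \<le> t \<Longrightarrow> f \<in> measurable (F t) N"
  using sets_F_mono[of s t] by (auto simp: measurable_def)

lemma measurable_F_M: "f \<in> measurable (F s) N \<Longrightarrow> f \<in> measurable M N"
  using sets_F_subset[of s] by (auto simp: measurable_def)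

lemma sets_F_rightI:
  assumes "0 \<le> t" "\<And>s. t < s \<Longrightarrow> A \<in> sets (F s)"
  shows "A \<in> sets (F t)"
proof -
  have "sets (F t) = (\<Inter>s\<in>{t<..}. sets (F s))"
    using usual assms(1) unfolding usual_filtration_def by (elim conjE) (drule spec[of "\<lambda>t. 0 \<le> t \<longrightarrow> _ t"], erule mp)
  then show ?thesis using assms(2) by blast
qed

lemma null_set_in_F: "A \<subseteq> B \<Longrightarrow> B \<in> null_sets M \<Longrightarrow> 0 \<le> t \<Longrightarrow> A \<in> sets (F t)"
proof -
  assume A: "A \<subseteq> B" "B \<in> null_sets M" "0 \<le> t"
  have "complete_measure M" using usual unfolding usual_filtration_def by (elim conjE)
  moreover have "null_sets M \<subseteq> sets (F 0)" using usual unfolding usual_filtration_def by (elim conjE)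
  ultimately show ?thesis
    using A complete_measure.complete2[of M A B] sets_F_mono[of 0 t] by blast
qed

text \<open>Completeness, together with the null sets being in \<open>F 0\<close>, puts every almost
  sure event into each \<open>F t\<close>. This is what allows exceptional paths to be redefined
  without losing adaptedness.\<close>

lemma AE_set_in_F:
  assumes "AE \<omega> in M. Q \<omega>" "0 \<le> t"
  shows "{\<omega>\<in>space M. Q \<omega>} \<in> sets (F t)"
proof -
  from assms(1) obtain N where "{\<omega>\<in>space M. \<not> Q \<omega>} \<subseteq> N" "N \<in> null_sets M"
    by (auto elim!: AE_E simp: null_sets_def)
  then have "{\<omega>\<in>space M. \<not> Q \<omega>} \<in> sets (F t)" using null_set_in_F assms(2) by blast
  then have "space (F t) - {\<omega>\<in>space M. \<not> Q \<omega>} \<in> sets (F t)" by (rule sets.compl_sets)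
  moreover have "space (F t) - {\<omega>\<in>space M. \<not> Q \<omega>} = {\<omega>\<in>space M. Q \<omega>}" by auto
  ultimately show ?thesis by simp
qed

lemma measurable_F_AE_cong:
  fixes f g :: "'a \<Rightarrow> 'b::topological_space"
  assumes f: "f \<in> borel_measurable (F t)" and ae: "AE \<omega> in M. f \<omega> = g \<omega>" and t: "0 \<le> t"
  shows "g \<in> borel_measurable (F t)"
proof (rule measurableI)
  fix A :: "'b set" assume A: "A \<in> sets borel"
  let ?E = "{\<omega>\<in>space M. f \<omega> = g \<omega>}"
  have E: "?E \<in> sets (F t)" by (rule AE_set_in_F[OF ae t])
  from ae obtain N where "{\<omega>\<in>space M. f \<omega> \<noteq> g \<omega>} \<subseteq> N" "N \<in> null_sets M"
    by (auto elim!: AE_E simp: null_sets_def)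
  then have "(g -` A \<inter> space M) - ?E \<in> sets (F t)"
    by (intro null_set_in_F[of _ N]) (use t in auto)
  moreover have "(f -` A \<inter> space M) \<inter> ?E \<in> sets (F t)"
    using sets.Int[OF measurable_sets[OF f A] E] by simp
  moreover have "g -` A \<inter> space M = ((g -` A \<inter> space M) - ?E) \<union> ((f -` A \<inter> space M) \<inter> ?E)" by auto
  ultimately show "g -` A \<inter> space (F t) \<in> sets (F t)"
    using sets.Un[of "g -` A \<inter> space M - ?E" "F t" "f -` A \<inter> space M \<inter> ?E"] by simp
qed simp

section \<open>Predictable and optional sigma-fields\<close>

lemma space_predictable [simp]: "space (predictable_sigma M F) = space M \<times> {0..}"
  unfolding predictable_sigma_def by (rule space_measure_of) auto

lemma space_optional [simp]: "space (optional_sigma M F) = space M \<times> {0..}"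
  unfolding optional_sigma_def by (rule space_measure_of) auto

lemma left_process_predictable:
  assumes "left_process M F X"
  shows "(\<lambda>(\<omega>, t). X t \<omega>) \<in> borel_measurable (predictable_sigma M F)"
proof (rule measurableI)
  fix B :: "real set" assume B: "B \<in> sets borel"
  have "(\<lambda>(\<omega>, t). X t \<omega>) -` B \<inter> space (predictable_sigma M F)
      = {(\<omega>, t). \<omega> \<in> space M \<and> 0 \<le> t \<and> X t \<omega> \<in> B}" by auto
  also have "\<dots> \<in> sets (predictable_sigma M F)"
    unfolding predictable_sigma_def
    by (rule in_measure_of) (use assms B in \<open>auto simp: left_process_def\<close>)
  finally show "(\<lambda>(\<omega>, t). X t \<omega>) -` B \<inter> space (predictable_sigma M F) \<in> sets (predictable_sigma M F)" .
qed simp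

lemma cadlag_optional:
  assumes "adapted F X" "\<And>\<omega>. \<omega> \<in> space M \<Longrightarrow> cadlag (\<lambda>t. X t \<omega>)"
  shows "(\<lambda>(\<omega>, t). X t \<omega>) \<in> borel_measurable (optional_sigma M F)"
proof (rule measurableI)
  fix B :: "real set" assume B: "B \<in> sets borel"
  have "(\<lambda>(\<omega>, t). X t \<omega>) -` B \<inter> space (optional_sigma M F)
      = {(\<omega>, t). \<omega> \<in> space M \<and> 0 \<le> t \<and> X t \<omega> \<in> B}" by auto
  also have "\<dots> \<in> sets (optional_sigma M F)"
    unfolding optional_sigma_def
    by (rule in_measure_of) (use assms B in auto)
  finally show "(\<lambda>(\<omega>, t). X t \<omega>) -` B \<inter> space (optional_sigma M F) \<in> sets (optional_sigma M F)" .
qed simp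

lemma left_process_LIMSEQ:
  assumes "left_process M F X" "\<omega> \<in> space M" "0 \<le> t"
  shows "(\<lambda>n. X (\<lfloor>2 ^ n * t\<rfloor> / 2 ^ n) \<omega>) \<longlonglongrightarrow> X t \<omega>"
proof (cases "t = 0")
  case False
  with assms have "continuous (at_left t) (\<lambda>s. X s \<omega>)" by (simp add: left_process_def)
  then show ?thesis by (rule continuous_at_left_LIMSEQ) (rule floor_grid)+
qed simp

text \<open>Freezing a left-continuous process at the last dyadic time gives a right-continuous step
  process, adapted because the dyadic time does not exceed \<open>t\<close>; the limit recovers the
  process. Hence predictable processes are optional.\<close>

lemma left_process_optional:
  assumes X: "left_process M F X"
  shows "(\<lambda>(\<omega>, t). X t \<omega>) \<in> borel_measurable (optional_sigma M F)"
proof (rule borel_measurable_LIMSEQ_real)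
  let ?X = "\<lambda>n t \<omega>. X (\<lfloor>2 ^ n * t\<rfloor> / 2 ^ n) \<omega>"
  show "(\<lambda>n. (\<lambda>(\<omega>, t). ?X n t \<omega>) z) \<longlonglongrightarrow> (\<lambda>(\<omega>, t). X t \<omega>) z"
    if "z \<in> space (optional_sigma M F)" for z
    using that left_process_LIMSEQ[OF X] by (auto split: prod.split)
  show "(\<lambda>(\<omega>, t). ?X n t \<omega>) \<in> borel_measurable (optional_sigma M F)" for n
  proof (rule cadlag_optional)
    show "adapted F (?X n)"
      unfolding adapted_def
    proof (intro allI impI)
      fix t :: real assume t: "0 \<le> t"
      have "X (\<lfloor>2 ^ n * t\<rfloor> / 2 ^ n) \<in> borel_measurable (F (\<lfloor>2 ^ n * t\<rfloor> / 2 ^ n))"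
        using X floor_grid(3)[OF t] by (simp add: left_process_def adapted_def)
      then show "?X n t \<in> borel_measurable (F t)"
        by (rule measurable_F_mono) (rule floor_grid)
    qed
  qed (rule cadlag_floor_grid)
qed

lemma measurable_from_predictable_to_optional:
  "(\<lambda>z. z) \<in> measurable (optional_sigma M F) (predictable_sigma M F)"
proof -
  have "(\<lambda>z. z) -` A \<inter> space (optional_sigma M F) \<in> sets (optional_sigma M F)"
    if "A = {(\<omega>, t). \<omega> \<in> space M \<and> 0 \<le> t \<and> X t \<omega> \<in> B}" "left_process M F X" "B \<in> sets borel" for A X B
  proof -
    have "(\<lambda>z. z) -` A \<inter> space (optional_sigma M F) = (\<lambda>(\<omega>, t). X t \<omega>) -` B \<inter> space (optional_sigma M F)"
      using that(1) by auto
    then show ?thesis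
      using measurable_sets[OF left_process_optional[OF that(2)] that(3)] by simp
  qed
  then show ?thesis
    unfolding predictable_sigma_def
    by (intro measurable_measure_of) (auto simp: left_process_def)
qed

lemma measurable_optional_if_predictable:
  "f \<in> measurable (predictable_sigma M F) N \<Longrightarrow> f \<in> measurable (optional_sigma M F) N"
  by (rule measurable_compose[OF measurable_from_predictable_to_optional])

text \<open>\<open>I\<close> is an initial piece of the time axis and \<open>N\<close> contains
  every \<open>F u\<close> with \<open>u\<close> in \<open>I\<close>. With \<open>I = {0..t}\<close>
  and \<open>N = F t\<close> this is progressive measurability, with \<open>I = {0..}\<close> and
  \<open>N = M\<close> joint measurability. \<open>I\<close> is closed downwards because the dyadic
  approximation evaluates a process at earlier times.\<close>

lemma measurable_id_predictable:
  assumes N: "space N = space M" "\<And>u. u \<in> I \<Longrightarrow> sets (F u) \<subseteq> sets N"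
    and I: "I \<subseteq> {0..}" "\<And>u v. u \<in> I \<Longrightarrow> 0 \<le> v \<Longrightarrow> v \<le> u \<Longrightarrow> v \<in> I"
  shows "(\<lambda>z. z) \<in> measurable (restrict_space (N \<Otimes>\<^sub>M borel) (space N \<times> I)) (predictable_sigma M F)"
proof -
  let ?R = "restrict_space (N \<Otimes>\<^sub>M borel) (space N \<times> I)"
  have sp: "space ?R = space M \<times> I"
    using N by (auto simp: space_restrict_space space_pair_measure)
  have "(\<lambda>z. z) -` A \<inter> space ?R \<in> sets ?R"
    if A: "A = {(\<omega>, t). \<omega> \<in> space M \<and> 0 \<le> t \<and> X t \<omega> \<in> B}" and X: "left_process M F X" and B: "B \<in> sets borel"
    for A X B
  proof -
    have "(\<lambda>(\<omega>, t). X t \<omega>) \<in> borel_measurable ?R"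
    proof (rule borel_measurable_LIMSEQ_real)
      let ?X = "\<lambda>n t \<omega>. X (\<lfloor>2 ^ n * t\<rfloor> / 2 ^ n) \<omega>"
      show "(\<lambda>n. (\<lambda>(\<omega>, t). ?X n t \<omega>) z) \<longlonglongrightarrow> (\<lambda>(\<omega>, t). X t \<omega>) z" if "z \<in> space ?R" for z
        using that left_process_LIMSEQ[OF X] I(1) unfolding sp by (auto split: prod.split)
      fix n
      \<comment> \<open>Only these grid indices occur on \<open>space ?R\<close>; at other grid
        times the value of \<open>X\<close> need not be \<open>N\<close>-measurable.\<close>
      let ?J = "{j::int. j / 2 ^ n \<in> I}"
      have snd: "snd \<in> borel_measurable ?R"
        by (rule measurable_restrict_space1) simp
      have "(\<lambda>z. X (real_of_int \<lfloor>2 ^ n * snd z\<rfloor> / 2 ^ n) (fst z)) \<in> borel_measurable ?R"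
      proof (rule measurable_compose_countable'[where I = ?J and f = "\<lambda>j z. X (real_of_int j / 2 ^ n) (fst z)"
            and g = "\<lambda>z. \<lfloor>2 ^ n * snd z\<rfloor>"])
        show "countable ?J" by simp
        have "(\<lambda>z. \<lfloor>2 ^ n * snd z\<rfloor>) \<in> measurable ?R (count_space UNIV)"
          using snd by measurable
        moreover have "\<lfloor>2 ^ n * snd z\<rfloor> \<in> ?J" if "z \<in> space ?R" for z
          using that I(1) I(2)[of "snd z" "real_of_int \<lfloor>2 ^ n * snd z\<rfloor> / 2 ^ n"] floor_grid(2,3)[where u="snd z" and n=n]
          unfolding sp by auto
        ultimately have "(\<lambda>z. \<lfloor>2 ^ n * snd z\<rfloor>) \<in> measurable ?R (restrict_space (count_space UNIV) ?J)"
          by (intro measurable_restrict_space2) auto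
        then show "(\<lambda>z. \<lfloor>2 ^ n * snd z\<rfloor>) \<in> measurable ?R (count_space ?J)"
          by (simp add: restrict_count_space)
        fix j assume j: "j \<in> ?J"
        then have "0 \<le> real_of_int j / 2 ^ n" using I(1) by blast
        then have "X (real_of_int j / 2 ^ n) \<in> borel_measurable (F (real_of_int j / 2 ^ n))"
          using X unfolding left_process_def adapted_def by blast
        moreover have "subalgebra N (F (real_of_int j / 2 ^ n))"
          using N j unfolding subalgebra_def by simp
        ultimately have "X (real_of_int j / 2 ^ n) \<in> borel_measurable N"
          by (rule measurable_from_subalg[rotated])
        then show "(\<lambda>z. X (real_of_int j / 2 ^ n) (fst z)) \<in> borel_measurable ?R"
          by (intro measurable_restrict_space1 measurable_compose[OF measurable_fst])
      qed
      then show "(\<lambda>(\<omega>, t). ?X n t \<omega>) \<in> borel_measurable ?R" by (simp add: split_beta')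
    qed
    from measurable_sets[OF this B]
    have "(\<lambda>(\<omega>, t). X t \<omega>) -` B \<inter> space ?R \<in> sets ?R" .
    moreover have "(\<lambda>z. z) -` A \<inter> space ?R = (\<lambda>(\<omega>, t). X t \<omega>) -` B \<inter> space ?R"
      using A I(1) unfolding sp by auto
    ultimately show ?thesis by simp
  qed
  moreover have "(\<lambda>z. z) \<in> space ?R \<rightarrow> space M \<times> {0..}"
    using I(1) unfolding sp by auto
  ultimately show ?thesis
    unfolding predictable_sigma_def
    by (intro measurable_measure_of) (auto simp: left_process_def)
qed

text \<open>Multiplying by the indicator extends the function from the restricted space to the whole
  product, the shape in which Tonelli's theorem over \<open>lborel\<close> is applied.\<close>

lemma predictable_times_indicator:
  fixes f :: "'a \<times> real \<Rightarrow> ennreal"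
  assumes f: "f \<in> borel_measurable (predictable_sigma M F)"
    and N: "space N = space M" "\<And>u. u \<in> I \<Longrightarrow> sets (F u) \<subseteq> sets N"
    and I: "I \<in> sets borel" "I \<subseteq> {0..}" "\<And>u v. u \<in> I \<Longrightarrow> 0 \<le> v \<Longrightarrow> v \<le> u \<Longrightarrow> v \<in> I"
  shows "(\<lambda>(\<omega>, u). f (\<omega>, u) * indicator I u) \<in> borel_measurable (N \<Otimes>\<^sub>M borel)"
proof -
  have "f \<in> borel_measurable (restrict_space (N \<Otimes>\<^sub>M borel) (space N \<times> I))"
    by (rule measurable_compose[OF measurable_id_predictable[OF N I(2,3)] f])
  moreover have "space N \<times> I \<in> sets (N \<Otimes>\<^sub>M borel)" using I(1) by simp
  ultimately have "(\<lambda>z. f z * indicator (space N \<times> I) z) \<in> borel_measurable (N \<Otimes>\<^sub>M borel)"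
    by (subst (asm) borel_measurable_restrict_space_iff_ennreal) auto
  then show ?thesis
    by (rule measurable_cong[THEN iffD1, rotated])
       (auto simp: space_pair_measure indicator_def split: if_splits)
qed

lemma predictable_progressive:
  fixes f :: "'a \<times> real \<Rightarrow> ennreal"
  assumes f: "f \<in> borel_measurable (predictable_sigma M F)"
  shows "(\<lambda>(\<omega>, u). f (\<omega>, u) * indicator {0..t} u) \<in> borel_measurable (F t \<Otimes>\<^sub>M borel)"
  using sets_F_mono by (intro predictable_times_indicator[OF f]) auto

lemma predictable_joint:
  fixes f :: "'a \<times> real \<Rightarrow> ennreal"
  assumes f: "f \<in> borel_measurable (predictable_sigma M F)"
  shows "(\<lambda>(\<omega>, u). f (\<omega>, u) * indicator {0..} u) \<in> borel_measurable (M \<Otimes>\<^sub>M borel)"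
  using sets_F_subset by (intro predictable_times_indicator[OF f]) auto

lemma predictable_path:
  assumes "f \<in> borel_measurable (predictable_sigma M F)" "\<omega> \<in> space M"
  shows "(\<lambda>u. f (\<omega>, u) * indicator {0..} u :: ennreal) \<in> borel_measurable borel"
  using measurable_compose[OF measurable_Pair1'[OF assms(2)] predictable_joint[OF assms(1)]] by simp

lemma measurable_Pair_predictable_time:
  assumes "0 \<le> t"
  shows "(\<lambda>\<omega>. (\<omega>, t)) \<in> measurable (F t) (predictable_sigma M F)"
proof -
  have "(\<lambda>\<omega>. (\<omega>, t)) \<in> measurable (F t) (restrict_space (F t \<Otimes>\<^sub>M borel) (space (F t) \<times> {0..t}))"
    using assms by (intro measurable_restrict_space2) auto
  from measurable_compose[OF this measurable_id_predictable] show ?thesis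
    using sets_F_mono by auto
qed

lemma measurable_Pair_predictable_path:
  assumes "\<omega> \<in> space M"
  shows "Pair \<omega> \<in> measurable (restrict_space borel {0..}) (predictable_sigma M F)"
proof -
  have "Pair \<omega> \<in> measurable (restrict_space borel {0..}) (restrict_space (M \<Otimes>\<^sub>M borel) (space M \<times> {0..}))"
    using assms by (intro measurable_restrict_space2 measurable_Pair1' measurable_restrict_space1)
      (auto simp: space_restrict_space)
  from measurable_compose[OF this measurable_id_predictable] show ?thesis
    using sets_F_subset by auto
qed

lemma measurable_Pair_optional_time:
  assumes "0 \<le> t"
  shows "(\<lambda>\<omega>. (\<omega>, t)) \<in> measurable (F t) (optional_sigma M F)"
  unfolding optional_sigma_def
proof (rule measurable_measure_of)
  fix y
  assume "y \<in> {{(\<omega>, t). \<omega> \<in> space M \<and> 0 \<le> t \<and> X t \<omega> \<in> B} |X B.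
        adapted F X \<and> (\<forall>\<omega>\<in>space M. cadlag (\<lambda>t. X t \<omega>)) \<and> B \<in> sets borel}"
  then obtain X B where y: "y = {(\<omega>, t). \<omega> \<in> space M \<and> 0 \<le> t \<and> X t \<omega> \<in> B}"
    and "adapted F X" and B: "B \<in> sets borel" by auto
  then have "X t \<in> borel_measurable (F t)" using assms by (simp add: adapted_def)
  from measurable_sets[OF this B] show "(\<lambda>\<omega>. (\<omega>, t)) -` y \<inter> space (F t) \<in> sets (F t)"
    using assms by (auto simp: y vimage_def Int_def conj_commute)
qed (use assms in auto)

lemma measurable_snd_predictable: "snd \<in> borel_measurable (predictable_sigma M F)"
proof -
  have "left_process M F (\<lambda>t \<omega>. t)" by (auto simp: left_process_def adapted_def)
  from left_process_predictable[OF this] show ?thesis by (simp add: split_beta')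
qed

end


section \<open>Optional sampling of the continuous factor\<close>

text \<open>Completing the square: tilting the density of variance \<open>v\<close> by
  \<open>exp (a * x)\<close> moves its mean to \<open>a * v\<close> and leaves the factor
  \<open>exp (a\<^sup>2 * v / 2)\<close>.\<close>

lemma (in prob_space) nn_integral_exp_normal:
  assumes D: "distributed M lborel D (normal_density 0 (sqrt v))" and v: "0 < v"
  shows "(\<integral>\<^sup>+\<omega>. ennreal (exp (a * D \<omega>)) \<partial>M) = ennreal (exp (a\<^sup>2 * v / 2))"
proof -
  have eq: "normal_density 0 (sqrt v) x * exp (a * x) = exp (a\<^sup>2 * v / 2) * normal_density (a * v) (sqrt v) x" for x
  proof -
    have "- (x\<^sup>2 / (2 * v)) + a * x = a\<^sup>2 * v / 2 - (x - a * v)\<^sup>2 / (2 * v)"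
      using v by (simp add: field_simps power2_eq_square)
    then have "exp (- (x\<^sup>2 / (2 * v))) * exp (a * x) = exp (a\<^sup>2 * v / 2) * exp (- ((x - a * v)\<^sup>2 / (2 * v)))"
      by (simp add: exp_add[symmetric])
    then show ?thesis using v by (simp add: normal_density_def)
  qed
  have "(\<integral>\<^sup>+\<omega>. ennreal (exp (a * D \<omega>)) \<partial>M)
      = (\<integral>\<^sup>+x. ennreal (normal_density 0 (sqrt v) x) * ennreal (exp (a * x)) \<partial>lborel)"
    by (rule distributed_nn_integral[OF D, symmetric]) simp
  also have "\<dots> = (\<integral>\<^sup>+x. ennreal (exp (a\<^sup>2 * v / 2)) * ennreal (normal_density (a * v) (sqrt v) x) \<partial>lborel)"
    by (simp add: ennreal_mult'[symmetric] eq)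
  also have "\<dots> = ennreal (exp (a\<^sup>2 * v / 2)) * (\<integral>\<^sup>+x. ennreal (normal_density (a * v) (sqrt v) x) \<partial>lborel)"
    by (rule nn_integral_cmult) simp
  also have "(\<integral>\<^sup>+x. ennreal (normal_density (a * v) (sqrt v) x) \<partial>lborel) = 1"
    using v by (subst nn_integral_eq_integral) auto
  finally show ?thesis by simp
qed

text \<open>Independence makes the joint law of \<open>f\<close> and \<open>g (D \<omega>)\<close> a
  product measure, and Tonelli factors the integral. Everything is in \<open>ennreal\<close>, so
  that \<open>f\<close> may be a weight of unknown integrability.\<close>

lemma (in prob_space) nn_integral_indep_mult:
  fixes f g :: "_ \<Rightarrow> ennreal"
  assumes N: "subalgebra M N" and D: "D \<in> borel_measurable M"
    and indep: "indep_set (sets N) (sets (vimage_algebra (space M) D borel))"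
    and f: "f \<in> borel_measurable N" and g: "g \<in> borel_measurable borel"
  shows "(\<integral>\<^sup>+\<omega>. g (D \<omega>) * f \<omega> \<partial>M) = (\<integral>\<^sup>+\<omega>. g (D \<omega>) \<partial>M) * (\<integral>\<^sup>+\<omega>. f \<omega> \<partial>M)"
proof -
  let ?D = "\<lambda>\<omega>. g (D \<omega>)"
  have f': "f \<in> borel_measurable M" by (rule measurable_from_subalg[OF N f])
  have D': "?D \<in> borel_measurable M" using D g by measurable
  have "sigma_sets (space M) {f -` A \<inter> space M |A. A \<in> sets borel} \<subseteq> sets N"
    using N measurable_sets[OF f] sets.sigma_sets_subset[of "{f -` A \<inter> space M |A. A \<in> sets borel}" N]
    by (auto simp: subalgebra_def)
  moreover have "sigma_sets (space M) {?D -` A \<inter> space M |A. A \<in> sets borel}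
      \<subseteq> sets (vimage_algebra (space M) D borel)"
  proof -
    have "?D -` A \<inter> space M \<in> sets (vimage_algebra (space M) D borel)" if "A \<in> sets borel" for A
    proof -
      have "?D -` A \<inter> space M = D -` (g -` A) \<inter> space M" by auto
      moreover have "g -` A \<in> sets borel" using measurable_sets[OF g that] by simp
      ultimately show ?thesis by (simp add: in_vimage_algebra)
    qed
    then show ?thesis
      using sets.sigma_sets_subset[of "{?D -` A \<inter> space M |A. A \<in> sets borel}" "vimage_algebra (space M) D borel"]
      by auto
  qed
  ultimately have "indep_var borel f borel ?D"
    using indep f' D' unfolding indep_var_eq indep_sets2_eq by blast
  then have distr: "distr M borel f \<Otimes>\<^sub>M distr M borel ?D = distr M (borel \<Otimes>\<^sub>M borel) (\<lambda>\<omega>. (f \<omega>, ?D \<omega>))"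
    by (simp add: indep_var_distribution_eq)
  interpret N': prob_space "distr M borel f" by (rule prob_space_distr[OF f'])
  interpret D': prob_space "distr M borel ?D" by (rule prob_space_distr[OF D'])
  have m: "(\<lambda>z. snd z * fst z :: ennreal) \<in> borel_measurable (borel \<Otimes>\<^sub>M borel)" by measurable
  have p: "(\<lambda>\<omega>. (f \<omega>, ?D \<omega>)) \<in> measurable M (borel \<Otimes>\<^sub>M borel)"
    using f' D' by measurable
  have "(\<integral>\<^sup>+\<omega>. ?D \<omega> * f \<omega> \<partial>M) = (\<integral>\<^sup>+z. snd z * fst z \<partial>distr M (borel \<Otimes>\<^sub>M borel) (\<lambda>\<omega>. (f \<omega>, ?D \<omega>)))"
    using m by (subst nn_integral_distr[OF p]) simp_all
  also have "\<dots> = (\<integral>\<^sup>+z. snd z * fst z \<partial>(distr M borel f \<Otimes>\<^sub>M distr M borel ?D))"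
    by (simp add: distr)
  also have "\<dots> = (\<integral>\<^sup>+x. \<integral>\<^sup>+y. y * x \<partial>distr M borel ?D \<partial>distr M borel f)"
    using m by (subst D'.nn_integral_fst[symmetric]) (auto cong: measurable_cong_sets sets_pair_measure_cong)
  also have "\<dots> = (\<integral>\<^sup>+x. (\<integral>\<^sup>+\<omega>. ?D \<omega> \<partial>M) * x \<partial>distr M borel f)"
    using D' by (intro nn_integral_cong) (simp add: nn_integral_multc nn_integral_distr)
  also have "\<dots> = (\<integral>\<^sup>+\<omega>. ?D \<omega> \<partial>M) * (\<integral>\<^sup>+\<omega>. f \<omega> \<partial>M)"
    using f' by (simp add: nn_integral_cmult nn_integral_distr)
  finally show ?thesis .
qed

context stochastic_basis
begin

text \<open>The increment after \<open>s\<close> is independent of \<open>F s\<close> and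
  contributes its Gaussian exponential moment. A non-negative weight \<open>Y\<close> in place of a
  conditional expectation keeps the identity usable while nothing is known to be integrable.\<close>

lemma brownian_exp:
  fixes Y :: "'a \<Rightarrow> ennreal"
  assumes B: "brownian_motion M F B" and st: "0 \<le> s" "s \<le> t" and Y: "Y \<in> borel_measurable (F s)"
  shows "(\<integral>\<^sup>+\<omega>. ennreal (exp (a * B t \<omega>)) * Y \<omega> \<partial>M)
    = ennreal (exp (a\<^sup>2 * (t - s) / 2)) * (\<integral>\<^sup>+\<omega>. ennreal (exp (a * B s \<omega>)) * Y \<omega> \<partial>M)"
proof (cases "s = t")
  case False
  with st have lt: "s < t" by simp
  let ?D = "\<lambda>\<omega>. B t \<omega> - B s \<omega>"
  have D: "distributed M lborel ?D (normal_density 0 (sqrt (t - s)))"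
    and ind: "indep_set (sets (F s)) (sets (vimage_algebra (space M) ?D borel))"
    using B st lt by (auto simp: brownian_motion_def)
  have Bs: "B s \<in> borel_measurable (F s)" using B st by (simp add: brownian_motion_def adapted_def)
  have "(\<integral>\<^sup>+\<omega>. ennreal (exp (a * B t \<omega>)) * Y \<omega> \<partial>M)
      = (\<integral>\<^sup>+\<omega>. ennreal (exp (a * ?D \<omega>)) * (ennreal (exp (a * B s \<omega>)) * Y \<omega>) \<partial>M)"
    by (simp add: mult.assoc[symmetric] ennreal_mult'[symmetric] exp_add[symmetric] algebra_simps)
  also have "\<dots> = (\<integral>\<^sup>+\<omega>. ennreal (exp (a * ?D \<omega>)) \<partial>M) * (\<integral>\<^sup>+\<omega>. ennreal (exp (a * B s \<omega>)) * Y \<omega> \<partial>M)"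
    using Bs Y distributed_measurable[OF D]
    by (intro nn_integral_indep_mult[OF subalgebra_F _ ind, where g = "\<lambda>x. ennreal (exp (a * x))"]) auto
  also have "(\<integral>\<^sup>+\<omega>. ennreal (exp (a * ?D \<omega>)) \<partial>M) = ennreal (exp (a\<^sup>2 * (t - s) / 2))"
    using lt by (intro nn_integral_exp_normal[OF D]) simp
  finally show ?thesis .
qed simp

end

text \<open>The last two assumptions give uniform integrability, which optional sampling needs.\<close>

locale square_integrable_martingale = stochastic_basis +
  fixes L :: "real \<Rightarrow> 'a \<Rightarrow> real"
  assumes L_adapted: "adapted F L"
    and L_cont: "\<And>\<omega>. \<omega> \<in> space M \<Longrightarrow> continuous_on {0..} (\<lambda>t. L t \<omega>)"
    and L_nonneg: "\<And>t \<omega>. 0 \<le> L t \<omega>"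
    and L_mart: "\<And>s t Y. 0 \<le> s \<Longrightarrow> s \<le> t \<Longrightarrow> Y \<in> borel_measurable (F s) \<Longrightarrow>
      (\<integral>\<^sup>+\<omega>. ennreal (L t \<omega>) * Y \<omega> \<partial>M) = (\<integral>\<^sup>+\<omega>. ennreal (L s \<omega>) * Y \<omega> \<partial>M)"
    and L_square: "\<And>s t Y. 0 \<le> s \<Longrightarrow> s \<le> t \<Longrightarrow> Y \<in> borel_measurable (F s) \<Longrightarrow>
      (\<integral>\<^sup>+\<omega>. ennreal ((L s \<omega>)\<^sup>2) * Y \<omega> \<partial>M) \<le> (\<integral>\<^sup>+\<omega>. ennreal ((L t \<omega>)\<^sup>2) * Y \<omega> \<partial>M)"
    and L_square_finite: "\<And>t. 0 \<le> t \<Longrightarrow> (\<integral>\<^sup>+\<omega>. ennreal ((L t \<omega>)\<^sup>2) \<partial>M) < \<infinity>"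
begin

lemma L_left_process: "left_process M F L"
  unfolding left_process_def
proof (intro conjI ballI allI impI L_adapted)
  show "continuous (at_left t) (\<lambda>s. L s \<omega>)" if "\<omega> \<in> space M" "0 < t" for \<omega> t
    by (rule continuous_on_sides(1)[OF L_cont[OF that(1)] that(2)])
qed

lemma L_measurable_F: "0 \<le> t \<Longrightarrow> L t \<in> borel_measurable (F t)"
  using L_adapted by (simp add: adapted_def)

lemma L_measurable: "0 \<le> t \<Longrightarrow> L t \<in> borel_measurable M"
  using measurable_F_M[OF L_measurable_F] .

lemma L_joint: "(\<lambda>(\<omega>, u). ennreal (L u \<omega>) * indicator {0..} u) \<in> borel_measurable (M \<Otimes>\<^sub>M borel)"
  using predictable_joint[of "\<lambda>(\<omega>, u). ennreal (L u \<omega>)"] left_process_predictable[OF L_left_process]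
  by (simp add: split_beta')

end

text \<open>Rescaling the window to \<open>[0, 1)\<close> turns the average into the integral of
  \<open>f (T + s / (n + 1))\<close>, which converges by dominated convergence; the dominating
  constant bounds \<open>f\<close> on the compact interval \<open>[T, T + 1]\<close>.\<close>

lemma nn_integral_average_LIMSEQ:
  fixes f :: "real \<Rightarrow> real"
  assumes f: "continuous_on {0..} f" "0 \<le> T"
  shows "(\<lambda>n. ennreal (real (Suc n)) * (\<integral>\<^sup>+u. ennreal (f u) * indicator {T..<T + 1 / Suc n} u \<partial>lborel))
    \<longlonglongrightarrow> ennreal (f T)"
proof -
  have fb: "(\<lambda>u. ennreal (f u) * indicator {0..} u) \<in> borel_measurable borel"
  proof -
    have "(\<lambda>u. indicator {0..} u *\<^sub>R f u) \<in> borel_measurable borel"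
      using f by (intro borel_measurable_continuous_on_indicator) auto
    then have "(\<lambda>u. ennreal (indicator {0..} u *\<^sub>R f u)) \<in> borel_measurable borel" by measurable
    then show ?thesis by (rule measurable_cong[THEN iffD1, rotated]) (auto simp: indicator_def)
  qed
  \<comment> \<open>The Jacobian \<open>1 / Suc n\<close> of the substitution cancels the factor in
    front.\<close>
  have eq: "ennreal (real (Suc n)) * (\<integral>\<^sup>+u. ennreal (f u) * indicator {T..<T + 1 / Suc n} u \<partial>lborel)
      = (\<integral>\<^sup>+s. ennreal (f (T + 1 / Suc n * s)) * indicator {0..<1} s \<partial>lborel)" for n
  proof -
    have m: "(\<lambda>u. ennreal (f u) * indicator {T..<T + 1 / Suc n} u) \<in> borel_measurable borel"
    proof -
      have "(\<lambda>u. (ennreal (f u) * indicator {0..} u) * indicator {T..<T + 1 / Suc n} u) \<in> borel_measurable borel"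
        using fb by measurable
      moreover have "(\<lambda>u. (ennreal (f u) * indicator {0..} u) * indicator {T..<T + 1 / Suc n} u)
          = (\<lambda>u. ennreal (f u) * indicator {T..<T + 1 / Suc n} u)"
        using f(2) by (auto simp: indicator_def)
      ultimately show ?thesis by simp
    qed
    have "(\<integral>\<^sup>+u. ennreal (f u) * indicator {T..<T + 1 / Suc n} u \<partial>lborel)
        = ennreal \<bar>1 / Suc n\<bar> * (\<integral>\<^sup>+s. ennreal (f (T + 1 / Suc n * s)) * indicator {T..<T + 1 / Suc n} (T + 1 / Suc n * s) \<partial>lborel)"
      by (rule nn_integral_real_affine[OF m]) simp
    also have "(\<lambda>s. indicator {T..<T + 1 / Suc n} (T + 1 / Suc n * s) :: ennreal) = indicator {0..<1}"
    proof
      fix s :: real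
      have "(1 / Suc n * s < 1 / Suc n) = (s < 1)" "(0 \<le> 1 / Suc n * s) = (0 \<le> s)"
        by (simp_all add: divide_less_cancel zero_le_divide_iff del: of_nat_Suc)
      then show "indicator {T..<T + 1 / Suc n} (T + 1 / Suc n * s) = (indicator {0..<1} s :: ennreal)"
        by (simp add: indicator_def)
    qed
    finally have "(\<integral>\<^sup>+u. ennreal (f u) * indicator {T..<T + 1 / Suc n} u \<partial>lborel)
        = ennreal \<bar>1 / Suc n\<bar> * (\<integral>\<^sup>+s. ennreal (f (T + 1 / Suc n * s)) * indicator {0..<1} s \<partial>lborel)"
      by (simp add: fun_eq_iff)
    then show ?thesis
      by (simp add: mult.assoc[symmetric] ennreal_mult'[symmetric] del: of_nat_Suc)
  qed
  have cont: "continuous_on {T..T+1} f" using f by (auto intro: continuous_on_subset)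
  then have "compact (f ` {T..T+1})" by (intro compact_continuous_image) auto
  then obtain C where C: "\<And>x. x \<in> {T..T+1} \<Longrightarrow> f x \<le> C"
    by (meson bdd_above_def bounded_imp_bdd_above compact_imp_bounded imageI)
  have "(\<lambda>n. \<integral>\<^sup>+s. ennreal (f (T + 1 / Suc n * s)) * indicator {0..<1} s \<partial>lborel)
      \<longlonglongrightarrow> (\<integral>\<^sup>+s. ennreal (f T) * indicator {0..<1::real} s \<partial>lborel)"
  proof (rule nn_integral_dominated_convergence[where w = "\<lambda>s. ennreal C * indicator {0..<1} s"])
    show "(\<lambda>s. ennreal (f (T + 1 / Suc n * s)) * indicator {0..<1} s) \<in> borel_measurable lborel" for n
    proof -
      have "(\<lambda>s. (\<lambda>u. ennreal (f u) * indicator {0..} u) (T + 1 / Suc n * s) * indicator {0..<1} s) \<in> borel_measurable borel"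
        using fb by measurable
      moreover have "(\<lambda>s. (\<lambda>u. ennreal (f u) * indicator {0..} u) (T + 1 / Suc n * s) * indicator {0..<1} s)
          = (\<lambda>s. ennreal (f (T + 1 / Suc n * s)) * indicator {0..<1} s)"
        using f(2) by (auto simp: indicator_def)
      ultimately show ?thesis by simp
    qed
    show "AE s in lborel. ennreal (f (T + 1 / Suc n * s)) * indicator {0..<1} s \<le> ennreal C * indicator {0..<1} s" for n
    proof (rule AE_I2)
      fix s :: real
      have "T + 1 / Suc n * s \<in> {T..T+1}" if "0 \<le> s" "s < 1"
        using that by (auto simp: divide_le_eq)
      then show "ennreal (f (T + 1 / Suc n * s)) * indicator {0..<1} s \<le> ennreal C * indicator {0..<1} s"
        using C by (auto simp: indicator_def intro!: ennreal_leI)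
    qed
    show "AE s in lborel. (\<lambda>n. ennreal (f (T + 1 / Suc n * s)) * indicator {0..<1} s)
        \<longlonglongrightarrow> ennreal (f T) * indicator {0..<1::real} s"
    proof (rule AE_I2)
      fix s :: real
      have "(\<lambda>n. f (T + 1 / Suc n * s)) \<longlonglongrightarrow> f T" if s: "0 \<le> s" "s < 1"
      proof -
        have "(\<lambda>n. 1 / real (Suc n)) \<longlonglongrightarrow> 0" using LIMSEQ_inverse_real_of_nat by (simp add: inverse_eq_divide)
        then have "(\<lambda>n. T + 1 / Suc n * s) \<longlonglongrightarrow> T + 0 * s" by (intro tendsto_intros)
        then have "(\<lambda>n. T + 1 / Suc n * s) \<longlonglongrightarrow> T" by simp
        moreover have "\<forall>\<^sub>F n in sequentially. T + 1 / Suc n * s \<in> {0..}"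
          using s f(2) by (auto intro!: always_eventually)
        ultimately show ?thesis
          using f continuous_on_tendsto_compose[OF f(1)] by auto
      qed
      then show "(\<lambda>n. ennreal (f (T + 1 / Suc n * s)) * indicator {0..<1} s)
        \<longlonglongrightarrow> ennreal (f T) * indicator {0..<1::real} s"
        by (auto simp: indicator_def intro: tendsto_ennrealI)
    qed
    show "(\<integral>\<^sup>+s. ennreal C * indicator {0..<1::real} s \<partial>lborel) < \<infinity>"
      by (simp add: nn_integral_cmult_indicator ennreal_mult_less_top)
  qed (auto)
  moreover have "(\<integral>\<^sup>+s. ennreal (f T) * indicator {0..<1::real} s \<partial>lborel) = ennreal (f T)"
    by (simp add: nn_integral_cmult_indicator)
  ultimately show ?thesis unfolding eq by simp
qed


section \<open>Optional sampling by averaging to the right\<close>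

context square_integrable_martingale
begin

text \<open>Averaging over \<open>[T, T + e)\<close> and exchanging the integrals reduces optional sampling at \<open>T\<close>
  to the martingale property at deterministic times, without discretizing \<open>T\<close>.\<close>

lemma smoothing_swap:
  assumes T: "stopping_time F T" "\<And>\<omega>. \<omega> \<in> space M \<Longrightarrow> 0 \<le> T \<omega>"
    and Z: "Z \<in> borel_measurable M" "\<And>\<omega>. \<omega> \<in> space M \<Longrightarrow> t < T \<omega> \<Longrightarrow> Z \<omega> = (0::ennreal)"
    and \<Phi>: "(\<lambda>(\<omega>, u). \<Phi> \<omega> u * indicator {0..} u :: ennreal) \<in> borel_measurable (M \<Otimes>\<^sub>M borel)"
    and e: "e \<le> 1"
  shows "(\<integral>\<^sup>+\<omega>. Z \<omega> * (\<integral>\<^sup>+u. \<Phi> \<omega> u * indicator {T \<omega>..<T \<omega> + e} u \<partial>lborel) \<partial>M)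
    = (\<integral>\<^sup>+u. (\<integral>\<^sup>+\<omega>. \<Phi> \<omega> u * (Z \<omega> * indicator {T \<omega>..<T \<omega> + e} u) \<partial>M) * indicator {0..t+1} u \<partial>lborel)"
proof -
  have TM[measurable]: "T \<in> borel_measurable M"
    using measurable_stopping_time[OF T(1)] sets_F_subset by auto
  interpret L: pair_sigma_finite M lborel ..
  \<comment> \<open>The indicator of \<open>{0..}\<close> changes no value, as \<open>T\<close> is
    non-negative; it is inserted because joint measurability is given for the product with
    it.\<close>
  let ?\<Psi> = "\<lambda>\<omega> u. (\<Phi> \<omega> u * indicator {0..} u) * (Z \<omega> * indicator {T \<omega>..<T \<omega> + e} u)"
  have ind: "(\<lambda>z. indicator {T (fst z)..<T (fst z) + e} (snd z) :: ennreal) \<in> borel_measurable (M \<Otimes>\<^sub>M borel)"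
  proof -
    have "(\<lambda>z. indicator {z. T (fst z) \<le> snd z \<and> snd z < T (fst z) + e} z :: ennreal) \<in> borel_measurable (M \<Otimes>\<^sub>M borel)"
      by measurable
    then show ?thesis by (simp add: indicator_def)
  qed
  have m: "(\<lambda>z. ?\<Psi> (fst z) (snd z)) \<in> borel_measurable (M \<Otimes>\<^sub>M lborel)"
    using \<Phi> Z(1) ind by (simp add: split_beta') measurable
  have "(\<integral>\<^sup>+\<omega>. Z \<omega> * (\<integral>\<^sup>+u. \<Phi> \<omega> u * indicator {T \<omega>..<T \<omega> + e} u \<partial>lborel) \<partial>M)
      = (\<integral>\<^sup>+\<omega>. \<integral>\<^sup>+u. ?\<Psi> \<omega> u \<partial>lborel \<partial>M)"
  proof (rule nn_integral_cong)
    fix \<omega> assume w: "\<omega> \<in> space M"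
    have m': "(\<lambda>u. (\<Phi> \<omega> u * indicator {0..} u) * indicator {T \<omega>..<T \<omega> + e} u) \<in> borel_measurable lborel"
      using measurable_compose[OF measurable_Pair1'[OF w] \<Phi>] by simp
    have "Z \<omega> * (\<integral>\<^sup>+u. \<Phi> \<omega> u * indicator {T \<omega>..<T \<omega> + e} u \<partial>lborel)
       = Z \<omega> * (\<integral>\<^sup>+u. (\<Phi> \<omega> u * indicator {0..} u) * indicator {T \<omega>..<T \<omega> + e} u \<partial>lborel)"
      using T(2)[OF w] by (intro arg_cong[where f="\<lambda>x. Z \<omega> * x"] nn_integral_cong) (auto simp: indicator_def)
    also have "\<dots> = (\<integral>\<^sup>+u. ?\<Psi> \<omega> u \<partial>lborel)"
      by (subst nn_integral_cmult[OF m', symmetric]) (simp add: ac_simps)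
    finally show "Z \<omega> * (\<integral>\<^sup>+u. \<Phi> \<omega> u * indicator {T \<omega>..<T \<omega> + e} u \<partial>lborel) = (\<integral>\<^sup>+u. ?\<Psi> \<omega> u \<partial>lborel)" .
  qed
  also have "\<dots> = (\<integral>\<^sup>+u. \<integral>\<^sup>+\<omega>. ?\<Psi> \<omega> u \<partial>M \<partial>lborel)"
    using L.Fubini'[of ?\<Psi>] m by (simp add: split_beta')
  also have "\<dots> = (\<integral>\<^sup>+u. (\<integral>\<^sup>+\<omega>. \<Phi> \<omega> u * (Z \<omega> * indicator {T \<omega>..<T \<omega> + e} u) \<partial>M) * indicator {0..t+1} u \<partial>lborel)"
  proof (rule nn_integral_cong)
    fix u :: real
    consider "u < 0" | "0 \<le> u" "u \<le> t + 1" | "t + 1 < u" by linarith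
    then show "(\<integral>\<^sup>+\<omega>. ?\<Psi> \<omega> u \<partial>M)
      = (\<integral>\<^sup>+\<omega>. \<Phi> \<omega> u * (Z \<omega> * indicator {T \<omega>..<T \<omega> + e} u) \<partial>M) * indicator {0..t+1} u"
    proof cases
      \<comment> \<open>Where \<open>Z\<close> does not vanish, \<open>T \<omega> \<le> t\<close>,
        and with \<open>e \<le> 1\<close> the window ends by \<open>t + 1\<close>.\<close>
      case 3
      have "?\<Psi> \<omega> u = 0" if "\<omega> \<in> space M" for \<omega>
        using 3 e Z(2)[OF that] by (cases "t < T \<omega>") (auto simp: indicator_def)
      then have "(\<integral>\<^sup>+\<omega>. ?\<Psi> \<omega> u \<partial>M) = (\<integral>\<^sup>+\<omega>. 0 \<partial>M)" by (rule nn_integral_cong)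
      with 3 show ?thesis by simp
    qed auto
  qed
  finally show ?thesis .
qed

text \<open>The window \<open>[T, T + e)\<close> contains \<open>u\<close> if and only if
  \<open>T \<le> u\<close> and \<open>u - e < T\<close>, an event decided at time \<open>u\<close>;
  it can be absorbed into the weight \<open>G\<close>. An inequality between \<open>\<Phi>\<close>
  and \<open>\<Psi>\<close> at each fixed \<open>u\<close> thus passes to the window. It is used in
  both directions for the martingale and in one direction for its square.\<close>

lemma smoothing_le:
  assumes T: "stopping_time F T" "\<And>\<omega>. \<omega> \<in> space M \<Longrightarrow> 0 \<le> T \<omega>"
    and Y: "\<And>u. 0 \<le> u \<Longrightarrow> (\<lambda>\<omega>. Y \<omega> * indicator {\<omega>. T \<omega> \<le> u} \<omega>) \<in> borel_measurable (F u)"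
    and t: "0 \<le> t"
    and \<Phi>: "(\<lambda>(\<omega>, u). \<Phi> \<omega> u * indicator {0..} u :: ennreal) \<in> borel_measurable (M \<Otimes>\<^sub>M borel)"
    and \<Psi>: "(\<lambda>(\<omega>, u). \<Psi> \<omega> u * indicator {0..} u :: ennreal) \<in> borel_measurable (M \<Otimes>\<^sub>M borel)"
    and e: "0 < e" "e \<le> 1"
    and le: "\<And>u G. 0 \<le> u \<Longrightarrow> u \<le> t + 1 \<Longrightarrow> G \<in> borel_measurable (F u) \<Longrightarrow>
      (\<integral>\<^sup>+\<omega>. \<Phi> \<omega> u * G \<omega> \<partial>M) \<le> (\<integral>\<^sup>+\<omega>. \<Psi> \<omega> u * G \<omega> \<partial>M)"
  defines "Z \<equiv> \<lambda>\<omega>. Y \<omega> * indicator {\<omega>. T \<omega> \<le> t} \<omega>"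
  shows "(\<integral>\<^sup>+\<omega>. Z \<omega> * (\<integral>\<^sup>+u. \<Phi> \<omega> u * indicator {T \<omega>..<T \<omega> + e} u \<partial>lborel) \<partial>M)
    \<le> (\<integral>\<^sup>+\<omega>. Z \<omega> * (\<integral>\<^sup>+u. \<Psi> \<omega> u * indicator {T \<omega>..<T \<omega> + e} u \<partial>lborel) \<partial>M)"
proof -
  have Z: "Z \<in> borel_measurable M" "\<And>\<omega>. \<omega> \<in> space M \<Longrightarrow> t < T \<omega> \<Longrightarrow> Z \<omega> = 0"
    using measurable_F_M[OF Y[OF t]] by (auto simp: Z_def)
  have "(\<integral>\<^sup>+\<omega>. \<Phi> \<omega> u * (Z \<omega> * indicator {T \<omega>..<T \<omega> + e} u) \<partial>M)
      \<le> (\<integral>\<^sup>+\<omega>. \<Psi> \<omega> u * (Z \<omega> * indicator {T \<omega>..<T \<omega> + e} u) \<partial>M)" if u: "0 \<le> u" "u \<le> t + 1" for u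
  proof (rule le[OF u])
    have 1: "(\<lambda>\<omega>. Y \<omega> * indicator {\<omega>. T \<omega> \<le> min t u} \<omega>) \<in> borel_measurable (F u)"
      using t u(1) by (intro measurable_F_mono[OF Y]) auto
    have "Measurable.pred (F u) (\<lambda>\<omega>. u - e < T \<omega>)"
      using measurable_F_mono[OF stopping_timeD2[OF T(1)], of "u - e" u] e by simp
    then have 2: "(\<lambda>\<omega>. indicator {\<omega>. u - e < T \<omega>} \<omega> :: ennreal) \<in> borel_measurable (F u)"
      by (intro borel_measurable_indicator') (simp add: pred_def)
    \<comment> \<open>Joining \<open>T \<le> t\<close> and \<open>T \<le> u\<close> into
      \<open>T \<le> min t u\<close> evaluates \<open>Y\<close> at a time not after
      \<open>u\<close>, as is needed when \<open>u < t\<close>.\<close>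
    have "(\<lambda>\<omega>. Z \<omega> * indicator {T \<omega>..<T \<omega> + e} u)
        = (\<lambda>\<omega>. Y \<omega> * indicator {\<omega>. T \<omega> \<le> min t u} \<omega> * indicator {\<omega>. u - e < T \<omega>} \<omega>)"
      by (auto simp: Z_def indicator_def fun_eq_iff)
    with 1 2 show "(\<lambda>\<omega>. Z \<omega> * indicator {T \<omega>..<T \<omega> + e} u) \<in> borel_measurable (F u)"
      by simp
  qed
  then have "(\<integral>\<^sup>+u. (\<integral>\<^sup>+\<omega>. \<Phi> \<omega> u * (Z \<omega> * indicator {T \<omega>..<T \<omega> + e} u) \<partial>M) * indicator {0..t+1} u \<partial>lborel)
      \<le> (\<integral>\<^sup>+u. (\<integral>\<^sup>+\<omega>. \<Psi> \<omega> u * (Z \<omega> * indicator {T \<omega>..<T \<omega> + e} u) \<partial>M) * indicator {0..t+1} u \<partial>lborel)"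
    by (intro nn_integral_mono) (simp add: indicator_def)
  then show ?thesis
    by (simp only: smoothing_swap[OF T Z \<Phi> e(2)] smoothing_swap[OF T Z \<Psi> e(2)])
qed


lemma L_sampled_measurable:
  assumes T: "stopping_time F T" "\<And>\<omega>. \<omega> \<in> space M \<Longrightarrow> 0 \<le> T \<omega>"
  shows "(\<lambda>\<omega>. ennreal (L (T \<omega>) \<omega>)) \<in> borel_measurable M"
proof -
  have "T \<in> borel_measurable M"
    using measurable_stopping_time[OF T(1)] sets_F_subset by auto
  then have "(\<lambda>\<omega>. (\<omega>, T \<omega>)) \<in> measurable M (M \<Otimes>\<^sub>M borel)" by measurable
  from measurable_compose[OF this L_joint]
  have "(\<lambda>\<omega>. ennreal (L (T \<omega>) \<omega>) * indicator {0..} (T \<omega>)) \<in> borel_measurable M" by simp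
  then show ?thesis by (rule measurable_cong[THEN iffD1, rotated]) (simp add: T(2))
qed

text \<open>\<open>\<phi>\<close> will be the identity, a truncation and the square.\<close>

lemma L_average_measurable:
  assumes T: "stopping_time F T" "\<And>\<omega>. \<omega> \<in> space M \<Longrightarrow> 0 \<le> T \<omega>"
    and \<phi>: "\<phi> \<in> borel_measurable borel"
  shows "(\<lambda>\<omega>. \<integral>\<^sup>+u. \<phi> (ennreal (L u \<omega>)) * indicator {T \<omega>..<T \<omega> + e} u \<partial>lborel) \<in> borel_measurable M"
proof -
  have TM[measurable]: "T \<in> borel_measurable M"
    using measurable_stopping_time[OF T(1)] sets_F_subset by auto
  have ind: "(\<lambda>z. indicator {z. T (fst z) \<le> snd z \<and> snd z < T (fst z) + e} z :: ennreal) \<in> borel_measurable (M \<Otimes>\<^sub>M lborel)"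
    by measurable
  have 1: "(\<lambda>z. \<phi> (ennreal (L (snd z) (fst z)) * indicator {0..} (snd z))) \<in> borel_measurable (M \<Otimes>\<^sub>M lborel)"
    using measurable_compose[OF L_joint \<phi>] by (simp add: split_beta')
  have "(\<lambda>\<omega>. \<integral>\<^sup>+u. \<phi> (ennreal (L u \<omega>) * indicator {0..} u)
      * indicator {z. T (fst z) \<le> snd z \<and> snd z < T (fst z) + e} (\<omega>, u) \<partial>lborel) \<in> borel_measurable M"
    using 1 ind by (intro lborel.borel_measurable_nn_integral) (simp add: split_beta')
  then show ?thesis
  proof (rule measurable_cong[THEN iffD1, rotated])
    fix \<omega> assume "\<omega> \<in> space M"
    then show "(\<integral>\<^sup>+u. \<phi> (ennreal (L u \<omega>) * indicator {0..} u)
      * indicator {z. T (fst z) \<le> snd z \<and> snd z < T (fst z) + e} (\<omega>, u) \<partial>lborel)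
      = (\<integral>\<^sup>+u. \<phi> (ennreal (L u \<omega>)) * indicator {T \<omega>..<T \<omega> + e} u \<partial>lborel)"
      using T(2)[of \<omega>] by (intro nn_integral_cong) (auto simp: indicator_def)
  qed
qed

text \<open>Every window starting by \<open>t\<close> ends by \<open>t + 1\<close>, so
  \<open>L u\<close> may be replaced there by \<open>L (t + 1)\<close>; the inner integral becomes
  the window length \<open>1 / Suc n\<close> times that value, and the factor in front cancels. As
  \<open>Z\<close> is known at time \<open>t\<close>, the martingale property leads back to
  \<open>L t\<close>. The square is only a submartingale, which gives an inequality and leaves the
  time \<open>t + 1\<close>.\<close>

lemma optional_sampling_aux:
  assumes T: "stopping_time F T" "\<And>\<omega>. \<omega> \<in> space M \<Longrightarrow> 0 \<le> T \<omega>"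
    and Y: "\<And>u. 0 \<le> u \<Longrightarrow> (\<lambda>\<omega>. Y \<omega> * indicator {\<omega>. T \<omega> \<le> u} \<omega>) \<in> borel_measurable (F u)"
    and t: "0 \<le> t"
  defines "Z \<equiv> \<lambda>\<omega>. Y \<omega> * indicator {\<omega>. T \<omega> \<le> t} \<omega>"
  shows "ennreal (Suc n) * (\<integral>\<^sup>+\<omega>. Z \<omega> * (\<integral>\<^sup>+u. ennreal (L u \<omega>) * indicator {T \<omega>..<T \<omega> + 1 / Suc n} u \<partial>lborel) \<partial>M)
      = (\<integral>\<^sup>+\<omega>. ennreal (L t \<omega>) * Z \<omega> \<partial>M)"
    and "ennreal (Suc n) * (\<integral>\<^sup>+\<omega>. Z \<omega> * (\<integral>\<^sup>+u. (ennreal (L u \<omega>))\<^sup>2 * indicator {T \<omega>..<T \<omega> + 1 / Suc n} u \<partial>lborel) \<partial>M)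
      \<le> (\<integral>\<^sup>+\<omega>. (ennreal (L (t+1) \<omega>))\<^sup>2 * Z \<omega> \<partial>M)"
proof -
  have ZF: "Z \<in> borel_measurable (F t)" using Y[OF t] by (simp add: Z_def)
  have Z: "Z \<in> borel_measurable M" using measurable_F_M[OF ZF] .
  have L2: "(\<lambda>(\<omega>, u). (ennreal (L u \<omega>))\<^sup>2 * indicator {0..} u) \<in> borel_measurable (M \<Otimes>\<^sub>M borel)"
  proof -
    have "(\<lambda>z. ((\<lambda>(\<omega>, u). ennreal (L u \<omega>) * indicator {0..} u) z)\<^sup>2) \<in> borel_measurable (M \<Otimes>\<^sub>M borel)"
      using L_joint by (rule borel_measurable_power_ennreal)
    moreover have "(\<lambda>z. ((\<lambda>(\<omega>, u). ennreal (L u \<omega>) * indicator {0..} u) z)\<^sup>2)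
      = (\<lambda>(\<omega>, u). (ennreal (L u \<omega>))\<^sup>2 * indicator {0..} u)"
      by (auto simp: indicator_def fun_eq_iff)
    ultimately show ?thesis by simp
  qed
  have Lt[measurable]: "L (t + 1) \<in> borel_measurable M" using t L_measurable by simp
  have ind: "(\<lambda>z. indicator {0::real..} (snd z) :: ennreal) \<in> borel_measurable (M \<Otimes>\<^sub>M borel)"
    by (rule measurable_compose[OF measurable_snd]) simp
  have Ltz: "(\<lambda>z. ennreal (L (t+1) (fst z))) \<in> borel_measurable (M \<Otimes>\<^sub>M (borel :: real measure))" by measurable
  have \<Psi>1: "(\<lambda>(\<omega>, u). ennreal (L (t+1) \<omega>) * indicator {0::real..} u) \<in> borel_measurable (M \<Otimes>\<^sub>M borel)"
    unfolding split_beta' by (intro borel_measurable_times_ennreal borel_measurable_power_ennreal Ltz ind)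
  have \<Psi>2: "(\<lambda>(\<omega>, u). (ennreal (L (t+1) \<omega>))\<^sup>2 * indicator {0::real..} u) \<in> borel_measurable (M \<Otimes>\<^sub>M borel)"
    unfolding split_beta' by (intro borel_measurable_times_ennreal borel_measurable_power_ennreal Ltz ind)
  let ?e = "1 / real (Suc n)"
  have e: "0 < ?e" "?e \<le> 1" by auto
  have cancel: "ennreal (Suc n) * (\<integral>\<^sup>+\<omega>. Z \<omega> * (\<integral>\<^sup>+u. f \<omega> * indicator {T \<omega>..<T \<omega> + ?e} u \<partial>lborel) \<partial>M)
      = (\<integral>\<^sup>+\<omega>. f \<omega> * Z \<omega> \<partial>M)" if f: "f \<in> borel_measurable M" for f
  proof -
    have "(\<integral>\<^sup>+u. f \<omega> * indicator {T \<omega>..<T \<omega> + ?e} u \<partial>lborel) = f \<omega> * ennreal ?e" for \<omega>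
      by (subst nn_integral_cmult_indicator) auto
    then have "(\<integral>\<^sup>+\<omega>. Z \<omega> * (\<integral>\<^sup>+u. f \<omega> * indicator {T \<omega>..<T \<omega> + ?e} u \<partial>lborel) \<partial>M)
        = (\<integral>\<^sup>+\<omega>. ennreal ?e * (f \<omega> * Z \<omega>) \<partial>M)"
      by (simp add: ac_simps)
    also have "\<dots> = ennreal ?e * (\<integral>\<^sup>+\<omega>. f \<omega> * Z \<omega> \<partial>M)"
      using f Z by (intro nn_integral_cmult) auto
    finally show ?thesis
      by (simp add: mult.assoc[symmetric] ennreal_mult'[symmetric] del: of_nat_Suc)
  qed
  have "(\<integral>\<^sup>+\<omega>. Z \<omega> * (\<integral>\<^sup>+u. ennreal (L u \<omega>) * indicator {T \<omega>..<T \<omega> + ?e} u \<partial>lborel) \<partial>M)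
      = (\<integral>\<^sup>+\<omega>. Z \<omega> * (\<integral>\<^sup>+u. ennreal (L (t+1) \<omega>) * indicator {T \<omega>..<T \<omega> + ?e} u \<partial>lborel) \<partial>M)"
    unfolding Z_def using L_mart[of _ "t + 1"]
    by (intro antisym smoothing_le[OF T Y t L_joint \<Psi>1 e] smoothing_le[OF T Y t \<Psi>1 L_joint e]) simp_all
  moreover have "(\<integral>\<^sup>+\<omega>. ennreal (L (t+1) \<omega>) * Z \<omega> \<partial>M) = (\<integral>\<^sup>+\<omega>. ennreal (L t \<omega>) * Z \<omega> \<partial>M)"
    by (rule L_mart) (use t ZF in auto)
  ultimately show "ennreal (Suc n) * (\<integral>\<^sup>+\<omega>. Z \<omega> * (\<integral>\<^sup>+u. ennreal (L u \<omega>) * indicator {T \<omega>..<T \<omega> + ?e} u \<partial>lborel) \<partial>M)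
      = (\<integral>\<^sup>+\<omega>. ennreal (L t \<omega>) * Z \<omega> \<partial>M)"
    using cancel[of "\<lambda>\<omega>. ennreal (L (t+1) \<omega>)"] by simp
  have "(\<integral>\<^sup>+\<omega>. Z \<omega> * (\<integral>\<^sup>+u. (ennreal (L u \<omega>))\<^sup>2 * indicator {T \<omega>..<T \<omega> + ?e} u \<partial>lborel) \<partial>M)
      \<le> (\<integral>\<^sup>+\<omega>. Z \<omega> * (\<integral>\<^sup>+u. (ennreal (L (t+1) \<omega>))\<^sup>2 * indicator {T \<omega>..<T \<omega> + ?e} u \<partial>lborel) \<partial>M)"
    unfolding Z_def using L_square[of _ "t + 1"] L_nonneg
    by (intro smoothing_le[OF T Y t L2 \<Psi>2 e]) (simp_all add: ennreal_power)
  then have "ennreal (Suc n) * (\<integral>\<^sup>+\<omega>. Z \<omega> * (\<integral>\<^sup>+u. (ennreal (L u \<omega>))\<^sup>2 * indicator {T \<omega>..<T \<omega> + ?e} u \<partial>lborel) \<partial>M)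
      \<le> ennreal (Suc n) * (\<integral>\<^sup>+\<omega>. Z \<omega> * (\<integral>\<^sup>+u. (ennreal (L (t+1) \<omega>))\<^sup>2 * indicator {T \<omega>..<T \<omega> + ?e} u \<partial>lborel) \<partial>M)"
    by (rule mult_left_mono) simp
  then show "ennreal (Suc n) * (\<integral>\<^sup>+\<omega>. Z \<omega> * (\<integral>\<^sup>+u. (ennreal (L u \<omega>))\<^sup>2 * indicator {T \<omega>..<T \<omega> + ?e} u \<partial>lborel) \<partial>M)
      \<le> (\<integral>\<^sup>+\<omega>. (ennreal (L (t+1) \<omega>))\<^sup>2 * Z \<omega> \<partial>M)"
    by (subst (asm) cancel) auto
qed

text \<open>Fatou's lemma gives one inequality. The other needs uniform integrability: the averages
  are truncated at \<open>k\<close>, the truncated parts converge by domination, and the rest is at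
  most \<open>1 / k\<close> times a second moment that \<open>optional_sampling_aux\<close> bounds
  uniformly in \<open>n\<close>. The bound \<open>c\<close> on \<open>Y\<close> makes that second
  moment finite.\<close>

lemma optional_sampling_bounded:
  assumes T: "stopping_time F T" "\<And>\<omega>. \<omega> \<in> space M \<Longrightarrow> 0 \<le> T \<omega>"
    and Y: "\<And>u. 0 \<le> u \<Longrightarrow> (\<lambda>\<omega>. Y \<omega> * indicator {\<omega>. T \<omega> \<le> u} \<omega>) \<in> borel_measurable (F u)"
    and t: "0 \<le> t"
    and bound: "\<And>\<omega>. \<omega> \<in> space M \<Longrightarrow> Y \<omega> \<le> ennreal c" "0 \<le> c"
  shows "(\<integral>\<^sup>+\<omega>. ennreal (L t \<omega>) * (Y \<omega> * indicator {\<omega>. T \<omega> \<le> t} \<omega>) \<partial>M)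
    = (\<integral>\<^sup>+\<omega>. ennreal (L (T \<omega>) \<omega>) * (Y \<omega> * indicator {\<omega>. T \<omega> \<le> t} \<omega>) \<partial>M)"
proof -
  define Z where "Z = (\<lambda>\<omega>. Y \<omega> * indicator {\<omega>. T \<omega> \<le> t} \<omega>)"
  define av where "av \<phi> n \<omega> = ennreal (Suc n) * (\<integral>\<^sup>+u. \<phi> (ennreal (L u \<omega>)) * indicator {T \<omega>..<T \<omega> + 1 / Suc n} u \<partial>lborel)"
    for \<phi> and n :: nat and \<omega>
  have Z[measurable]: "Z \<in> borel_measurable M" using measurable_F_M[OF Y[OF t]] by (simp add: Z_def)
  have Zc: "Z \<omega> \<le> ennreal c" if "\<omega> \<in> space M" for \<omega>
    using bound(1)[OF that] by (auto simp: Z_def indicator_def)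
  have avm[measurable]: "av \<phi> n \<in> borel_measurable M" if "\<phi> \<in> borel_measurable borel" for \<phi> n
    unfolding av_def using L_average_measurable[OF T that] by measurable
  note LT[measurable] = L_sampled_measurable[OF T]
  have cmult: "(\<lambda>n. f n * c) \<longlonglongrightarrow> x * c" if "f \<longlonglongrightarrow> x" "c < \<top>" for f x and c :: ennreal
    using ennreal_tendsto_cmult[OF that(2,1)] by (simp add: mult.commute)
  have avZ: "(\<integral>\<^sup>+\<omega>. av \<phi> n \<omega> * Z \<omega> \<partial>M)
      = ennreal (Suc n) * (\<integral>\<^sup>+\<omega>. Z \<omega> * (\<integral>\<^sup>+u. \<phi> (ennreal (L u \<omega>)) * indicator {T \<omega>..<T \<omega> + 1 / Suc n} u \<partial>lborel) \<partial>M)"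
    if \<phi>: "\<phi> \<in> borel_measurable borel" for \<phi> n
  proof -
    have "(\<lambda>\<omega>. av \<phi> n \<omega> * Z \<omega>) = (\<lambda>\<omega>. ennreal (Suc n) *
        (Z \<omega> * (\<integral>\<^sup>+u. \<phi> (ennreal (L u \<omega>)) * indicator {T \<omega>..<T \<omega> + 1 / Suc n} u \<partial>lborel)))"
      by (simp only: av_def ac_simps)
    then show ?thesis
      by (simp only:) (intro nn_integral_cmult borel_measurable_times_ennreal Z L_average_measurable[OF T \<phi>])
  qed
  have lim: "(\<lambda>n. av (\<lambda>x. min x (ennreal k)) n \<omega>) \<longlonglongrightarrow> min (ennreal (L (T \<omega>) \<omega>)) (ennreal k)"
    if w: "\<omega> \<in> space M" and k: "0 \<le> k" for \<omega> k
  proof -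
    have "continuous_on {0..} (\<lambda>u. min (L u \<omega>) k)"
      using L_cont[OF w] by (intro continuous_intros)
    from nn_integral_average_LIMSEQ[OF this T(2)[OF w]]
    show ?thesis using k L_nonneg by (simp add: av_def min_ennreal del: of_nat_Suc)
  qed
  have lim': "(\<lambda>n. av (\<lambda>x. x) n \<omega>) \<longlonglongrightarrow> ennreal (L (T \<omega>) \<omega>)" if w: "\<omega> \<in> space M" for \<omega>
    using nn_integral_average_LIMSEQ[OF L_cont[OF w] T(2)[OF w]] by (simp add: av_def)
  let ?E = "\<integral>\<^sup>+\<omega>. ennreal (L t \<omega>) * Z \<omega> \<partial>M"
  let ?ET = "\<integral>\<^sup>+\<omega>. ennreal (L (T \<omega>) \<omega>) * Z \<omega> \<partial>M"
  have E: "(\<integral>\<^sup>+\<omega>. av (\<lambda>x. x) n \<omega> * Z \<omega> \<partial>M) = ?E" for n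
    using avZ[of "\<lambda>x. x" n] optional_sampling_aux(1)[OF T Y t, of n] by (simp add: Z_def)
  have Zfin: "Z \<omega> < \<top>" if "\<omega> \<in> space M" for \<omega>
    using Zc[OF that] ennreal_less_top le_less_trans by blast
  have "?ET = (\<integral>\<^sup>+\<omega>. liminf (\<lambda>n. av (\<lambda>x. x) n \<omega> * Z \<omega>) \<partial>M)"
  proof (rule nn_integral_cong)
    fix \<omega> assume w: "\<omega> \<in> space M"
    have "(\<lambda>n. av (\<lambda>x. x) n \<omega> * Z \<omega>) \<longlonglongrightarrow> ennreal (L (T \<omega>) \<omega>) * Z \<omega>"
      using lim'[OF w] Zfin[OF w] by (intro cmult)
    from lim_imp_Liminf[OF _ this]
    show "ennreal (L (T \<omega>) \<omega>) * Z \<omega> = liminf (\<lambda>n. av (\<lambda>x. x) n \<omega> * Z \<omega>)" by simp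
  qed
  also have "\<dots> \<le> liminf (\<lambda>n. \<integral>\<^sup>+\<omega>. av (\<lambda>x. x) n \<omega> * Z \<omega> \<partial>M)"
    by (rule nn_integral_liminf) measurable
  also have "\<dots> = ?E" unfolding E by (simp add: Liminf_const)
  finally have le: "?ET \<le> ?E" .
  define C where "C = (\<integral>\<^sup>+\<omega>. (ennreal (L (t+1) \<omega>))\<^sup>2 * Z \<omega> \<partial>M)"
  have "C \<le> (\<integral>\<^sup>+\<omega>. ennreal ((L (t+1) \<omega>)\<^sup>2) * ennreal c \<partial>M)"
    unfolding C_def using L_nonneg Zc
    by (intro nn_integral_mono) (auto simp: ennreal_power intro!: mult_left_mono)
  also have "\<dots> = (\<integral>\<^sup>+\<omega>. ennreal ((L (t+1) \<omega>)\<^sup>2) \<partial>M) * ennreal c"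
    using L_measurable[of "t+1"] t by (intro nn_integral_multc) auto
  also have "\<dots> < \<infinity>"
    using L_square_finite[of "t+1"] t by (simp add: ennreal_mult_less_top)
  finally have C: "C < \<infinity>" .
  have ge: "?E \<le> ?ET + C * ennreal (1 / k)" if k: "0 < k" for k :: real
  proof -
    \<comment> \<open>Above the level \<open>k\<close> already \<open>x\<^sup>2 / k\<close>
      dominates \<open>x\<close>; this is how a second moment controls the tail.\<close>
    have split: "x \<le> min x (ennreal k) + ennreal (1 / k) * x\<^sup>2" for x :: ennreal
    proof (cases x)
      case (real r)
      have "r \<le> min r k + 1 / k * r\<^sup>2"
      proof (cases "r \<le> k")
        case False
        then have "r * k \<le> r * r" using real k by (intro mult_left_mono) auto
        then have "r \<le> 1 / k * r\<^sup>2" using k by (simp add: field_simps power2_eq_square)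
        then show ?thesis using False k by simp
      qed (use k in simp)
      then have "ennreal r \<le> ennreal (min r k + 1 / k * r\<^sup>2)" by (rule ennreal_leI)
      also have "\<dots> = min x (ennreal k) + ennreal (1 / k) * x\<^sup>2"
        using real k by (simp add: ennreal_plus ennreal_mult'[symmetric] ennreal_power min_ennreal)
      finally show ?thesis using real by simp
    next
      case top
      then show ?thesis using k by (simp add: ennreal_mult_top power2_eq_square)
    qed
    have "?E \<le> (\<integral>\<^sup>+\<omega>. av (\<lambda>x. min x (ennreal k)) n \<omega> * Z \<omega> \<partial>M) + ennreal (1 / k) * C" for n
    proof -
      have "av (\<lambda>x. x) n \<omega> \<le> av (\<lambda>x. min x (ennreal k)) n \<omega> + ennreal (1 / k) * av (\<lambda>x. x\<^sup>2) n \<omega>"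
        if w: "\<omega> \<in> space M" for \<omega>
      proof -
        have Lb: "(\<lambda>u. ennreal (L u \<omega>) * indicator {0..} u) \<in> borel_measurable lborel"
          using measurable_compose[OF measurable_Pair1'[OF w] L_joint] by simp
        have m: "(\<lambda>u. \<phi> (ennreal (L u \<omega>)) * indicator {T \<omega>..<T \<omega> + 1 / Suc n} u) \<in> borel_measurable lborel"
          if \<phi>: "\<phi> \<in> borel_measurable borel" for \<phi> :: "ennreal \<Rightarrow> ennreal"
        proof -
          have "(\<lambda>u. \<phi> (ennreal (L u \<omega>) * indicator {0..} u) * indicator {T \<omega>..<T \<omega> + 1 / Suc n} u) \<in> borel_measurable lborel"
            using measurable_compose[OF Lb \<phi>] by measurable
          then show ?thesis
            by (rule measurable_cong[THEN iffD1, rotated]) (use T(2)[OF w] in \<open>auto simp: indicator_def\<close>)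
        qed
        have "(\<integral>\<^sup>+u. ennreal (L u \<omega>) * indicator {T \<omega>..<T \<omega> + 1 / Suc n} u \<partial>lborel)
          \<le> (\<integral>\<^sup>+u. min (ennreal (L u \<omega>)) (ennreal k) * indicator {T \<omega>..<T \<omega> + 1 / Suc n} u
              + ennreal (1 / k) * ((ennreal (L u \<omega>))\<^sup>2 * indicator {T \<omega>..<T \<omega> + 1 / Suc n} u) \<partial>lborel)"
          using split by (intro nn_integral_mono) (auto simp: indicator_def)
        also have "\<dots> = (\<integral>\<^sup>+u. min (ennreal (L u \<omega>)) (ennreal k) * indicator {T \<omega>..<T \<omega> + 1 / Suc n} u \<partial>lborel)
              + ennreal (1 / k) * (\<integral>\<^sup>+u. (ennreal (L u \<omega>))\<^sup>2 * indicator {T \<omega>..<T \<omega> + 1 / Suc n} u \<partial>lborel)"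
          using m[of "\<lambda>x. min x (ennreal k)"] m[of "\<lambda>x. x\<^sup>2"]
          by (subst nn_integral_add) (auto simp: nn_integral_cmult)
        finally have "ennreal (Suc n) * (\<integral>\<^sup>+u. ennreal (L u \<omega>) * indicator {T \<omega>..<T \<omega> + 1 / Suc n} u \<partial>lborel)
          \<le> ennreal (Suc n) * \<dots>" by (rule mult_left_mono) simp
        then show ?thesis by (simp add: av_def distrib_left ac_simps del: of_nat_Suc)
      qed
      then have "(\<integral>\<^sup>+\<omega>. av (\<lambda>x. x) n \<omega> * Z \<omega> \<partial>M)
          \<le> (\<integral>\<^sup>+\<omega>. av (\<lambda>x. min x (ennreal k)) n \<omega> * Z \<omega> + ennreal (1 / k) * (av (\<lambda>x. x\<^sup>2) n \<omega> * Z \<omega>) \<partial>M)"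
        by (intro nn_integral_mono) (metis distrib_right mult.assoc mult_right_mono zero_le)
      also have "\<dots> = (\<integral>\<^sup>+\<omega>. av (\<lambda>x. min x (ennreal k)) n \<omega> * Z \<omega> \<partial>M)
          + ennreal (1 / k) * (\<integral>\<^sup>+\<omega>. av (\<lambda>x. x\<^sup>2) n \<omega> * Z \<omega> \<partial>M)"
        by (subst nn_integral_add) (auto simp: nn_integral_cmult)
      also have "(\<integral>\<^sup>+\<omega>. av (\<lambda>x. x\<^sup>2) n \<omega> * Z \<omega> \<partial>M) \<le> C"
        using avZ[of "\<lambda>x. x\<^sup>2" n] optional_sampling_aux(2)[OF T Y t, of n] by (simp add: Z_def C_def)
      finally show ?thesis unfolding E by (simp add: mult_left_mono add_left_mono)
    qed
    moreover have "(\<lambda>n. \<integral>\<^sup>+\<omega>. av (\<lambda>x. min x (ennreal k)) n \<omega> * Z \<omega> \<partial>M)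
        \<longlonglongrightarrow> (\<integral>\<^sup>+\<omega>. min (ennreal (L (T \<omega>) \<omega>)) (ennreal k) * Z \<omega> \<partial>M)"
    proof (rule nn_integral_dominated_convergence[where w = "\<lambda>_. ennreal k * ennreal c"])
      show "(\<integral>\<^sup>+\<omega>. ennreal k * ennreal c \<partial>M) < \<infinity>"
        by (simp add: emeasure_space_1 ennreal_mult_less_top)
      show "AE \<omega> in M. (\<lambda>n. av (\<lambda>x. min x (ennreal k)) n \<omega> * Z \<omega>)
        \<longlonglongrightarrow> min (ennreal (L (T \<omega>) \<omega>)) (ennreal k) * Z \<omega>"
        using lim k Zfin by (intro AE_I2 cmult) auto
      show "AE \<omega> in M. av (\<lambda>x. min x (ennreal k)) n \<omega> * Z \<omega> \<le> ennreal k * ennreal c" for n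
      proof (rule AE_I2)
        fix \<omega> assume w: "\<omega> \<in> space M"
        have "(\<integral>\<^sup>+u. min (ennreal (L u \<omega>)) (ennreal k) * indicator {T \<omega>..<T \<omega> + 1 / Suc n} u \<partial>lborel)
          \<le> (\<integral>\<^sup>+u. ennreal k * indicator {T \<omega>..<T \<omega> + 1 / Suc n} u \<partial>lborel)"
          by (intro nn_integral_mono mult_right_mono) auto
        also have "\<dots> = ennreal k * ennreal (1 / Suc n)"
          by (subst nn_integral_cmult_indicator) auto
        finally have "av (\<lambda>x. min x (ennreal k)) n \<omega> \<le> ennreal (Suc n) * (ennreal k * ennreal (1 / Suc n))"
          unfolding av_def by (rule mult_left_mono) simp
        also have "\<dots> = ennreal k"
          using k by (simp add: ennreal_mult'[symmetric] del: of_nat_Suc)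
        finally show "av (\<lambda>x. min x (ennreal k)) n \<omega> * Z \<omega> \<le> ennreal k * ennreal c"
          using Zc[OF w] by (rule mult_mono) auto
      qed
    qed measurable
    then have "(\<lambda>n. (\<integral>\<^sup>+\<omega>. av (\<lambda>x. min x (ennreal k)) n \<omega> * Z \<omega> \<partial>M) + ennreal (1 / k) * C)
        \<longlonglongrightarrow> (\<integral>\<^sup>+\<omega>. min (ennreal (L (T \<omega>) \<omega>)) (ennreal k) * Z \<omega> \<partial>M) + ennreal (1 / k) * C"
      by (intro tendsto_add tendsto_const)
    ultimately have "?E \<le> (\<integral>\<^sup>+\<omega>. min (ennreal (L (T \<omega>) \<omega>)) (ennreal k) * Z \<omega> \<partial>M) + ennreal (1 / k) * C"
      by (intro LIMSEQ_le_const) auto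
    also have "\<dots> \<le> ?ET + C * ennreal (1 / k)"
      by (intro add_mono nn_integral_mono mult_right_mono) (auto simp: mult.commute)
    finally show ?thesis .
  qed
  have "?E \<le> ?ET"
  proof (rule LIMSEQ_le_const)
    \<comment> \<open>The levels \<open>k = Suc n\<close> tend to infinity; finiteness of
      \<open>C\<close> makes the error vanish in \<open>ennreal\<close>.\<close>
    have "(\<lambda>n. ?ET + C * ennreal (1 / real (Suc n))) \<longlonglongrightarrow> ?ET + C * ennreal 0"
      using C LIMSEQ_inverse_real_of_nat
      by (intro tendsto_add tendsto_const ennreal_tendsto_cmult tendsto_ennrealI) (auto simp: inverse_eq_divide)
    then show "(\<lambda>n. ?ET + C * ennreal (1 / real (Suc n))) \<longlonglongrightarrow> ?ET" by simp
  qed (use ge in auto)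
  with le show ?thesis unfolding Z_def by (rule antisym[rotated])
qed

text \<open>Truncating \<open>Y\<close> at \<open>k\<close> and monotone convergence remove the
  bound, with both sides possibly infinite. The condition on \<open>Y\<close> expresses
  measurability with respect to the past of \<open>T\<close>.\<close>

lemma optional_sampling:
  assumes T: "stopping_time F T" "\<And>\<omega>. \<omega> \<in> space M \<Longrightarrow> 0 \<le> T \<omega>"
    and Y: "\<And>u. 0 \<le> u \<Longrightarrow> (\<lambda>\<omega>. Y \<omega> * indicator {\<omega>. T \<omega> \<le> u} \<omega>) \<in> borel_measurable (F u)"
    and t: "0 \<le> t"
  shows "(\<integral>\<^sup>+\<omega>. ennreal (L t \<omega>) * (Y \<omega> * indicator {\<omega>. T \<omega> \<le> t} \<omega>) \<partial>M)
    = (\<integral>\<^sup>+\<omega>. ennreal (L (T \<omega>) \<omega>) * (Y \<omega> * indicator {\<omega>. T \<omega> \<le> t} \<omega>) \<partial>M)"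
proof -
  define Z where "Z k \<omega> = min (Y \<omega>) (of_nat k) * indicator {\<omega>. T \<omega> \<le> t} \<omega>" for k :: nat and \<omega>
  have Zmin: "min (Y \<omega>) (of_nat k) * indicator {\<omega>. T \<omega> \<le> u} \<omega> = min (Y \<omega> * indicator {\<omega>. T \<omega> \<le> u} \<omega>) (of_nat k)"
    for u k \<omega> by (auto simp: indicator_def)
  have Zm: "Z k \<in> borel_measurable M" for k
    unfolding Z_def Zmin using measurable_F_M[OF Y[OF t]] by measurable
  have inc: "incseq (\<lambda>k. f \<omega> * Z k \<omega>)" for f :: "'a \<Rightarrow> ennreal" and \<omega>
    unfolding Z_def Zmin by (intro incseq_SucI mult_left_mono min.mono order_refl of_nat_mono) auto
  have SUP: "(SUP k. f \<omega> * Z k \<omega>) = f \<omega> * (Y \<omega> * indicator {\<omega>. T \<omega> \<le> t} \<omega>)" for f :: "'a \<Rightarrow> ennreal" and \<omega>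
  proof -
    have "(SUP k. min x (of_nat k)) = x" for x :: ennreal
      using inf_SUP[of x "\<lambda>k::nat. of_nat k :: ennreal" UNIV] ennreal_SUP_of_nat_eq_top
      by (simp add: inf_min)
    then show ?thesis unfolding Z_def Zmin by (simp add: SUP_mult_left_ennreal[symmetric])
  qed
  have mono: "(\<integral>\<^sup>+\<omega>. f \<omega> * (Y \<omega> * indicator {\<omega>. T \<omega> \<le> t} \<omega>) \<partial>M) = (SUP k. \<integral>\<^sup>+\<omega>. f \<omega> * Z k \<omega> \<partial>M)"
    if "f \<in> borel_measurable M" for f
    unfolding SUP[symmetric] using that Zm inc
    by (intro nn_integral_monotone_convergence_SUP) (auto simp: incseq_def le_fun_def)
  have "(\<integral>\<^sup>+\<omega>. ennreal (L t \<omega>) * Z k \<omega> \<partial>M) = (\<integral>\<^sup>+\<omega>. ennreal (L (T \<omega>) \<omega>) * Z k \<omega> \<partial>M)" for k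
    unfolding Z_def
  proof (rule optional_sampling_bounded[OF T _ t, where c = "real k"])
    show "(\<lambda>\<omega>. min (Y \<omega>) (of_nat k) * indicator {\<omega>. T \<omega> \<le> u} \<omega>) \<in> borel_measurable (F u)" if "0 \<le> u" for u
      unfolding Zmin using Y[OF that] by measurable
  qed (auto simp: ennreal_of_nat_eq_real_of_nat)
  then show ?thesis
    using L_measurable[OF t] L_sampled_measurable[OF T] by (simp add: mono)
qed

end


section \<open>Compensators of marked point processes\<close>

text \<open>Dividing by \<open>c b\<close>, one plus the total mass, gives a subprobability kernel,
  for which integrals are measurable; the factor is multiplied back afterwards. The added one
  prevents division by zero, and finiteness of the mass makes \<open>c b\<close> cancel.\<close>

lemma finite_kernel_nn_integral_measurable:
  fixes K :: "'b \<Rightarrow> 'e::topological_space measure"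
  assumes sets: "\<And>b. b \<in> space S \<Longrightarrow> sets (K b) = sets borel"
    and fin: "\<And>b. b \<in> space S \<Longrightarrow> emeasure (K b) UNIV < \<top>"
    and meas: "\<And>A. A \<in> sets borel \<Longrightarrow> (\<lambda>b. emeasure (K b) A) \<in> borel_measurable S"
    and f: "(\<lambda>(b, x). f b x) \<in> borel_measurable (S \<Otimes>\<^sub>M borel)"
  shows "(\<lambda>b. \<integral>\<^sup>+x. f b x \<partial>K b) \<in> borel_measurable S"
proof -
  define c where "c b = 1 + emeasure (K b) UNIV" for b
  define K' where "K' b = scale_measure (1 / c b) (K b)" for b
  have cc: "c b * (1 / c b) = 1" if "b \<in> space S" for b
    using fin[OF that] by (simp add: c_def ennreal_times_divide ennreal_divide_self)
  have [measurable]: "c \<in> borel_measurable S"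
    unfolding c_def using meas[of UNIV] by measurable
  have K': "K' \<in> measurable S (subprob_algebra borel)"
  proof (rule measurable_subprob_algebra)
    fix b assume b: "b \<in> space S"
    then show s: "sets (K' b) = sets borel" by (simp add: K'_def sets)
    have sp: "space (K b) = UNIV" using sets_eq_imp_space_eq[OF sets[OF b]] by simp
    have "emeasure (K' b) (space (K' b)) = 1 / c b * emeasure (K b) UNIV"
      by (simp add: K'_def space_scale_measure sp)
    also have "\<dots> \<le> 1 / c b * c b"
      unfolding c_def by (intro mult_left_mono) (auto simp: add_increasing)
    also have "\<dots> = 1" using cc[OF b] by (simp add: mult.commute)
    finally show "subprob_space (K' b)"
      by (intro subprob_spaceI) (auto simp: K'_def space_scale_measure sp)
  next
    fix A :: "'e set" assume "A \<in> sets borel"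
    then show "(\<lambda>b. emeasure (K' b) A) \<in> borel_measurable S"
      unfolding K'_def using meas[of A] by simp
  qed
  have "(\<lambda>b. c b * (\<integral>\<^sup>+x. f b x \<partial>K' b)) \<in> borel_measurable S"
    using nn_integral_measurable_subprob_algebra2[OF f K'] by measurable
  then show ?thesis
  proof (rule measurable_cong[THEN iffD1, rotated])
    fix b assume b: "b \<in> space S"
    have fb: "f b \<in> borel_measurable (K b)"
      using measurable_compose[OF measurable_Pair1'[OF b] f] sets[OF b]
      by (simp cong: measurable_cong_sets)
    have "c b * (\<integral>\<^sup>+x. f b x \<partial>K' b) = c b * (1 / c b) * (\<integral>\<^sup>+x. f b x \<partial>K b)"
      unfolding K'_def by (simp add: nn_integral_scale_measure[OF fb] mult.assoc)
    also have "c b * (1 / c b) = 1" by (rule cc[OF b])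
    finally show "c b * (\<integral>\<^sup>+x. f b x \<partial>K' b) = (\<integral>\<^sup>+x. f b x \<partial>K b)" by simp
  qed
qed

text \<open>\<open>measure_of\<close> falls back to the null measure when the set function is not
  countably additive. A single set of non-zero measure excludes the fallback, and the formula then
  holds on every Borel set.\<close>

lemma emeasure_kernel_dt:
  assumes "emeasure (kernel_dt k) A \<noteq> 0" "B \<in> sets borel"
  shows "emeasure (kernel_dt k) B = (\<integral>\<^sup>+t. emeasure (k t) (Pair t -` B) * indicator {0..} t \<partial>lborel)"
  using assms sets.sigma_sets_eq[of "borel :: (real \<times> 'a) measure"]
  by (auto simp: kernel_dt_def emeasure_measure_of_conv split: if_splits)

lemma sets_kernel_dt: "sets (kernel_dt k) = sets borel"
  unfolding kernel_dt_def using sets.sigma_sets_eq[of "borel :: (real \<times> 'a) measure"]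
  by (simp add: sets_measure_of_conv)

text \<open>Tonelli's theorem for \<open>k(t, dx) dt\<close>, by induction over \<open>V\<close>
  because the measure is not built as a product. Measurability in \<open>t\<close> of the inner
  integrals is an assumption: the kernel may be infinite at some times, and then it does not follow
  from measurability of the values on sets.\<close>

lemma nn_integral_kernel_dt:
  fixes k :: "real \<Rightarrow> 'e::euclidean_space measure"
  assumes nonnull: "emeasure (kernel_dt k) A \<noteq> 0"
    and sets: "\<And>t. 0 \<le> t \<Longrightarrow> sets (k t) = sets borel"
    and meas: "\<And>V. V \<in> borel_measurable borel \<Longrightarrow>
      (\<lambda>t. (\<integral>\<^sup>+x. V (t, x) \<partial>k t) * indicator {0..} t) \<in> borel_measurable borel"
    and V: "V \<in> borel_measurable borel"
  shows "(\<integral>\<^sup>+z. V z \<partial>kernel_dt k) = (\<integral>\<^sup>+t. (\<integral>\<^sup>+x. V (t, x) \<partial>k t) * indicator {0..} t \<partial>lborel)"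
  using V
proof (induction rule: borel_measurable_induct)
  case (cong f g)
  then show ?case by simp
next
  case (set B)
  have "(\<integral>\<^sup>+x. indicator B (t, x) \<partial>k t) = emeasure (k t) (Pair t -` B)" if "0 \<le> t" for t
  proof -
    have "Pair t -` B \<in> sets (k t)"
      using measurable_sets[of "Pair t" borel borel B] set sets[OF that] by (simp add: borel_prod[symmetric])
    moreover have "(\<lambda>x. indicator B (t, x) :: ennreal) = indicator (Pair t -` B)" by (auto simp: indicator_def)
    ultimately show ?thesis by simp
  qed
  then have "(\<integral>\<^sup>+t. (\<integral>\<^sup>+x. indicator B (t, x) \<partial>k t) * indicator {0..} t \<partial>lborel)
      = (\<integral>\<^sup>+t. emeasure (k t) (Pair t -` B) * indicator {0..} t \<partial>lborel)"
    by (intro nn_integral_cong) (auto simp: indicator_def)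
  then show ?case
    using emeasure_kernel_dt[OF nonnull set] set by (simp add: sets_kernel_dt)
next
  case (mult u c)
  have u: "(\<lambda>x. u (t, x)) \<in> borel_measurable (k t)" if "0 \<le> t" for t
    using measurable_compose[of "Pair t" borel borel u] mult(2) sets[OF that]
    by (simp add: borel_prod[symmetric] cong: measurable_cong_sets)
  have "(\<integral>\<^sup>+t. (\<integral>\<^sup>+x. c * u (t, x) \<partial>k t) * indicator {0..} t \<partial>lborel)
      = (\<integral>\<^sup>+t. c * ((\<integral>\<^sup>+x. u (t, x) \<partial>k t) * indicator {0..} t) \<partial>lborel)"
    using u by (intro nn_integral_cong) (auto simp: indicator_def nn_integral_cmult)
  also have "\<dots> = c * (\<integral>\<^sup>+t. (\<integral>\<^sup>+x. u (t, x) \<partial>k t) * indicator {0..} t \<partial>lborel)"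
    using meas[OF mult(2)] by (intro nn_integral_cmult) simp
  finally show ?case
    using mult by (subst nn_integral_cmult) (auto simp: sets_kernel_dt cong: measurable_cong_sets)
next
  case (add u v)
  have u: "(\<lambda>x. f (t, x)) \<in> borel_measurable (k t)" if "0 \<le> t" "f \<in> borel_measurable borel" for t and f :: "real \<times> 'e \<Rightarrow> ennreal"
    using measurable_compose[of "Pair t" borel borel f] that(2) sets[OF that(1)]
    by (simp add: borel_prod[symmetric] cong: measurable_cong_sets)
  have "(\<integral>\<^sup>+t. (\<integral>\<^sup>+x. v (t, x) + u (t, x) \<partial>k t) * indicator {0..} t \<partial>lborel)
      = (\<integral>\<^sup>+t. (\<integral>\<^sup>+x. v (t, x) \<partial>k t) * indicator {0..} t + (\<integral>\<^sup>+x. u (t, x) \<partial>k t) * indicator {0..} t \<partial>lborel)"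
    using u add by (intro nn_integral_cong) (auto simp: indicator_def nn_integral_add)
  also have "\<dots> = (\<integral>\<^sup>+t. (\<integral>\<^sup>+x. v (t, x) \<partial>k t) * indicator {0..} t \<partial>lborel)
      + (\<integral>\<^sup>+t. (\<integral>\<^sup>+x. u (t, x) \<partial>k t) * indicator {0..} t \<partial>lborel)"
    using meas add by (intro nn_integral_add) auto
  finally show ?case
    using add by (subst nn_integral_add) (auto simp: sets_kernel_dt cong: measurable_cong_sets)
next
  case (seq u)
  have u: "(\<lambda>x. f (t, x)) \<in> borel_measurable (k t)" if "0 \<le> t" "f \<in> borel_measurable borel" for t and f :: "real \<times> 'e \<Rightarrow> ennreal"
    using measurable_compose[of "Pair t" borel borel f] that(2) sets[OF that(1)]
    by (simp add: borel_prod[symmetric] cong: measurable_cong_sets)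
  have inc: "incseq (\<lambda>i. (\<integral>\<^sup>+x. u i (t, x) \<partial>k t) * indicator {0..} t)" for t
    using seq(3) by (intro incseq_SucI mult_right_mono nn_integral_mono) (auto simp: incseq_def le_fun_def)
  have "(\<integral>\<^sup>+z. (SUP i. u i) z \<partial>kernel_dt k) = (SUP i. \<integral>\<^sup>+z. u i z \<partial>kernel_dt k)"
    unfolding SUP_apply using seq
    by (intro nn_integral_monotone_convergence_SUP) (auto simp: sets_kernel_dt cong: measurable_cong_sets)
  also have "\<dots> = (SUP i. \<integral>\<^sup>+t. (\<integral>\<^sup>+x. u i (t, x) \<partial>k t) * indicator {0..} t \<partial>lborel)"
    by (simp add: seq)
  also have "\<dots> = (\<integral>\<^sup>+t. (SUP i. (\<integral>\<^sup>+x. u i (t, x) \<partial>k t) * indicator {0..} t) \<partial>lborel)"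
    using inc meas[OF seq(1)]
    by (intro nn_integral_monotone_convergence_SUP[symmetric]) (auto simp: incseq_def le_fun_def)
  also have "\<dots> = (\<integral>\<^sup>+t. (\<integral>\<^sup>+x. (SUP i. u i) (t, x) \<partial>k t) * indicator {0..} t \<partial>lborel)"
  proof (rule nn_integral_cong)
    fix t :: real
    show "(SUP i. (\<integral>\<^sup>+x. u i (t, x) \<partial>k t) * indicator {0..} t) = (\<integral>\<^sup>+x. (SUP i. u i) (t, x) \<partial>k t) * indicator {0..} t"
    proof (cases "0 \<le> t")
      case True
      have "(\<integral>\<^sup>+x. (SUP i. u i (t, x)) \<partial>k t) = (SUP i. \<integral>\<^sup>+x. u i (t, x) \<partial>k t)"
        using seq u[OF True] by (intro nn_integral_monotone_convergence_SUP) (auto simp: incseq_def le_fun_def)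
      then show ?thesis using True by (simp add: SUP_apply image_comp)
    qed simp
  qed
  finally show ?case .
qed

lemma rm_integral_mpp:
  fixes U :: "nat \<Rightarrow> 'a \<Rightarrow> 'e::euclidean_space"
  assumes "(\<lambda>(s, x). V ((\<omega>, s), x) * indicator I s) \<in> borel_measurable borel"
  shows "rm_integral (mpp_measure T U) V I \<omega> = (\<Sum>i. V ((\<omega>, T i \<omega>), U i \<omega>) * indicator I (T i \<omega>))"
  unfolding rm_integral_def mpp_measure_def using assms
  by (subst nn_integral_distr) (auto simp: nn_integral_count_space_nat)

lemma marked_point_process_facts:
  assumes "marked_point_process M F T U"
  shows "stopping_time F (T i)" "\<omega> \<in> space M \<Longrightarrow> 0 < T i \<omega>"
    "\<omega> \<in> space M \<Longrightarrow> T i \<omega> \<le> T j \<omega> \<longleftrightarrow> i \<le> j"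
    "AE \<omega> in M. filterlim (\<lambda>i. T i \<omega>) at_top sequentially"
proof -
  show "stopping_time F (T i)" "AE \<omega> in M. filterlim (\<lambda>i. T i \<omega>) at_top sequentially"
    using assms by (simp_all add: marked_point_process_def)
  have pos: "0 < T 0 \<omega>" and mono: "strict_mono (\<lambda>i. T i \<omega>)" if "\<omega> \<in> space M"
    using assms that by (auto simp: marked_point_process_def strict_mono_Suc_iff)
  show "\<omega> \<in> space M \<Longrightarrow> T i \<omega> \<le> T j \<omega> \<longleftrightarrow> i \<le> j"
    using strict_mono_less_eq[OF mono] by simp
  show "\<omega> \<in> space M \<Longrightarrow> 0 < T i \<omega>"
    using pos strict_mono_less_eq[OF mono, of 0 i] by fastforce
qed

section \<open>Compensators tested on predictable integrands\<close>

context stochastic_basis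
begin

text \<open>Predictable integrands live on non-negative times; with \<open>I\<close> inside
  \<open>{0..}\<close> the section can be extended by zero to a Borel function on the whole
  product.\<close>

lemma predictable_section:
  fixes V :: "('a \<times> real) \<times> 'e::euclidean_space \<Rightarrow> ennreal"
  assumes V: "V \<in> borel_measurable (predictable_sigma M F \<Otimes>\<^sub>M borel)"
    and \<omega>: "\<omega> \<in> space M" and I: "I \<in> sets borel" "I \<subseteq> {0..}"
  shows "(\<lambda>(s, x). V ((\<omega>, s), x) * indicator I s) \<in> borel_measurable borel"
proof -
  let ?R = "restrict_space (borel \<Otimes>\<^sub>M borel) ({0::real..} \<times> (UNIV :: 'e set))"
  have S: "{0::real..} \<times> (UNIV :: 'e set) \<in> sets (borel \<Otimes>\<^sub>M borel)" by simp
  have "(\<lambda>z. (\<omega>, fst z)) \<in> measurable ?R (predictable_sigma M F)"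
  proof (rule measurable_compose[OF _ measurable_Pair_predictable_path[OF \<omega>]])
    show "fst \<in> measurable ?R (restrict_space borel {0..})"
      by (intro measurable_restrict_space2 measurable_restrict_space1 measurable_fst)
        (auto simp: space_restrict_space)
  qed
  moreover have "snd \<in> measurable ?R borel"
    by (intro measurable_restrict_space1 measurable_snd)
  ultimately have "(\<lambda>z. ((\<omega>, fst z), snd z)) \<in> measurable ?R (predictable_sigma M F \<Otimes>\<^sub>M borel)"
    by measurable
  from measurable_compose[OF this V]
  have "(\<lambda>z. V ((\<omega>, fst z), snd z) * indicator ({0..} \<times> UNIV) z) \<in> borel_measurable (borel \<Otimes>\<^sub>M borel)"
    using S by (subst (asm) borel_measurable_restrict_space_iff_ennreal) auto
  moreover have "(\<lambda>z. indicator I (fst z) :: ennreal) \<in> borel_measurable (borel \<Otimes>\<^sub>M borel)"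
    by (rule measurable_compose[OF measurable_fst]) (use I in simp)
  ultimately have "(\<lambda>z. V ((\<omega>, fst z), snd z) * indicator ({0..} \<times> UNIV) z * indicator I (fst z)) \<in> borel_measurable borel"
    unfolding borel_prod[symmetric] by measurable
  moreover have "(\<lambda>z. V ((\<omega>, fst z), snd z) * indicator ({0..} \<times> UNIV) z * indicator I (fst z))
      = (\<lambda>(s, x). V ((\<omega>, s), x) * indicator I s)"
    using I(2) by (auto simp: fun_eq_iff indicator_def)
  ultimately show ?thesis by simp
qed

lemma rm_integral_mpp_predictable:
  fixes V :: "('a \<times> real) \<times> 'e::euclidean_space \<Rightarrow> ennreal"
  assumes "V \<in> borel_measurable (predictable_sigma M F \<Otimes>\<^sub>M borel)" "\<omega> \<in> space M"
    and "marked_point_process M F T U"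
  shows "rm_integral (mpp_measure T U) V {0..} \<omega> = (\<Sum>i. V ((\<omega>, T i \<omega>), U i \<omega>))"
  using marked_point_process_facts(2)[OF assms(3,2)]
  by (subst rm_integral_mpp[OF predictable_section[OF assms(1,2)]])
     (auto intro!: suminf_cong simp: indicator_def less_imp_le)

lemma predictable_fst_measurable:
  "f \<in> borel_measurable (predictable_sigma M F) \<Longrightarrow>
    (\<lambda>z. f (fst z)) \<in> borel_measurable (predictable_sigma M F \<Otimes>\<^sub>M borel)"
  by (rule measurable_compose[OF measurable_fst])

text \<open>Evaluated at the first jump: before its compensator has charged any mass, a point process
  cannot jump. In particular the compensator is almost surely not the null measure to which
  \<^const>\<open>kernel_dt\<close> may degenerate.\<close>

lemma compensator_pos:
  fixes U :: "nat \<Rightarrow> 'a \<Rightarrow> 'e::euclidean_space"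
  assumes comp: "compensator M F (mpp_measure T U) N" and mpp: "marked_point_process M F T U"
  shows "AE \<omega> in M. emeasure (N \<omega>) ({0..T 0 \<omega>} \<times> UNIV) \<noteq> 0"
proof -
  note T = marked_point_process_facts[OF mpp]
  define n where "n \<omega> t = emeasure (N \<omega>) ({0..t} \<times> UNIV)" for \<omega> and t :: real
  have pr: "predictable_random_measure M F N" using comp by (simp add: compensator_def)
  have setsN: "sets (N \<omega>) = sets borel" if "\<omega> \<in> space M" for \<omega>
    using pr that by (simp add: predictable_random_measure_def random_measure_def)
  have cyl: "{0..t} \<times> (UNIV :: 'e set) \<in> sets borel" for t :: real
    by (simp add: borel_prod[symmetric])
  have n_rm: "rm_integral N (\<lambda>_. 1) {0..t} \<omega> = n \<omega> t" if "\<omega> \<in> space M" for \<omega> t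
  proof -
    have "rm_integral N (\<lambda>_. 1) {0..t} \<omega> = (\<integral>\<^sup>+z. indicator ({0..t} \<times> UNIV) z \<partial>N \<omega>)"
      unfolding rm_integral_def by (intro nn_integral_cong) (auto simp: indicator_def)
    then show ?thesis using setsN[OF that] cyl by (simp add: n_def)
  qed
  have "(\<lambda>(\<omega>, t). rm_integral N (\<lambda>_. 1) {0..t} \<omega>) \<in> borel_measurable (predictable_sigma M F)"
    using pr by (simp add: predictable_random_measure_def)
  then have n_pred: "(\<lambda>(\<omega>, t). n \<omega> t) \<in> borel_measurable (predictable_sigma M F)"
    by (rule measurable_cong[THEN iffD1, rotated]) (auto simp: n_rm)
  \<comment> \<open>\<open>v\<close> indicates the times at which the compensator has charged
    nothing yet.\<close>
  define v where "v z = (indicator {0} (case z of (\<omega>, t) \<Rightarrow> n \<omega> t) :: ennreal)" for z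
  have v: "v \<in> borel_measurable (predictable_sigma M F)"
    unfolding v_def by (rule measurable_compose[OF n_pred]) simp
  have V: "(\<lambda>z. v (fst z)) \<in> borel_measurable (predictable_sigma M F \<Otimes>\<^sub>M (borel :: 'e measure))"
    by (rule predictable_fst_measurable[OF v])
  have "rm_integral N (\<lambda>z. v (fst z)) {0..} \<omega> = 0" if w: "\<omega> \<in> space M" for \<omega>
  proof -
    define D where "D = {s. 0 \<le> s \<and> n \<omega> s = 0}"
    \<comment> \<open>\<open>D\<close> is an initial interval of the time axis. Its rational points,
      together with its maximum if there is one, are countably many, and the cylinders below them
      cover it. Each such cylinder is null, hence so is their union.\<close>
    define Q where "Q = (D \<inter> \<rat>) \<union> {s\<in>D. \<forall>s'\<in>D. s' \<le> s}"
    have mono: "n \<omega> s \<le> n \<omega> s'" if "s \<le> s'" for s s'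
      unfolding n_def using that cyl setsN[OF w] by (intro emeasure_mono) auto
    have "countable {s\<in>D. \<forall>s'\<in>D. s' \<le> s}"
    proof (cases "{s\<in>D. \<forall>s'\<in>D. s' \<le> s} = {}")
      case False
      then obtain m where "m \<in> D" "\<forall>s'\<in>D. s' \<le> m" by auto
      then have "{s\<in>D. \<forall>s'\<in>D. s' \<le> s} \<subseteq> {m}" by force
      then show ?thesis by (rule countable_subset) simp
    next
      case True
      then show ?thesis by (simp only: countable_empty)
    qed
    then have "countable Q" unfolding Q_def using countable_rat by blast
    moreover have "{0..q} \<times> UNIV \<in> null_sets (N \<omega>)" if "q \<in> Q" for q
      using that cyl setsN[OF w] by (auto simp: null_sets_def Q_def D_def n_def)
    ultimately have null: "(\<Union>q\<in>Q. {0..q} \<times> UNIV) \<in> null_sets (N \<omega>)"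
      by (intro null_sets_UN') auto
    have "D \<subseteq> (\<Union>q\<in>Q. {0..q})"
    proof
      fix s assume s: "s \<in> D"
      show "s \<in> (\<Union>q\<in>Q. {0..q})"
      proof (cases "\<forall>s'\<in>D. s' \<le> s")
        case False
        then obtain s' where s': "s' \<in> D" "s < s'" by force
        then obtain q where q: "q \<in> \<rat>" "s < q" "q < s'" using Rats_dense_in_real by blast
        then have "q \<in> D" using s s' mono[of q s'] by (auto simp: D_def)
        then have "q \<in> Q" "s \<in> {0..q}" using q s by (auto simp: Q_def D_def)
        then show ?thesis by blast
      qed (use s in \<open>auto simp: Q_def D_def\<close>)
    qed
    then have "rm_integral N (\<lambda>z. v (fst z)) {0..} \<omega>
        = (\<integral>\<^sup>+z. v (\<omega>, fst z) * indicator {0..} (fst z) * indicator (\<Union>q\<in>Q. {0..q} \<times> UNIV) z \<partial>N \<omega>)"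
      unfolding rm_integral_def
      by (intro nn_integral_cong) (auto simp: v_def indicator_def D_def)
    also have "\<dots> = 0" by (rule nn_integral_null_set[OF null])
    finally show ?thesis .
  qed
  then have "0 = (\<integral>\<^sup>+\<omega>. rm_integral N (\<lambda>z. v (fst z)) {0..} \<omega> \<partial>M)"
    by (simp cong: nn_integral_cong)
  also have "\<dots> = (\<integral>\<^sup>+\<omega>. rm_integral (mpp_measure T U) (\<lambda>z. v (fst z)) {0..} \<omega> \<partial>M)"
    using comp V unfolding compensator_def by metis
  \<comment> \<open>Of the sum over all points only the first one is kept.\<close>
  also have "\<dots> \<ge> (\<integral>\<^sup>+\<omega>. v (\<omega>, T 0 \<omega>) \<partial>M)"
  proof (rule nn_integral_mono)
    fix \<omega> assume w: "\<omega> \<in> space M"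
    have "v (\<omega>, T 0 \<omega>) = (\<Sum>i<1. v (\<omega>, T i \<omega>))" by simp
    also have "\<dots> \<le> (\<Sum>i. v (\<omega>, T i \<omega>))" by (rule sum_le_suminf) auto
    also have "\<dots> = rm_integral (mpp_measure T U) (\<lambda>z. v (fst z)) {0..} \<omega>"
      using rm_integral_mpp_predictable[OF V w mpp] by simp
    finally show "v (\<omega>, T 0 \<omega>) \<le> rm_integral (mpp_measure T U) (\<lambda>z. v (fst z)) {0..} \<omega>" .
  qed
  finally have 0: "(\<integral>\<^sup>+\<omega>. v (\<omega>, T 0 \<omega>) \<partial>M) = 0" by simp
  have "T 0 \<in> borel_measurable M"
    using measurable_stopping_time[OF T(1)] sets_F_subset by auto
  then have "(\<lambda>\<omega>. (\<omega>, T 0 \<omega>)) \<in> measurable M (M \<Otimes>\<^sub>M borel)" by measurable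
  from measurable_compose[OF this predictable_joint[OF v]]
  have "(\<lambda>\<omega>. v (\<omega>, T 0 \<omega>) * indicator {0..} (T 0 \<omega>)) \<in> borel_measurable M" by simp
  then have "(\<lambda>\<omega>. v (\<omega>, T 0 \<omega>)) \<in> borel_measurable M"
    by (rule measurable_cong[THEN iffD1, rotated]) (use T(2) in \<open>auto simp: indicator_def less_imp_le\<close>)
  with 0 have "AE \<omega> in M. v (\<omega>, T 0 \<omega>) = 0" by (simp add: nn_integral_0_iff_AE)
  then show ?thesis by eventually_elim (auto simp: v_def n_def indicator_def)
qed

text \<open>Predictability of the closed stochastic interval up to \<open>\<sigma>\<close>: the
  event \<open>\<sigma> < t\<close> is the union of the events
  \<open>\<sigma> \<le> t - 1 / Suc j\<close>, so it is decided at time \<open>t\<close>, and so is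
  its complement. Closing the interval on the right makes the paths left-continuous.\<close>

lemma stopping_time_left_process:
  assumes "stopping_time F \<sigma>"
  shows "left_process M F (\<lambda>t \<omega>. indicator {..\<sigma> \<omega>} t)"
  unfolding left_process_def adapted_def
proof (intro conjI allI impI ballI)
  fix t :: real assume "0 \<le> t"
  have "{\<omega> \<in> space M. t \<le> \<sigma> \<omega>} \<in> sets (F t)"
  proof -
    have "{\<omega> \<in> space M. \<sigma> \<omega> \<le> t - 1 / real (Suc j)} \<in> sets (F t)" for j
      using stopping_timeD[OF assms, of "t - 1 / real (Suc j)"] sets_F_mono[of "t - 1 / real (Suc j)" t]
      by (auto simp: pred_def)
    then have "(\<Union>j. {\<omega> \<in> space M. \<sigma> \<omega> \<le> t - 1 / real (Suc j)}) \<in> sets (F t)" by blast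
    also have "(\<Union>j. {\<omega> \<in> space M. \<sigma> \<omega> \<le> t - 1 / real (Suc j)}) = {\<omega> \<in> space M. \<sigma> \<omega> < t}"
    proof safe
      fix \<omega> assume "\<sigma> \<omega> < t"
      then obtain j where "1 / real (Suc j) < t - \<sigma> \<omega>"
        using reals_Archimedean[of "t - \<sigma> \<omega>"] by (auto simp: inverse_eq_divide)
      then show "\<omega> \<in> (\<Union>j. {\<omega> \<in> space M. \<sigma> \<omega> \<le> t - 1 / real (Suc j)})" if "\<omega> \<in> space M"
        using that by (auto intro!: exI[of _ j])
    next
      fix \<omega> j assume "\<sigma> \<omega> \<le> t - 1 / real (Suc j)"
      moreover have "0 < 1 / real (Suc j)" by simp
      ultimately show "\<sigma> \<omega> < t" by linarith
    qed
    finally have "space (F t) - {\<omega> \<in> space M. \<sigma> \<omega> < t} \<in> sets (F t)" by (rule sets.compl_sets)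
    moreover have "space (F t) - {\<omega> \<in> space M. \<sigma> \<omega> < t} = {\<omega> \<in> space M. t \<le> \<sigma> \<omega>}" by auto
    ultimately show ?thesis by simp
  qed
  then have "(indicator {\<omega>. t \<le> \<sigma> \<omega>} :: 'a \<Rightarrow> real) \<in> borel_measurable (F t)"
    by (intro borel_measurable_indicator') simp
  moreover have "indicator {\<omega>. t \<le> \<sigma> \<omega>} = (\<lambda>\<omega>. indicator {..\<sigma> \<omega>} t :: real)" by (auto simp: indicator_def)
  ultimately show "(\<lambda>\<omega>. indicator {..\<sigma> \<omega>} t :: real) \<in> borel_measurable (F t)" by simp
next
  fix \<omega> and t :: real
  have "eventually (\<lambda>s. indicator {..\<sigma> \<omega>} s = (indicator {..\<sigma> \<omega>} t :: real)) (at_left t)"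
  proof (cases "t \<le> \<sigma> \<omega>")
    case True
    then show ?thesis by (auto simp: eventually_at_left_field indicator_def intro!: exI[of _ "t - 1"])
  next
    case False
    then show ?thesis by (auto simp: eventually_at_left_field indicator_def intro!: exI[of _ "\<sigma> \<omega>"])
  qed
  then show "continuous (at_left t) (\<lambda>s. indicator {..\<sigma> \<omega>} s :: real)"
    unfolding continuous_within by (rule tendsto_eventually)
qed

text \<open>The closed interval up to \<open>T n\<close> is predictable and contains exactly
  \<open>n + 1\<close> points, so the compensator has expected mass \<open>n + 1\<close> there and
  is almost surely finite. By \<open>compensator_pos\<close> this mass can be written as the time
  integral of the total masses of \<open>k\<close>.\<close>

lemma compensator_kernel:
  fixes U :: "nat \<Rightarrow> 'a \<Rightarrow> 'e::euclidean_space"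
  assumes comp: "compensator M F (mpp_measure T U) N" and mpp: "marked_point_process M F T U"
    and k: "AE \<omega> in M. N \<omega> = kernel_dt (k \<omega>)"
  shows "AE \<omega> in M. \<forall>n. (\<integral>\<^sup>+t. emeasure (k \<omega> t) UNIV * indicator {0..T n \<omega>} t \<partial>lborel) < \<infinity>"
proof -
  note T = marked_point_process_facts[OF mpp]
  have pr: "predictable_random_measure M F N" using comp by (simp add: compensator_def)
  have setsN: "sets (N \<omega>) = sets borel" if "\<omega> \<in> space M" for \<omega>
    using pr that by (simp add: predictable_random_measure_def random_measure_def)
  have "AE \<omega> in M. rm_integral N (\<lambda>((\<omega>, t), x). indicator {..T n \<omega>} t) {0..} \<omega> \<noteq> \<infinity>" for n
  proof -
    let ?V = "\<lambda>((\<omega>, t), x :: 'e). indicator {..T n \<omega>} t :: ennreal"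
    note v = left_process_predictable[OF stopping_time_left_process[OF T(1)[of n]]]
    have "(\<lambda>(\<omega>, t). indicator {..T n \<omega>} t :: ennreal) \<in> borel_measurable (predictable_sigma M F)"
      using measurable_compose[OF v, of ennreal] by (simp add: split_beta' ennreal_indicator)
    from predictable_fst_measurable[OF this]
    have V: "?V \<in> borel_measurable (predictable_sigma M F \<Otimes>\<^sub>M borel)" by (simp add: split_beta')
    have "rm_integral (mpp_measure T U) ?V {0..} \<omega> = of_nat (Suc n)" if w: "\<omega> \<in> space M" for \<omega>
    proof -
      have "rm_integral (mpp_measure T U) ?V {0..} \<omega> = (\<Sum>i. indicator {..T n \<omega>} (T i \<omega>))"
        using rm_integral_mpp_predictable[OF V w mpp] by simp
      also have "\<dots> = (\<Sum>i\<in>{..n}. indicator {..T n \<omega>} (T i \<omega>))"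
        using T(3)[OF w] by (intro suminf_finite) (auto simp: indicator_def)
      also have "\<dots> = of_nat (Suc n)" using T(3)[OF w] by (simp add: indicator_def)
      finally show ?thesis .
    qed
    then have "(\<integral>\<^sup>+\<omega>. rm_integral (mpp_measure T U) ?V {0..} \<omega> \<partial>M) = (\<integral>\<^sup>+\<omega>. of_nat (Suc n) \<partial>M)"
      by (intro nn_integral_cong)
    also have "\<dots> = of_nat (Suc n)" by (simp add: emeasure_space_1)
    finally have "(\<integral>\<^sup>+\<omega>. rm_integral N ?V {0..} \<omega> \<partial>M) = of_nat (Suc n)"
      using comp V unfolding compensator_def by metis
    \<comment> \<open>A predictable random measure has measurable integrals over
      \<open>{0..t}\<close>; the half-line is reached as their increasing limit along integer
      times.\<close>
    moreover have "rm_integral N ?V {0..} \<in> borel_measurable M"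
    proof -
      have m: "(\<lambda>\<omega>. rm_integral N ?V {0..real j} \<omega>) \<in> borel_measurable M" for j
      proof -
        have "(\<lambda>(\<omega>, t). rm_integral N ?V {0..t} \<omega>) \<in> borel_measurable (predictable_sigma M F)"
          using pr V unfolding predictable_random_measure_def by blast
        from measurable_compose[OF measurable_Pair_predictable_time this, of "real j"]
        show ?thesis by (intro measurable_F_M[of _ "real j"]) simp
      qed
      have "rm_integral N ?V {0..} \<omega> = (SUP j. rm_integral N ?V {0..real j} \<omega>)" if w: "\<omega> \<in> space M" for \<omega>
      proof -
        have "(SUP j. indicator {0..real j} s :: ennreal) = indicator {0..} s" for s :: real
        proof (rule antisym)
          obtain j where "s \<le> real j" using real_arch_simple by blast
          then show "indicator {0..} s \<le> (SUP j. indicator {0..real j} s :: ennreal)"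
            by (intro SUP_upper2[of j]) (auto simp: indicator_def)
        qed (auto intro!: SUP_least simp: indicator_def)
        then have "rm_integral N ?V {0..} \<omega> = (\<integral>\<^sup>+z. (SUP j. ?V ((\<omega>, fst z), snd z) * indicator {0..real j} (fst z)) \<partial>N \<omega>)"
          unfolding rm_integral_def by (intro nn_integral_cong) (simp add: SUP_mult_left_ennreal[symmetric] split_beta')
        also have "\<dots> = (SUP j. \<integral>\<^sup>+z. ?V ((\<omega>, fst z), snd z) * indicator {0..real j} (fst z) \<partial>N \<omega>)"
        proof (rule nn_integral_monotone_convergence_SUP)
          show "incseq (\<lambda>j z. ?V ((\<omega>, fst z), snd z) * indicator {0..real j} (fst z) :: ennreal)"
            by (intro incseq_SucI le_funI mult_left_mono) (auto simp: indicator_def)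
          show "(\<lambda>z. ?V ((\<omega>, fst z), snd z) * indicator {0..real j} (fst z)) \<in> borel_measurable (N \<omega>)" for j
            using predictable_section[OF V w, of "{0..real j}"] setsN[OF w]
            by (simp add: split_beta' cong: measurable_cong_sets)
        qed
        finally show ?thesis by (simp add: rm_integral_def split_beta')
      qed
      then show ?thesis using m by (subst measurable_cong) auto
    qed
    ultimately show ?thesis by (intro nn_integral_PInf_AE) auto
  qed
  then have "AE \<omega> in M. \<forall>n. rm_integral N (\<lambda>((\<omega>, t), x). indicator {..T n \<omega>} t) {0..} \<omega> \<noteq> \<infinity>"
    by (simp add: AE_all_countable)
  with compensator_pos[OF comp mpp] k AE_space show ?thesis
  proof eventually_elim
    case (elim \<omega>)
    show ?case
    proof
      fix n
      have cyl: "{0..T n \<omega>} \<times> (UNIV :: 'e set) \<in> sets borel"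
        by (simp add: borel_prod[symmetric])
      have "rm_integral N (\<lambda>((\<omega>, t), x). indicator {..T n \<omega>} t) {0..} \<omega>
          = (\<integral>\<^sup>+z. indicator ({0..T n \<omega>} \<times> UNIV) z \<partial>N \<omega>)"
        unfolding rm_integral_def by (intro nn_integral_cong) (auto simp: indicator_def)
      also have "\<dots> = emeasure (N \<omega>) ({0..T n \<omega>} \<times> UNIV)"
        using setsN[OF elim(3)] cyl by simp
      also have "\<dots> = (\<integral>\<^sup>+t. emeasure (k \<omega> t) (Pair t -` ({0..T n \<omega>} \<times> UNIV)) * indicator {0..} t \<partial>lborel)"
        using elim(1,2) cyl by (simp add: emeasure_kernel_dt)
      also have "\<dots> = (\<integral>\<^sup>+t. emeasure (k \<omega> t) UNIV * indicator {0..T n \<omega>} t \<partial>lborel)"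
      proof (rule nn_integral_cong)
        fix t
        have "Pair t -` ({0..T n \<omega>} \<times> (UNIV :: 'e set)) = (if t \<in> {0..T n \<omega>} then UNIV else {})" by auto
        then show "emeasure (k \<omega> t) (Pair t -` ({0..T n \<omega>} \<times> UNIV)) * indicator {0..} t
            = emeasure (k \<omega> t) UNIV * indicator {0..T n \<omega>} t" by (auto simp: indicator_def)
      qed
      finally show "(\<integral>\<^sup>+t. emeasure (k \<omega> t) UNIV * indicator {0..T n \<omega>} t \<partial>lborel) < \<infinity>"
        using spec[OF elim(4), of n] by (simp add: less_top)
    qed
  qed
qed

end


section \<open>Exponentials of integrals and of jump sums\<close>

text \<open>Takes the place of the fundamental theorem of calculus, which needs more than a Lebesgue
  integrable integrand.\<close>

lemma eq_if_quadratic_bound: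
  fixes f A :: "real \<Rightarrow> real"
  assumes A: "continuous_on {a..b} A" and mono: "\<And>x y. a \<le> x \<Longrightarrow> x \<le> y \<Longrightarrow> y \<le> b \<Longrightarrow> A x \<le> A y"
    and bound: "\<And>x y. a \<le> x \<Longrightarrow> x \<le> y \<Longrightarrow> y \<le> b \<Longrightarrow> \<bar>f y - f x\<bar> \<le> C * (A y - A x)\<^sup>2"
    and ab: "a \<le> b"
  shows "f b = f a"
proof -
  have "\<bar>f y - f x\<bar> \<le> C * (A y - A x)\<^sup>2 / 2 ^ n" if "a \<le> x" "x \<le> y" "y \<le> b" for x y n
    using that
  proof (induction n arbitrary: x y)
    case (Suc n)
    have "A x \<le> (A x + A y) / 2" "(A x + A y) / 2 \<le> A y" using mono[OF Suc.prems] by auto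
    moreover have "continuous_on {x..y} A"
      using Suc.prems by (intro continuous_on_subset[OF A]) auto
    \<comment> \<open>Splitting where \<open>A\<close> reaches the mean of its end values, and not
      at the middle of the interval, halves each increment of \<open>A\<close>; the squares of the
      two halves add up to half the square.\<close>
    ultimately obtain z where z: "x \<le> z" "z \<le> y" "A z = (A x + A y) / 2"
      using IVT'[of A x "(A x + A y) / 2" y] Suc.prems by auto
    have "\<bar>f y - f x\<bar> \<le> \<bar>f y - f z\<bar> + \<bar>f z - f x\<bar>" by simp
    also have "\<dots> \<le> C * (A y - A z)\<^sup>2 / 2 ^ n + C * (A z - A x)\<^sup>2 / 2 ^ n"
      using Suc.prems z by (intro add_mono Suc.IH) auto
    also have "\<dots> = C * (A y - A x)\<^sup>2 / 2 ^ Suc n"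
      unfolding z(3) by (simp add: field_simps power2_eq_square)
    finally show ?case .
  qed (use bound in simp)
  from this[of a b] have le: "\<bar>f b - f a\<bar> \<le> C * (A b - A a)\<^sup>2 / 2 ^ n" for n
    using ab by simp
  have "(\<lambda>n. C * (A b - A a)\<^sup>2 / 2 ^ n) \<longlonglongrightarrow> 0"
    by (rule LIMSEQ_divide_realpow_zero) simp
  then have "\<bar>f b - f a\<bar> \<le> 0"
    by (rule LIMSEQ_le_const) (use le in auto)
  then show ?thesis by simp
qed

lemma exp_diff_le:
  fixes x y :: real
  assumes "\<bar>x\<bar> \<le> b" "\<bar>y\<bar> \<le> b"
  shows "\<bar>exp x - exp y\<bar> \<le> exp b * \<bar>x - y\<bar>"
proof -
  have *: "\<bar>exp x - exp y\<bar> \<le> exp b * \<bar>x - y\<bar>" if "y \<le> x" "x \<le> b" for x y :: real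
  proof -
    have "1 - exp (y - x) \<le> x - y" using exp_ge_add_one_self[of "y - x"] by linarith
    then have "exp x * (1 - exp (y - x)) \<le> exp b * (x - y)"
      using that by (intro mult_mono) auto
    then show ?thesis using that by (simp add: exp_diff right_diff_distrib)
  qed
  show ?thesis
    using *[of x y] *[of y x] assms by (cases "y \<le> x") (auto simp: abs_minus_commute)
qed

text \<open>By convexity the first-order remainders at \<open>y\<close> and at \<open>x\<close> are
  both non-negative. Their sum is \<open>(x - y) * (exp x - exp y)\<close>, which therefore bounds
  either of them.\<close>

lemma exp_second_order_le:
  fixes x y :: real
  assumes "\<bar>x\<bar> \<le> b" "\<bar>y\<bar> \<le> b"
  shows "\<bar>exp x - exp y - (x - y) * exp y\<bar> \<le> exp b * (x - y)\<^sup>2"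
proof -
  have 1: "0 \<le> exp x - exp y - (x - y) * exp y"
    using mult_right_mono[OF exp_ge_add_one_self[of "x - y"], of "exp y"]
    by (simp add: exp_diff algebra_simps)
  have 2: "0 \<le> exp y - exp x - (y - x) * exp x"
    using mult_right_mono[OF exp_ge_add_one_self[of "y - x"], of "exp x"]
    by (simp add: exp_diff algebra_simps)
  have "\<bar>exp x - exp y - (x - y) * exp y\<bar> \<le> (x - y) * (exp x - exp y)"
    using 1 2 by (simp add: algebra_simps)
  also have "\<dots> \<le> \<bar>x - y\<bar> * \<bar>exp x - exp y\<bar>" by (simp add: abs_mult[symmetric])
  also have "\<dots> \<le> \<bar>x - y\<bar> * (exp b * \<bar>x - y\<bar>)"
    using exp_diff_le[OF assms] by (intro mult_left_mono) auto
  finally show ?thesis by (simp add: power2_eq_square ac_simps)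
qed

section \<open>Indefinite integrals and their exponentials\<close>

lemma locally_integrable_subset:
  assumes "locally_integrable h" "0 \<le> u"
  shows "set_integrable lborel {u<..v} h" "set_integrable lborel {u..v} h"
proof -
  have "set_integrable lborel {0..max u v} h" using assms by (simp add: locally_integrable_def)
  then show "set_integrable lborel {u<..v} h" "set_integrable lborel {u..v} h"
    using assms(2) by (auto intro: set_integrable_subset)
qed

lemma locally_integrable_split:
  assumes h: "locally_integrable h" and uv: "0 \<le> u" "u \<le> v"
  shows "(LINT s:{0..v}|lborel. h s) = (LINT s:{0..u}|lborel. h s) + (LINT s:{u<..v}|lborel. h s)"
proof -
  have "{0..v} = {0..u} \<union> {u<..v}" using uv by auto
  then show ?thesis
    using locally_integrable_subset(1)[OF h uv(1), of v] locally_integrable_subset(2)[OF h order_refl, of u]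
    by (simp only:) (intro set_integral_Un, auto)
qed

lemma locally_integrable_continuous:
  assumes h: "locally_integrable h"
  shows "continuous_on {0..} (\<lambda>t. LINT s:{0..t}|lborel. h s)"
proof -
  have "continuous_on {0..b} (\<lambda>t. LINT s:{0..t}|lborel. h s)" for b
  proof -
    have "h integrable_on {0..b}"
      using set_borel_integral_eq_integral(1)[OF locally_integrable_subset(2)[OF h, of 0 b]] by simp
    from indefinite_integral_continuous_1[OF this] show ?thesis
      by (rule continuous_on_eq)
        (simp add: set_borel_integral_eq_integral(2)[OF locally_integrable_subset(2)[OF h order_refl]])
  qed
  then have "continuous (at t within {0..t+1}) (\<lambda>t. LINT s:{0..t}|lborel. h s)" if "0 \<le> t" for t
    using that by (auto simp: continuous_on_eq_continuous_within)
  moreover have "at t within {0..t+1} = at t within {0..}" for t :: real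
    by (rule at_within_nhd[of t "{..<t+1}"]) auto
  ultimately show ?thesis by (simp add: continuous_on_eq_continuous_within)
qed

lemma locally_integrable_mult:
  assumes h: "locally_integrable h" and g: "continuous_on {0..} g"
  shows "locally_integrable (\<lambda>s. h s * g s)"
  unfolding locally_integrable_def
proof (intro allI impI)
  fix t :: real assume t: "0 \<le> t"
  have "continuous_on {0..t} g" using g by (rule continuous_on_subset) auto
  then have gm: "(\<lambda>s. indicator {0..t} s *\<^sub>R g s) \<in> borel_measurable borel"
    and "compact (g ` {0..t})"
    by (intro borel_measurable_continuous_on_indicator compact_continuous_image compact_Icc; simp)+
  then obtain C where C: "\<And>s. s \<in> {0..t} \<Longrightarrow> \<bar>g s\<bar> \<le> C"
    by (metis bounded_real compact_imp_bounded imageI)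
  have hm: "set_integrable lborel {0..t} h" using h t by (simp add: locally_integrable_def)
  show "set_integrable lborel {0..t} (\<lambda>s. h s * g s)"
    unfolding set_integrable_def
  proof (rule Bochner_Integration.integrable_bound)
    show "integrable lborel (\<lambda>s. C * (indicator {0..t} s *\<^sub>R h s))"
      using hm by (simp add: set_integrable_def)
    have "(\<lambda>s. (indicator {0..t} s *\<^sub>R h s) * (indicator {0..t} s *\<^sub>R g s)) \<in> borel_measurable lborel"
      using gm borel_measurable_integrable[OF hm[unfolded set_integrable_def]] by measurable
    then show "(\<lambda>s. indicator {0..t} s *\<^sub>R (h s * g s)) \<in> borel_measurable lborel"
      by (rule measurable_cong[THEN iffD1, rotated]) (simp add: indicator_def)
    show "AE s in lborel. norm (indicator {0..t} s *\<^sub>R (h s * g s)) \<le> norm (C * (indicator {0..t} s *\<^sub>R h s))"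
    proof (rule AE_I2)
      fix s :: real
      show "norm (indicator {0..t} s *\<^sub>R (h s * g s)) \<le> norm (C * (indicator {0..t} s *\<^sub>R h s))"
      proof (cases "s \<in> {0..t}")
        case True
        then have "\<bar>h s\<bar> * \<bar>g s\<bar> \<le> \<bar>h s\<bar> * \<bar>C\<bar>"
          using C[OF True] by (intro mult_left_mono) auto
        then show ?thesis using True by (simp add: abs_mult mult.commute)
      qed simp
    qed
  qed
qed

lemma integral_point: "(LINT s:{0..0::real}|lborel. f s) = (0::real)"
  unfolding set_lebesgue_integral_def
proof (rule integral_eq_zero_AE)
  show "AE s in lborel. indicator {0..0} s *\<^sub>R f s = 0"
    using AE_lborel_singleton[of 0] by eventually_elim (auto simp: indicator_def)
qed

text \<open>\<open>A\<close> is the variation of \<open>K\<close>. The increment of \<open>f\<close>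
  consists of the second-order remainder of the exponential and of the error from freezing
  \<open>exp (- K s)\<close> at the left end; each is at most \<open>exp (A v)\<close> times the
  squared increment of \<open>A\<close>, whence the constant \<open>2 * exp (A v)\<close>.\<close>

lemma exp_integral_eq:
  assumes h: "locally_integrable h" and uv: "0 \<le> u" "u \<le> v"
  defines "K \<equiv> \<lambda>t. LINT s:{0..t}|lborel. h s"
  shows "exp (- K v) - exp (- K u) = - (LINT s:{u<..v}|lborel. h s * exp (- K s))"
proof -
  have abs_h: "locally_integrable (\<lambda>s. \<bar>h s\<bar>)"
    using h by (auto simp: locally_integrable_def dest: set_integrable_abs)
  define A where "A = (\<lambda>t. LINT s:{0..t}|lborel. \<bar>h s\<bar>)"
  have Kc: "continuous_on {0..} K" unfolding K_def by (rule locally_integrable_continuous[OF h])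
  have Ac: "continuous_on {0..} A" unfolding A_def by (rule locally_integrable_continuous[OF abs_h])
  have hK: "locally_integrable (\<lambda>s. h s * exp (- K s))"
    by (intro locally_integrable_mult[OF h] continuous_intros Kc)
  have Ad: "A y - A x = (LINT s:{x<..y}|lborel. \<bar>h s\<bar>)" if "0 \<le> x" "x \<le> y" for x y
    using locally_integrable_split[OF abs_h that] by (simp add: A_def)
  have Kd: "K y - K x = (LINT s:{x<..y}|lborel. h s)" if "0 \<le> x" "x \<le> y" for x y
    using locally_integrable_split[OF h that] by (simp add: K_def)
  have Amono: "A x \<le> A y" if "0 \<le> x" "x \<le> y" for x y
  proof -
    have "0 \<le> (LINT s:{x<..y}|lborel. \<bar>h s\<bar>)"
      unfolding set_lebesgue_integral_def by (rule Bochner_Integration.integral_nonneg) simp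
    then show ?thesis using Ad[OF that] by simp
  qed
  have KA: "\<bar>K y - K x\<bar> \<le> A y - A x" if "0 \<le> x" "x \<le> y" for x y
  proof -
    have "norm (LINT s:{x<..y}|lborel. h s) \<le> (LINT s:{x<..y}|lborel. norm (h s))"
      by (rule set_integral_norm_bound) (rule locally_integrable_subset[OF h that(1)])
    then show ?thesis using Ad[OF that] Kd[OF that] by simp
  qed
  have "K 0 = 0" "A 0 = 0" unfolding K_def A_def by (rule integral_point)+
  then have Kb: "\<bar>K x\<bar> \<le> A v" if "0 \<le> x" "x \<le> v" for x
    using KA[OF order_refl that(1)] Amono[OF that] by simp
  define f where "f t = exp (- K t) + (LINT s:{0..t}|lborel. h s * exp (- K s))" for t
  have "f v = f u"
  proof (rule eq_if_quadratic_bound[OF _ _ _ uv(2), where A = A and C = "2 * exp (A v)"])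
    show "continuous_on {u..v} A" by (rule continuous_on_subset[OF Ac]) (use uv in auto)
    show "A x \<le> A y" if "u \<le> x" "x \<le> y" "y \<le> v" for x y using Amono that uv by auto
    fix x y assume xy: "u \<le> x" "x \<le> y" "y \<le> v"
    then have x0: "0 \<le> x" using uv by simp
    have i1: "set_integrable lborel {x<..y} (\<lambda>s. h s * exp (- K s))"
      by (rule locally_integrable_subset[OF hK x0])
    have i2: "set_integrable lborel {x<..y} h" by (rule locally_integrable_subset[OF h x0])
    have i3: "set_integrable lborel {x<..y} (\<lambda>s. h s * exp (- K x))" using i2 by simp
    have "f y - f x = exp (- K y) - exp (- K x) + (LINT s:{x<..y}|lborel. h s * exp (- K s))"
      using locally_integrable_split[OF hK x0 xy(2)] by (simp add: f_def)
    also have "(LINT s:{x<..y}|lborel. h s * exp (- K s))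
        = (LINT s:{x<..y}|lborel. h s * exp (- K s) - h s * exp (- K x)) + (K y - K x) * exp (- K x)"
      using i1 i3 by (simp add: set_integral_diff Kd[OF x0 xy(2)])
    finally have "f y - f x = (exp (- K y) - exp (- K x) - (- K y - - K x) * exp (- K x))
        + (LINT s:{x<..y}|lborel. h s * exp (- K s) - h s * exp (- K x))"
      by (simp add: algebra_simps)
    moreover have "\<bar>exp (- K y) - exp (- K x) - (- K y - - K x) * exp (- K x)\<bar> \<le> exp (A v) * (A y - A x)\<^sup>2"
    proof -
      have "\<bar>exp (- K y) - exp (- K x) - (- K y - - K x) * exp (- K x)\<bar> \<le> exp (A v) * (- K y - - K x)\<^sup>2"
        using Kb[of x] Kb[of y] x0 xy by (intro exp_second_order_le) auto
      also have "(- K y - - K x)\<^sup>2 \<le> (A y - A x)\<^sup>2"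
        using KA[OF x0 xy(2)] by (intro abs_le_square_iff[THEN iffD1]) auto
      finally show ?thesis by simp
    qed
    moreover have "\<bar>LINT s:{x<..y}|lborel. h s * exp (- K s) - h s * exp (- K x)\<bar> \<le> exp (A v) * (A y - A x)\<^sup>2"
    proof -
      have i4: "set_integrable lborel {x<..y} (\<lambda>s. h s * exp (- K s) - h s * exp (- K x))"
        using i1 i3 by (rule set_integral_diff)
      have i5: "set_integrable lborel {x<..y} (\<lambda>s. exp (A v) * (A y - A x) * \<bar>h s\<bar>)"
        using locally_integrable_subset(1)[OF abs_h x0, of y] by simp
      have "norm (LINT s:{x<..y}|lborel. h s * exp (- K s) - h s * exp (- K x))
          \<le> (LINT s:{x<..y}|lborel. norm (h s * exp (- K s) - h s * exp (- K x)))"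
        by (rule set_integral_norm_bound[OF i4])
      also have "\<dots> \<le> (LINT s:{x<..y}|lborel. exp (A v) * (A y - A x) * \<bar>h s\<bar>)"
      proof (rule set_integral_mono[OF _ i5])
        show "set_integrable lborel {x<..y} (\<lambda>s. norm (h s * exp (- K s) - h s * exp (- K x)))"
          using i4 by (rule set_integrable_norm)
        fix s assume s: "s \<in> {x<..y}"
        have "\<bar>exp (- K s) - exp (- K x)\<bar> \<le> exp (A v) * \<bar>- K s - - K x\<bar>"
          using Kb[of x] Kb[of s] x0 xy s by (intro exp_diff_le) auto
        also have "\<dots> \<le> exp (A v) * (A y - A x)"
        proof -
          have "\<bar>K s - K x\<bar> \<le> A s - A x" using KA[of x s] x0 s by simp
          also have "\<dots> \<le> A y - A x" using Amono[of s y] x0 s by simp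
          finally show ?thesis by (intro mult_left_mono) auto
        qed
        finally have "\<bar>h s\<bar> * \<bar>exp (- K s) - exp (- K x)\<bar> \<le> \<bar>h s\<bar> * (exp (A v) * (A y - A x))"
          by (rule mult_left_mono) simp
        then show "norm (h s * exp (- K s) - h s * exp (- K x)) \<le> exp (A v) * (A y - A x) * \<bar>h s\<bar>"
          by (simp add: abs_mult[symmetric] right_diff_distrib ac_simps)
      qed
      also have "\<dots> = exp (A v) * (A y - A x) * (A y - A x)"
        by (simp add: Ad[OF x0 xy(2)])
      finally show ?thesis by (simp add: power2_eq_square mult.assoc)
    qed
    ultimately show "\<bar>f y - f x\<bar> \<le> 2 * exp (A v) * (A y - A x)\<^sup>2" by linarith
  qed
  then show ?thesis
    using locally_integrable_split[OF hK uv] by (simp add: f_def)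
qed

section \<open>Deterministic jump times of a single path\<close>

lemma downward_closed_nat:
  fixes S :: "nat set"
  assumes "finite S" "\<And>i j. i \<in> S \<Longrightarrow> j \<le> i \<Longrightarrow> j \<in> S"
  shows "S = {..<card S}"
proof -
  define m where "m = (LEAST i. i \<notin> S)"
  have "\<exists>i. i \<notin> S" using assms(1) by (rule ex_new_if_finite[OF infinite_UNIV_nat])
  then have "m \<notin> S" unfolding m_def by (rule LeastI_ex)
  have "S = {..<m}"
  proof safe
    fix i assume "i \<in> S"
    then show "i < m" using assms(2)[of i m] \<open>m \<notin> S\<close> by (cases "i < m") auto
  next
    fix i assume "i < m"
    then show "i \<in> S" unfolding m_def using not_less_Least by blast
  qed
  then show ?thesis by simp
qed

text \<open>One non-exploding path of a point process, free of any probability; it is instantiated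
  at fixed \<open>\<omega>\<close>.\<close>

locale jump_times =
  fixes T :: "nat \<Rightarrow> real"
  assumes T_le: "\<And>i j. T i \<le> T j \<longleftrightarrow> i \<le> j" and T_lim: "filterlim T at_top sequentially"
    and T_pos: "\<And>i. 0 < T i"
begin

lemma T_less: "T i < T j \<longleftrightarrow> i < j" using T_le[of j i] by auto

lemma finite_jumps: "finite {i. T i \<le> u}" "finite {i. T i < u}"
proof -
  from T_lim have "eventually (\<lambda>i. u < T i) sequentially" by (auto simp: filterlim_at_top_dense)
  then obtain n where "\<And>i. n \<le> i \<Longrightarrow> u < T i" by (auto simp: eventually_sequentially)
  then have "{i. T i \<le> u} \<subseteq> {..<n}" "{i. T i < u} \<subseteq> {..<n}" by (force simp: not_le[symmetric])+
  then show "finite {i. T i \<le> u}" "finite {i. T i < u}" by (auto intro: finite_subset)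
qed

lemma jumps_eq: "{i. T i \<le> u} = {..<card {i. T i \<le> u}}"
proof (rule downward_closed_nat[OF finite_jumps(1)])
  fix i j assume "i \<in> {i. T i \<le> u}" "j \<le> i"
  then show "j \<in> {i. T i \<le> u}" using T_le[of j i] by simp
qed

lemma strict_jumps_eq: "{i. T i < u} = {..<card {i. T i < u}}"
proof (rule downward_closed_nat[OF finite_jumps(2)])
  fix i j assume "i \<in> {i. T i < u}" "j \<le> i"
  then show "j \<in> {i. T i < u}" using T_le[of j i] by simp
qed

lemma jumps_eq': "T i \<le> u \<longleftrightarrow> i < card {i. T i \<le> u}"
  using jumps_eq[of u] by auto

text \<open>Summation by parts. On \<open>(s, v]\<close> the left-limit process \<open>Jm\<close> is
  \<open>J s\<close> plus the increments \<open>d i\<close> switched on over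
  \<open>(T i, v]\<close>; the integral therefore splits into finitely many integrals of
  \<open>h * exp (- K)\<close>, which \<open>exp_integral_eq\<close> evaluates. \<open>Jm\<close>
  omits a jump at \<open>u\<close> itself, as a predictable integrand has to.\<close>

lemma exp_jump_identity:
  fixes a :: "nat \<Rightarrow> real"
  assumes h: "locally_integrable h" and sv: "0 \<le> s" "s \<le> v"
  defines "K \<equiv> \<lambda>t. LINT s:{0..t}|lborel. h s"
    and "J \<equiv> \<lambda>u. exp (\<Sum>i | T i \<le> u. a i)" and "Jm \<equiv> \<lambda>u. exp (\<Sum>i | T i < u. a i)"
  shows "set_integrable lborel {s<..v} (\<lambda>u. h u * (exp (- K u) * Jm u))"
    and "J v * exp (- K v) - J s * exp (- K s)
      = (\<Sum>i | s < T i \<and> T i \<le> v. exp (- K (T i)) * Jm (T i) * (exp (a i) - 1))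
        - (LINT u:{s<..v}|lborel. h u * (exp (- K u) * Jm u))"
proof -
  define n where "n u = card {i. T i \<le> u}" for u
  \<comment> \<open>\<open>E k\<close> is the exponential after the first \<open>k\<close> jumps;
    with indices from \<open>0\<close>, jump \<open>i\<close> leads from \<open>E i\<close> to
    \<open>E (Suc i)\<close>, and \<open>d i\<close> is that increment.\<close>
  define E where "E k = exp (\<Sum>i<k. a i)" for k
  define d where "d i = E i * (exp (a i) - 1)" for i
  let ?I = "{n s..<n v}"
  define c where "c u = exp (- K u)" for u
  have n: "T i \<le> u \<longleftrightarrow> i < n u" for i u unfolding n_def by (rule jumps_eq')
  have J: "J u = E (n u)" for u unfolding J_def E_def n_def by (subst jumps_eq) simp
  have I: "{i. s < T i \<and> T i \<le> v} = ?I" by (auto simp: n not_le[symmetric])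
  have nm: "n s \<le> n v"
    unfolding n_def using sv finite_jumps by (intro card_mono) auto
  have Edist: "E k = E (n s) + (\<Sum>i\<in>{n s..<k}. d i)" if "n s \<le> k" for k
    using that
  proof (induction k rule: dec_induct)
    case (step k)
    have "E (Suc k) = E k + d k" by (simp add: E_def d_def exp_add algebra_simps)
    then show ?case using step by simp
  qed simp
  have JmT: "Jm (T i) = E i" for i
  proof -
    have "{j. T j < T i} = {..<i}" by (auto simp: T_less)
    then show ?thesis by (simp add: Jm_def E_def)
  qed
  have Jm: "Jm u = E (n s) + (\<Sum>i\<in>?I. indicator {T i<..v} u * d i)" if u: "s < u" "u \<le> v" for u
  proof -
    define k where "k = card {i. T i < u}"
    have k: "T i < u \<longleftrightarrow> i < k" for i
      unfolding k_def using strict_jumps_eq[of u] by blast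
    have "{i. T i \<le> s} \<subseteq> {i. T i < u}" "{i. T i < u} \<subseteq> {i. T i \<le> v}" using u by auto
    then have kk: "n s \<le> k" "k \<le> n v"
      unfolding n_def k_def using finite_jumps by (auto intro: card_mono)
    have "Jm u = E k" unfolding Jm_def E_def by (simp add: k lessThan_def)
    also have "\<dots> = E (n s) + (\<Sum>i\<in>{n s..<k}. d i)" by (rule Edist[OF kk(1)])
    also have "(\<Sum>i\<in>{n s..<k}. d i) = (\<Sum>i\<in>?I. indicator {T i<..v} u * d i)"
      using kk(2) u by (intro sum.mono_neutral_cong_left) (auto simp: indicator_def k[symmetric])
    finally show ?thesis .
  qed
  have hc: "locally_integrable (\<lambda>u. h u * c u)"
    unfolding c_def K_def by (intro locally_integrable_mult[OF h] continuous_intros locally_integrable_continuous[OF h])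
  have int: "(LINT u:{x<..v}|lborel. h u * c u) = c x - c v" if "0 \<le> x" "x \<le> v" for x
    using exp_integral_eq[OF h that] unfolding c_def K_def by simp
  have Ti: "s < T i" "T i \<le> v" if "i \<in> ?I" for i using that unfolding I[symmetric] by simp_all
  have pw: "indicator {s<..v} u *\<^sub>R (h u * (exp (- K u) * Jm u))
      = E (n s) * (indicator {s<..v} u *\<^sub>R (h u * c u)) + (\<Sum>i\<in>?I. d i * (indicator {T i<..v} u *\<^sub>R (h u * c u)))" for u
  proof (cases "s < u \<and> u \<le> v")
    case True
    define X where "X = (\<Sum>i\<in>?I. indicator {T i<..v} u * d i)"
    have "(\<Sum>i\<in>?I. d i * (indicator {T i<..v} u *\<^sub>R (h u * c u))) = X * (h u * c u)"
      unfolding X_def sum_distrib_right by (intro sum.cong) simp_all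
    moreover have "Jm u = E (n s) + X" using Jm[of u] True by (simp only: X_def)
    ultimately show ?thesis using True by (simp add: c_def algebra_simps)
  next
    case False
    have "indicator {T i<..v} u = (0::real)" if "i \<in> ?I" for i
      using Ti[OF that] False by (auto simp: indicator_def)
    then have "(\<Sum>i\<in>?I. d i * (indicator {T i<..v} u *\<^sub>R (h u * c u))) = 0"
      by (intro sum.neutral ballI) (simp only: scaleR_zero_left mult_zero_right)
    moreover have "indicator {s<..v} u = (0::real)" using False by (auto simp: indicator_def)
    ultimately show ?thesis by (simp only: scaleR_zero_left mult_zero_right)
  qed
  have integrable: "integrable lborel (\<lambda>u. indicator {x<..v} u *\<^sub>R (h u * c u))" if "0 \<le> x" for x
    using locally_integrable_subset(1)[OF hc that, of v] by (simp add: set_integrable_def)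
  have Ti0: "0 \<le> T i" for i using T_pos[of i] by simp
  show "set_integrable lborel {s<..v} (\<lambda>u. h u * (exp (- K u) * Jm u))"
    unfolding set_integrable_def pw using integrable sv Ti0
    by (intro Bochner_Integration.integrable_add Bochner_Integration.integrable_sum integrable_mult_right) auto
  have "(LINT u:{s<..v}|lborel. h u * (exp (- K u) * Jm u))
      = E (n s) * (LINT u:{s<..v}|lborel. h u * c u) + (\<Sum>i\<in>?I. d i * (LINT u:{T i<..v}|lborel. h u * c u))"
    unfolding set_lebesgue_integral_def pw using integrable sv Ti0
    by (subst Bochner_Integration.integral_add)
       (auto intro!: Bochner_Integration.integrable_sum simp: Bochner_Integration.integral_sum)
  also have "\<dots> = E (n s) * (c s - c v) + (\<Sum>i\<in>?I. d i * (c (T i) - c v))"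
    using Ti Ti0 sv by (simp add: int)
  also have "(\<Sum>i\<in>?I. d i * (c (T i) - c v)) = (\<Sum>i\<in>?I. c (T i) * d i) - c v * (\<Sum>i\<in>?I. d i)"
    by (simp add: right_diff_distrib sum_subtractf sum_distrib_left ac_simps)
  also have "(\<Sum>i\<in>?I. d i) = E (n v) - E (n s)" using Edist[OF nm] by simp
  finally have "(LINT u:{s<..v}|lborel. h u * (exp (- K u) * Jm u))
      = E (n s) * c s - E (n v) * c v + (\<Sum>i\<in>?I. c (T i) * d i)"
    by (simp add: algebra_simps)
  moreover have "(\<Sum>i | s < T i \<and> T i \<le> v. exp (- K (T i)) * Jm (T i) * (exp (a i) - 1)) = (\<Sum>i\<in>?I. c (T i) * d i)"
    unfolding I by (simp add: JmT c_def d_def mult.assoc)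
  ultimately show "J v * exp (- K v) - J s * exp (- K s)
      = (\<Sum>i | s < T i \<and> T i \<le> v. exp (- K (T i)) * Jm (T i) * (exp (a i) - 1))
        - (LINT u:{s<..v}|lborel. h u * (exp (- K u) * Jm u))"
    by (simp add: J c_def)
qed

end


section \<open>Local martingales and random jump times\<close>

context stochastic_basis
begin

text \<open>The right-continuous process is sampled at grid times to the right of
  \<open>min t (\<tau> \<omega>)\<close>; cutting these off at \<open>t\<close> keeps them in the
  past of \<open>t\<close>, so the limit is \<open>F t\<close>-measurable and not merely measurable
  at later times.\<close>

lemma measurable_stopped:
  assumes X: "adapted F X" "\<And>\<omega> s. \<omega> \<in> space M \<Longrightarrow> 0 \<le> s \<Longrightarrow> continuous (at_right s) (\<lambda>u. X u \<omega>)"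
    and \<tau>: "stopping_time F \<tau>" "\<And>\<omega>. \<omega> \<in> space M \<Longrightarrow> 0 \<le> \<tau> \<omega>" and t: "0 \<le> t"
  shows "(\<lambda>\<omega>. X (min t (\<tau> \<omega>)) \<omega>) \<in> borel_measurable (F t)"
proof (rule borel_measurable_LIMSEQ_real)
  let ?m = "\<lambda>\<omega>. min t (\<tau> \<omega>)"
  have m: "?m \<in> borel_measurable (F t)"
  proof (rule borel_measurableI_le)
    fix c
    show "{\<omega> \<in> space (F t). ?m \<omega> \<le> c} \<in> sets (F t)"
    proof (cases "t \<le> c")
      case False
      then have "{\<omega> \<in> space (F t). ?m \<omega> \<le> c} = {\<omega> \<in> space (F c). \<tau> \<omega> \<le> c}" by (auto simp: min_le_iff_disj)
      also have "\<dots> \<in> sets (F c)" using stopping_timeD[OF \<tau>(1)] by (simp add: pred_def)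
      finally show ?thesis using sets_F_mono[of c t] False by auto
    qed (simp add: min.coboundedI1 sets.top[of "F t", simplified])
  qed
  \<comment> \<open>The composition ranges over all integers \<open>j\<close>;
    \<open>max 0 j\<close> keeps the evaluation time non-negative, where adaptedness applies, and
    changes nothing at the indices that occur.\<close>
  let ?X = "\<lambda>n j \<omega>. X (min t ((real_of_int (max 0 j) + 1) / 2 ^ n)) \<omega>"
  show "(\<lambda>n. ?X n \<lfloor>2 ^ n * ?m \<omega>\<rfloor> \<omega>) \<longlonglongrightarrow> X (?m \<omega>) \<omega>" if "\<omega> \<in> space (F t)" for \<omega>
  proof (rule continuous_at_right_LIMSEQ[where f = "\<lambda>s. X s \<omega>" and u = "?m \<omega>"
        and a = "\<lambda>n. min t ((real_of_int (max 0 \<lfloor>2 ^ n * ?m \<omega>\<rfloor>) + 1) / 2 ^ n)"])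
    have w: "\<omega> \<in> space M" and m0: "0 \<le> ?m \<omega>" using that \<tau>(2) t by auto
    then show "continuous (at_right (?m \<omega>)) (\<lambda>s. X s \<omega>)" by (intro X(2))
    have max: "max 0 \<lfloor>2 ^ n * ?m \<omega>\<rfloor> = \<lfloor>2 ^ n * ?m \<omega>\<rfloor>" for n using m0 by (simp add: max_def)
    have "(\<lambda>n. min t ((\<lfloor>2 ^ n * ?m \<omega>\<rfloor> + 1) / 2 ^ n)) \<longlonglongrightarrow> min t (?m \<omega>)"
      using floor_grid_strict(1)[of "?m \<omega>"] by (intro tendsto_min tendsto_const) simp
    then show "(\<lambda>n. min t ((real_of_int (max 0 \<lfloor>2 ^ n * ?m \<omega>\<rfloor>) + 1) / 2 ^ n)) \<longlonglongrightarrow> ?m \<omega>"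
      unfolding max by simp
    show "?m \<omega> \<le> min t ((real_of_int (max 0 \<lfloor>2 ^ n * ?m \<omega>\<rfloor>) + 1) / 2 ^ n)" for n
      unfolding max using floor_grid_strict(2)[of "?m \<omega>" n] by simp
  qed
  show "(\<lambda>\<omega>. ?X n \<lfloor>2 ^ n * ?m \<omega>\<rfloor> \<omega>) \<in> borel_measurable (F t)" for n
  proof (rule measurable_compose_countable[where f = "?X n" and g = "\<lambda>\<omega>. \<lfloor>2 ^ n * ?m \<omega>\<rfloor>"])
    show "(\<lambda>\<omega>. \<lfloor>2 ^ n * ?m \<omega>\<rfloor>) \<in> measurable (F t) (count_space UNIV)"
      using m by measurable
    fix j :: int
    have "X (min t ((real_of_int (max 0 j) + 1) / 2 ^ n)) \<in> borel_measurable (F (min t ((real_of_int (max 0 j) + 1) / 2 ^ n)))"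
      using X(1) t by (simp add: adapted_def)
    then show "?X n j \<in> borel_measurable (F t)" by (rule measurable_F_mono) simp
  qed
qed

text \<open>Null sets lie in \<open>F 0\<close>, so adaptedness survives the modification. The
  exceptional set is common to all \<open>t\<close>, which is what transfers the regularity of the
  paths and the values at the random times \<open>\<tau> n\<close>.\<close>

lemma local_martingale_AE_cong:
  assumes X: "local_martingale M F X" and eq: "AE \<omega> in M. \<forall>t\<ge>0. X t \<omega> = Y t \<omega>"
  shows "local_martingale M F Y"
proof -
  from X obtain \<tau> :: "nat \<Rightarrow> 'a \<Rightarrow> real" where \<tau>: "\<And>n. stopping_time F (\<tau> n)"
      "\<And>n \<omega>. \<omega> \<in> space M \<Longrightarrow> 0 \<le> \<tau> n \<omega>"
      "AE \<omega> in M. incseq (\<lambda>n. \<tau> n \<omega>) \<and> filterlim (\<lambda>n. \<tau> n \<omega>) at_top sequentially"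
      "\<And>n. martingale M F (\<lambda>t \<omega>. X (min t (\<tau> n \<omega>)) \<omega>)"
    unfolding local_martingale_def by blast
  have adapted: "adapted F Y'" if "adapted F X'" "\<And>t. 0 \<le> t \<Longrightarrow> AE \<omega> in M. X' t \<omega> = Y' t \<omega>" for X' Y'
    using that measurable_F_AE_cong unfolding adapted_def by blast
  have eq_t: "AE \<omega> in M. X t \<omega> = Y t \<omega>" if "0 \<le> t" for t
    using eq by eventually_elim (use that in simp)
  have eq_\<tau>: "AE \<omega> in M. X (min t (\<tau> n \<omega>)) \<omega> = Y (min t (\<tau> n \<omega>)) \<omega>" if "0 \<le> t" for t n
    using eq AE_space by eventually_elim (use that \<tau>(2) in simp)
  have "AE \<omega> in M. cadlag (\<lambda>t. X t \<omega>)" using X by (simp add: local_martingale_def)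
  with eq have "AE \<omega> in M. cadlag (\<lambda>t. Y t \<omega>)"
  proof eventually_elim
    case (elim \<omega>)
    have R: "\<forall>\<^sub>F s in at_right t. X s \<omega> = Y s \<omega>" if "0 \<le> t" for t
      using elim(1) that by (auto simp: eventually_at_right_field intro!: exI[of _ "t + 1"])
    have L: "\<forall>\<^sub>F s in at_left t. X s \<omega> = Y s \<omega>" if "0 < t" for t
      using elim(1) that by (auto simp: eventually_at_left_field intro!: exI[of _ 0])
    show ?case
      unfolding cadlag_def continuous_within
    proof (intro conjI allI impI)
      fix t :: real assume t: "0 \<le> t"
      then have "((\<lambda>t. X t \<omega>) \<longlongrightarrow> X t \<omega>) (at_right t)"
        using elim(2) by (simp add: cadlag_def continuous_within)
      then show "((\<lambda>t. Y t \<omega>) \<longlongrightarrow> Y t \<omega>) (at_right t)"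
        using tendsto_cong[OF R[OF t]] elim(1) t by simp
    next
      fix t :: real assume t: "0 < t"
      then obtain l where "((\<lambda>t. X t \<omega>) \<longlongrightarrow> l) (at_left t)"
        using elim(2) by (auto simp: cadlag_def)
      then show "\<exists>l. ((\<lambda>t. Y t \<omega>) \<longlongrightarrow> l) (at_left t)"
        using tendsto_cong[OF L[OF t]] by blast
    qed
  qed
  moreover have "martingale M F (\<lambda>t \<omega>. Y (min t (\<tau> n \<omega>)) \<omega>)" for n
    unfolding martingale_def
  proof (intro conjI allI impI)
    have Xm: "adapted F (\<lambda>t \<omega>. X (min t (\<tau> n \<omega>)) \<omega>)"
      "\<And>t. 0 \<le> t \<Longrightarrow> integrable M (\<lambda>\<omega>. X (min t (\<tau> n \<omega>)) \<omega>)"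
      "\<And>s t. 0 \<le> s \<Longrightarrow> s \<le> t \<Longrightarrow>
        AE \<omega> in M. real_cond_exp M (F s) (\<lambda>\<omega>. X (min t (\<tau> n \<omega>)) \<omega>) \<omega> = X (min s (\<tau> n \<omega>)) \<omega>"
      using \<tau>(4)[of n] unfolding martingale_def by blast+
    show Ya: "adapted F (\<lambda>t \<omega>. Y (min t (\<tau> n \<omega>)) \<omega>)" by (rule adapted[OF Xm(1) eq_\<tau>])
    have meas: "(\<lambda>\<omega>. Y (min t (\<tau> n \<omega>)) \<omega>) \<in> borel_measurable M" if "0 \<le> t" for t
      using Ya that by (auto simp: adapted_def intro: measurable_F_M)
    show "integrable M (\<lambda>\<omega>. Y (min t (\<tau> n \<omega>)) \<omega>)" if "0 \<le> t" for t
      using eq_\<tau>[OF that, of n]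
      by (intro integrable_cong_AE_imp[OF Xm(2)[OF that] meas[OF that]]) (simp add: eq_commute)
    fix s t :: real assume st: "0 \<le> s \<and> s \<le> t"
    then have t: "0 \<le> t" by simp
    interpret sigma_finite_subalgebra M "F s"
      by (rule finite_measure_subalgebra_is_sigma_finite) (simp_all add: subalgebra_F finite_measure_subalgebra_def finite_measure_axioms finite_measure_subalgebra_axioms_def)
    have "AE \<omega> in M. real_cond_exp M (F s) (\<lambda>\<omega>. X (min t (\<tau> n \<omega>)) \<omega>) \<omega>
        = real_cond_exp M (F s) (\<lambda>\<omega>. Y (min t (\<tau> n \<omega>)) \<omega>) \<omega>"
      using Xm(2)[OF t] by (intro real_cond_exp_cong eq_\<tau> meas t borel_measurable_integrable)
    with Xm(3)[of s t] st eq_\<tau>[of s n]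
    show "AE \<omega> in M. real_cond_exp M (F s) (\<lambda>\<omega>. Y (min t (\<tau> n \<omega>)) \<omega>) \<omega> = Y (min s (\<tau> n \<omega>)) \<omega>"
      by (simp) (elim AE_mp, rule AE_I2, simp)
  qed
  moreover have "adapted F Y"
    using X eq_t adapted[of X Y] by (simp add: local_martingale_def)
  ultimately show ?thesis
    unfolding local_martingale_def using \<tau>(1-3) by (intro conjI exI[of _ \<tau>]) auto
qed

text \<open>The graph is the intersection of the closed interval up to \<open>\<sigma>\<close>,
  which is predictable, with the interval from \<open>\<sigma>\<close> on, whose indicator is
  right-continuous and adapted. In general it is optional and not predictable.\<close>

lemma stopping_time_graph_optional:
  assumes \<sigma>: "stopping_time F \<sigma>"
  shows "(\<lambda>(\<omega>, t). indicator {\<sigma> \<omega>} t :: ennreal) \<in> borel_measurable (optional_sigma M F)"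
proof -
  have 1: "(\<lambda>(\<omega>, t). indicator {..\<sigma> \<omega>} t :: real) \<in> borel_measurable (optional_sigma M F)"
    by (rule left_process_optional[OF stopping_time_left_process[OF \<sigma>]])
  have 2: "(\<lambda>(\<omega>, t). indicator {\<sigma> \<omega>..} t :: real) \<in> borel_measurable (optional_sigma M F)"
  proof (rule cadlag_optional)
    show "adapted F (\<lambda>t \<omega>. indicator {\<sigma> \<omega>..} t :: real)"
      unfolding adapted_def
    proof (intro allI impI)
      fix t :: real
      have "(indicator {\<omega>. \<sigma> \<omega> \<le> t} :: 'a \<Rightarrow> real) \<in> borel_measurable (F t)"
        using stopping_timeD[OF \<sigma>, of t] by (intro borel_measurable_indicator') (simp add: pred_def)
      moreover have "indicator {\<omega>. \<sigma> \<omega> \<le> t} = (\<lambda>\<omega>. indicator {\<sigma> \<omega>..} t :: real)" by (auto simp: indicator_def)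
      ultimately show "(\<lambda>\<omega>. indicator {\<sigma> \<omega>..} t :: real) \<in> borel_measurable (F t)" by simp
    qed
    fix \<omega>
    show "cadlag (\<lambda>t. indicator {\<sigma> \<omega>..} t :: real)"
      unfolding cadlag_def continuous_within
    proof (intro conjI allI impI)
      fix t :: real
      have "eventually (\<lambda>s. indicator {\<sigma> \<omega>..} s = (indicator {\<sigma> \<omega>..} t :: real)) (at_right t)"
      proof (cases "t < \<sigma> \<omega>")
        case True
        then show ?thesis by (auto simp: eventually_at_right_field indicator_def intro!: exI[of _ "\<sigma> \<omega>"])
      next
        case False
        then show ?thesis by (auto simp: eventually_at_right_field indicator_def intro!: exI[of _ "t + 1"])
      qed
      then show "((\<lambda>t. indicator {\<sigma> \<omega>..} t :: real) \<longlongrightarrow> indicator {\<sigma> \<omega>..} t) (at_right t)"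
        by (rule tendsto_eventually)
      have "eventually (\<lambda>s. indicator {\<sigma> \<omega>..} s = (if \<sigma> \<omega> < t then 1 else 0 :: real)) (at_left t)"
      proof (cases "\<sigma> \<omega> < t")
        case True
        then show ?thesis by (auto simp: eventually_at_left_field indicator_def intro!: exI[of _ "\<sigma> \<omega>"])
      next
        case False
        then show ?thesis by (auto simp: eventually_at_left_field indicator_def intro!: exI[of _ "t - 1"])
      qed
      then show "\<exists>l. ((\<lambda>t. indicator {\<sigma> \<omega>..} t :: real) \<longlongrightarrow> l) (at_left t)"
        by (intro exI tendsto_eventually)
    qed
  qed
  have "(\<lambda>z. ennreal ((\<lambda>(\<omega>, t). indicator {..\<sigma> \<omega>} t :: real) z * (\<lambda>(\<omega>, t). indicator {\<sigma> \<omega>..} t :: real) z))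
      \<in> borel_measurable (optional_sigma M F)"
    using 1 2 by measurable
  then show ?thesis
    by (rule measurable_cong[THEN iffD1, rotated]) (auto simp: indicator_def)
qed

end

context square_integrable_martingale
begin

text \<open>Under the measure with density \<open>L t\<close> the point process keeps its compensator.\<close>

lemma jump_compensation:
  fixes U :: "nat \<Rightarrow> 'a \<Rightarrow> 'e::euclidean_space"
  assumes mpp: "marked_point_process M F T U" and opt: "optional_random_measure M F (mpp_measure T U)"
    and f: "f \<in> borel_measurable borel" and pf: "pf \<in> borel_measurable (predictable_sigma M F)"
    and comp: "\<And>H. H \<in> borel_measurable (predictable_sigma M F) \<Longrightarrow>
      (\<integral>\<^sup>+\<omega>. (\<Sum>i. H (\<omega>, T i \<omega>) * f (U i \<omega>)) \<partial>M)
      = (\<integral>\<^sup>+\<omega>. (\<integral>\<^sup>+u. H (\<omega>, u) * pf (\<omega>, u) * indicator {0..} u \<partial>lborel) \<partial>M)"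
    and \<Theta>: "\<Theta> \<in> borel_measurable (predictable_sigma M F)" "\<And>\<omega> u. t < u \<Longrightarrow> \<Theta> (\<omega>, u) = (0::ennreal)"
    and t: "0 \<le> t"
  shows "(\<integral>\<^sup>+\<omega>. ennreal (L t \<omega>) * (\<Sum>i. \<Theta> (\<omega>, T i \<omega>) * f (U i \<omega>)) \<partial>M)
    = (\<integral>\<^sup>+\<omega>. ennreal (L t \<omega>) * (\<integral>\<^sup>+u. \<Theta> (\<omega>, u) * pf (\<omega>, u) * indicator {0..} u \<partial>lborel) \<partial>M)"
proof -
  note T = marked_point_process_facts[OF mpp]
  interpret Fub: pair_sigma_finite M lborel ..
  define Y where "Y i \<omega> = \<Theta> (\<omega>, T i \<omega>) * f (U i \<omega>)" for i \<omega>
  have Y_F: "(\<lambda>\<omega>. Y i \<omega> * indicator {\<omega>. T i \<omega> \<le> u} \<omega>) \<in> borel_measurable (F u)" if u: "0 \<le> u" for i u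
  proof -
    \<comment> \<open>The graph of \<open>T i\<close> singles out the \<open>i\<close>-th point of
      the random measure. Optionality of the measure then shows that the contribution of the mark
      \<open>U i\<close> is known at the time \<open>T i\<close>, which optional sampling requires
      of its weight.\<close>
    define V where "V = (\<lambda>z. indicator {T i (fst (fst z))} (snd (fst z)) * \<Theta> (fst z) * f (snd z))"
    have "V \<in> borel_measurable (optional_sigma M F \<Otimes>\<^sub>M borel)"
    proof -
      have "(\<lambda>z. indicator {T i (fst (fst z))} (snd (fst z)) :: ennreal) \<in> borel_measurable (optional_sigma M F \<Otimes>\<^sub>M (borel :: 'e measure))"
        using measurable_compose[OF measurable_fst stopping_time_graph_optional[OF T(1)]] by (simp add: split_beta')
      moreover have "(\<lambda>z. \<Theta> (fst z)) \<in> borel_measurable (optional_sigma M F \<Otimes>\<^sub>M (borel :: 'e measure))"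
        by (rule measurable_compose[OF measurable_fst measurable_optional_if_predictable[OF \<Theta>(1)]])
      moreover have "(\<lambda>z. f (snd z)) \<in> borel_measurable (optional_sigma M F \<Otimes>\<^sub>M borel)"
        by (rule measurable_compose[OF measurable_snd f])
      ultimately show ?thesis unfolding V_def by (intro borel_measurable_times_ennreal)
    qed
    then have "(\<lambda>(\<omega>, t). rm_integral (mpp_measure T U) V {0..t} \<omega>) \<in> borel_measurable (optional_sigma M F)"
      using opt unfolding optional_random_measure_def by blast
    from measurable_compose[OF measurable_Pair_optional_time[OF u] this]
    have "(\<lambda>\<omega>. rm_integral (mpp_measure T U) V {0..u} \<omega>) \<in> borel_measurable (F u)" by simp
    then show ?thesis
    proof (rule measurable_cong[THEN iffD1, rotated])
      fix \<omega> assume "\<omega> \<in> space (F u)"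
      then have w: "\<omega> \<in> space M" by simp
      have eq: "(\<lambda>(s, x). V ((\<omega>, s), x) * indicator {0..u} s)
          = (\<lambda>z. indicator {T i \<omega>} (fst z) * (\<Theta> (\<omega>, T i \<omega>) * f (snd z) * indicator {0..u} (T i \<omega>)))"
        by (auto simp: V_def indicator_def fun_eq_iff)
      have "(\<lambda>(s, x). V ((\<omega>, s), x) * indicator {0..u} s) \<in> borel_measurable borel"
        unfolding eq borel_prod[symmetric]
        using measurable_compose[OF measurable_snd f, of "borel :: real measure"]
          measurable_compose[OF measurable_fst borel_measurable_indicator, of "{T i \<omega>}" borel "borel :: 'e measure"]
        by (intro borel_measurable_times_ennreal) auto
      then have "rm_integral (mpp_measure T U) V {0..u} \<omega> = (\<Sum>j. V ((\<omega>, T j \<omega>), U j \<omega>) * indicator {0..u} (T j \<omega>))"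
        by (rule rm_integral_mpp)
      also have "\<dots> = (\<Sum>j\<in>{i}. V ((\<omega>, T j \<omega>), U j \<omega>) * indicator {0..u} (T j \<omega>))"
      proof (rule suminf_finite)
        fix j assume "j \<notin> {i}"
        then have "T j \<omega> \<noteq> T i \<omega>" using T(3)[OF w, of i j] T(3)[OF w, of j i] by auto
        then show "V ((\<omega>, T j \<omega>), U j \<omega>) * indicator {0..u} (T j \<omega>) = 0" by (simp add: V_def)
      qed simp
      also have "\<dots> = Y i \<omega> * indicator {\<omega>. T i \<omega> \<le> u} \<omega>"
        using T(2)[OF w, of i] by (simp add: V_def Y_def indicator_def)
      finally show "rm_integral (mpp_measure T U) V {0..u} \<omega> = Y i \<omega> * indicator {\<omega>. T i \<omega> \<le> u} \<omega>" .
    qed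
  qed
  \<comment> \<open>Since \<open>\<Theta>\<close> vanishes after \<open>t\<close>, only jumps up to
    \<open>t\<close> count.\<close>
  have Yt: "Y i \<omega> = Y i \<omega> * indicator {\<omega>. T i \<omega> \<le> t} \<omega>" for i \<omega>
    using \<Theta>(2)[of "T i \<omega>" \<omega>] by (auto simp: Y_def indicator_def)
  have Y_M: "Y i \<in> borel_measurable M" for i
    using measurable_F_M[OF Y_F[OF t, of i]] Yt[of i] by simp
  have LT: "(\<lambda>\<omega>. ennreal (L (T i \<omega>) \<omega>)) \<in> borel_measurable M" for i
    using T(2) by (intro L_sampled_measurable T(1)) (simp add: less_imp_le)
  have "(\<integral>\<^sup>+\<omega>. ennreal (L t \<omega>) * (\<Sum>i. Y i \<omega>) \<partial>M) = (\<Sum>i. \<integral>\<^sup>+\<omega>. ennreal (L t \<omega>) * Y i \<omega> \<partial>M)"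
    using L_measurable[OF t] Y_M by (subst nn_integral_suminf[symmetric]) auto
  also have "\<dots> = (\<Sum>i. \<integral>\<^sup>+\<omega>. ennreal (L (T i \<omega>) \<omega>) * Y i \<omega> \<partial>M)"
  proof (rule suminf_cong)
    fix i
    have "(\<integral>\<^sup>+\<omega>. ennreal (L t \<omega>) * (Y i \<omega> * indicator {\<omega>. T i \<omega> \<le> t} \<omega>) \<partial>M)
        = (\<integral>\<^sup>+\<omega>. ennreal (L (T i \<omega>) \<omega>) * (Y i \<omega> * indicator {\<omega>. T i \<omega> \<le> t} \<omega>) \<partial>M)"
      using T(2) by (intro optional_sampling T(1) Y_F t) (auto simp: less_imp_le)
    then show "(\<integral>\<^sup>+\<omega>. ennreal (L t \<omega>) * Y i \<omega> \<partial>M) = (\<integral>\<^sup>+\<omega>. ennreal (L (T i \<omega>) \<omega>) * Y i \<omega> \<partial>M)"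
      unfolding Yt[symmetric] .
  qed
  also have "\<dots> = (\<integral>\<^sup>+\<omega>. (\<Sum>i. ennreal (L (T i \<omega>) \<omega>) * Y i \<omega>) \<partial>M)"
    using LT Y_M by (intro nn_integral_suminf[symmetric]) auto
  also have "\<dots> = (\<integral>\<^sup>+\<omega>. (\<Sum>i. (\<lambda>(\<omega>, u). ennreal (L u \<omega>) * \<Theta> (\<omega>, u)) (\<omega>, T i \<omega>) * f (U i \<omega>)) \<partial>M)"
    by (simp add: Y_def mult.assoc)
  also have "\<dots> = (\<integral>\<^sup>+\<omega>. (\<integral>\<^sup>+u. (\<lambda>(\<omega>, u). ennreal (L u \<omega>) * \<Theta> (\<omega>, u)) (\<omega>, u) * pf (\<omega>, u) * indicator {0..} u \<partial>lborel) \<partial>M)"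
  proof (rule comp)
    show "(\<lambda>(\<omega>, u). ennreal (L u \<omega>) * \<Theta> (\<omega>, u)) \<in> borel_measurable (predictable_sigma M F)"
      using left_process_predictable[OF L_left_process] \<Theta>(1) by (simp add: split_beta')
  qed
  also have "\<dots> = (\<integral>\<^sup>+\<omega>. (\<integral>\<^sup>+u. ennreal (L u \<omega>) * indicator {0..} u * (\<Theta> (\<omega>, u) * pf (\<omega>, u) * indicator {0..} u) \<partial>lborel) \<partial>M)"
    by (intro nn_integral_cong) (auto simp: indicator_def mult.assoc)
  also have "\<dots> = (\<integral>\<^sup>+u. (\<integral>\<^sup>+\<omega>. ennreal (L u \<omega>) * indicator {0..} u * (\<Theta> (\<omega>, u) * pf (\<omega>, u) * indicator {0..} u) \<partial>M) \<partial>lborel)"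
    using L_joint predictable_joint[OF borel_measurable_times_ennreal[OF \<Theta>(1) pf]]
    by (intro Fub.Fubini'[symmetric]) (simp add: split_beta')
  also have "\<dots> = (\<integral>\<^sup>+u. (\<integral>\<^sup>+\<omega>. ennreal (L t \<omega>) * (\<Theta> (\<omega>, u) * pf (\<omega>, u) * indicator {0..} u) \<partial>M) \<partial>lborel)"
  proof (rule nn_integral_cong)
    fix u :: real
    consider "u < 0" | "t < u" | "0 \<le> u" "u \<le> t" by linarith
    then show "(\<integral>\<^sup>+\<omega>. ennreal (L u \<omega>) * indicator {0..} u * (\<Theta> (\<omega>, u) * pf (\<omega>, u) * indicator {0..} u) \<partial>M)
        = (\<integral>\<^sup>+\<omega>. ennreal (L t \<omega>) * (\<Theta> (\<omega>, u) * pf (\<omega>, u) * indicator {0..} u) \<partial>M)"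
    proof cases
      case 3
      have "(\<lambda>\<omega>. \<Theta> (\<omega>, u) * pf (\<omega>, u)) \<in> borel_measurable (F u)"
        using measurable_compose[OF measurable_Pair_predictable_time[OF 3(1)] borel_measurable_times_ennreal[OF \<Theta>(1) pf]]
        by simp
      from L_mart[OF 3 this] 3 show ?thesis by simp
    qed (use \<Theta>(2) in auto)
  qed
  also have "\<dots> = (\<integral>\<^sup>+\<omega>. (\<integral>\<^sup>+u. ennreal (L t \<omega>) * (\<Theta> (\<omega>, u) * pf (\<omega>, u) * indicator {0..} u) \<partial>lborel) \<partial>M)"
    using L_measurable[OF t] predictable_joint[OF borel_measurable_times_ennreal[OF \<Theta>(1) pf]]
    by (intro Fub.Fubini') (simp add: split_beta')
  also have "\<dots> = (\<integral>\<^sup>+\<omega>. ennreal (L t \<omega>) * (\<integral>\<^sup>+u. \<Theta> (\<omega>, u) * pf (\<omega>, u) * indicator {0..} u \<partial>lborel) \<partial>M)"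
  proof (rule nn_integral_cong)
    fix \<omega> assume w: "\<omega> \<in> space M"
    have "(\<lambda>u. \<Theta> (\<omega>, u) * pf (\<omega>, u) * indicator {0..} u) \<in> borel_measurable lborel"
      using measurable_compose[OF measurable_Pair1'[OF w] predictable_joint[OF borel_measurable_times_ennreal[OF \<Theta>(1) pf]]]
      by simp
    then show "(\<integral>\<^sup>+u. ennreal (L t \<omega>) * (\<Theta> (\<omega>, u) * pf (\<omega>, u) * indicator {0..} u) \<partial>lborel)
        = ennreal (L t \<omega>) * (\<integral>\<^sup>+u. \<Theta> (\<omega>, u) * pf (\<omega>, u) * indicator {0..} u \<partial>lborel)"
      by (rule nn_integral_cmult)
  qed
  finally show ?thesis by (simp add: Y_def)
qed

end


section \<open>The jump factor of the price\<close>

context jump_times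
begin

lemma eventually_jumps_right: "\<forall>\<^sub>F s in at_right t. {i. T i \<le> s} = {i. T i \<le> t}"
proof -
  \<comment> \<open>The jump times in \<open>(t, t + 1]\<close>; the extra element
    \<open>t + 1\<close> keeps the set non-empty for \<open>Min\<close>.\<close>
  let ?B = "insert (t + 1) (T ` {i. T i \<le> t + 1 \<and> t < T i})"
  have fin: "finite ?B" using finite_jumps(1)[of "t + 1"] by (auto intro: finite_subset[of _ "{i. T i \<le> t + 1}"])
  have "{i. T i \<le> s} = {i. T i \<le> t}" if s: "t < s" "s < Min ?B" for s
  proof safe
    fix i assume i: "T i \<le> s"
    show "T i \<le> t"
    proof (rule ccontr)
      assume "\<not> T i \<le> t"
      moreover have "s < t + 1" using s fin by simp
      ultimately have "T i \<in> ?B" using i by auto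
      then show False using s fin i by (auto simp: Min_less_iff Min_gr_iff)
    qed
  qed (use s in auto)
  moreover have "t < Min ?B" using fin by (auto simp: Min_gr_iff)
  ultimately show ?thesis unfolding eventually_at_right_field by blast
qed

lemma eventually_jumps_left:
  "\<forall>\<^sub>F s in at_left t. {i. T i \<le> s} = {i. T i < t} \<and> {i. T i < s} = {i. T i < t}"
proof -
  let ?B = "insert (t - 1) (T ` {i. T i < t})"
  have fin: "finite ?B" using finite_jumps(2)[of t] by simp
  have *: "T i < s" if "Max ?B < s" "T i < t" for s i
    using that fin by (auto simp: Max_less_iff)
  have "{i. T i \<le> s} = {i. T i < t} \<and> {i. T i < s} = {i. T i < t}" if s: "Max ?B < s" "s < t" for s
  proof (intro conjI set_eqI)
    fix i
    show "i \<in> {i. T i \<le> s} \<longleftrightarrow> i \<in> {i. T i < t}" "i \<in> {i. T i < s} \<longleftrightarrow> i \<in> {i. T i < t}"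
      using *[OF s(1), of i] s(2) by (cases "T i < t"; simp)+
  qed
  moreover have "Max ?B < t" using fin by (auto simp: Max_less_iff)
  ultimately show ?thesis unfolding eventually_at_left_field by blast
qed

end

text \<open>Passage from an \<open>ennreal\<close> density to a real one: finiteness of its
  integrals forces finite values at almost every time, and \<open>enn2real\<close> then loses
  nothing.\<close>

lemma locally_integrable_enn2real:
  fixes f :: "real \<Rightarrow> ennreal"
  assumes m: "(\<lambda>u. f u * indicator {0..} u) \<in> borel_measurable borel"
    and fin: "\<And>t. 0 \<le> t \<Longrightarrow> (\<integral>\<^sup>+u. f u * indicator {0..t} u \<partial>lborel) < \<top>"
  shows "locally_integrable (\<lambda>u. enn2real (f u))"
    and "AE u in lborel. 0 \<le> u \<longrightarrow> f u < \<top>"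
    and "0 \<le> t \<Longrightarrow> (LINT u:{0..t}|lborel. enn2real (f u)) = enn2real (\<integral>\<^sup>+u. f u * indicator {0..t} u \<partial>lborel)"
proof -
  have mt: "(\<lambda>u. f u * indicator {0..t} u) \<in> borel_measurable borel" for t
  proof -
    have "(\<lambda>u. (f u * indicator {0..} u) * indicator {..t} u) \<in> borel_measurable borel"
      using m by measurable
    then show ?thesis by (rule measurable_cong[THEN iffD1, rotated]) (auto simp: indicator_def)
  qed
  have mr: "(\<lambda>u. indicator {0..t} u *\<^sub>R enn2real (f u)) \<in> borel_measurable lborel" for t
  proof -
    have "(\<lambda>u. enn2real (f u * indicator {0..t} u)) \<in> borel_measurable lborel"
      using mt by measurable
    then show ?thesis by (rule measurable_cong[THEN iffD1, rotated]) (auto simp: indicator_def)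
  qed
  have "AE u in lborel. f u * indicator {0..real n} u \<noteq> \<infinity>" for n
    using mt fin[of "real n"] by (intro nn_integral_PInf_AE) auto
  then have "AE u in lborel. \<forall>n. f u * indicator {0..real n} u \<noteq> \<infinity>" by (simp add: AE_all_countable)
  then show ae: "AE u in lborel. 0 \<le> u \<longrightarrow> f u < \<top>"
  proof eventually_elim
    case (elim u)
    obtain n where "u \<le> real n" using real_arch_simple by blast
    then show ?case using spec[OF elim, of n] by (auto simp: less_top)
  qed
  have nn: "(\<integral>\<^sup>+u. ennreal (indicator {0..t} u *\<^sub>R enn2real (f u)) \<partial>lborel) = (\<integral>\<^sup>+u. f u * indicator {0..t} u \<partial>lborel)" for t
  proof (rule nn_integral_cong_AE)
    show "AE u in lborel. ennreal (indicator {0..t} u *\<^sub>R enn2real (f u)) = f u * indicator {0..t} u"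
      using ae by eventually_elim (auto simp: indicator_def)
  qed
  show "locally_integrable (\<lambda>u. enn2real (f u))"
    unfolding locally_integrable_def set_integrable_def
  proof (intro allI impI)
    fix t :: real assume "0 \<le> t"
    then show "integrable lborel (\<lambda>u. indicator {0..t} u *\<^sub>R enn2real (f u))"
      using mr nn[of t] fin[of t] by (intro integrableI_nonneg) (auto simp: less_top)
  qed
  show "(LINT u:{0..t}|lborel. enn2real (f u)) = enn2real (\<integral>\<^sup>+u. f u * indicator {0..t} u \<partial>lborel)" if "0 \<le> t"
    unfolding set_lebesgue_integral_def nn[symmetric]
    using mr by (intro integral_eq_nn_integral) auto
qed

text \<open>Left continuity makes the sublevel set contain its supremum, and
  \<open>x \<le> R x\<close> bounds it. So not lying beyond the supremum is the same as
  \<open>R u \<le> c\<close>, an event read off from \<open>R\<close> at time \<open>u\<close>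
  alone; this is how a stopped interval becomes predictable.\<close>

lemma le_Sup_sublevel_iff:
  fixes R :: "real \<Rightarrow> real"
  assumes R0: "R 0 \<le> c" and mono: "\<And>x y. 0 \<le> x \<Longrightarrow> x \<le> y \<Longrightarrow> R x \<le> R y"
    and left: "\<And>x. 0 < x \<Longrightarrow> continuous (at_left x) R" and ge: "\<And>x. 0 \<le> x \<Longrightarrow> x \<le> R x"
    and u: "0 \<le> u"
  shows "u \<le> Sup {x. 0 \<le> x \<and> R x \<le> c} \<longleftrightarrow> R u \<le> c"
proof
  let ?X = "{x. 0 \<le> x \<and> R x \<le> c}"
  have bdd: "bdd_above ?X" using ge by (intro bdd_aboveI[of _ c]) (auto intro: order_trans)
  show "u \<le> Sup ?X" if "R u \<le> c" using that u bdd by (intro cSup_upper) auto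
  have less: "R x \<le> c" if x: "x < Sup ?X" "0 \<le> x" for x
  proof -
    have "?X \<noteq> {}" using R0 by auto
    from less_cSupE[OF x(1) this] obtain y where "y \<in> ?X" "x < y" by blast
    then show ?thesis using mono[of x y] x(2) by auto
  qed
  assume "u \<le> Sup ?X"
  then consider "u < Sup ?X" | "u = 0" | "0 < u" "u = Sup ?X" using u by linarith
  then show "R u \<le> c"
  proof cases
    case 3
    have "(R \<longlongrightarrow> R u) (at_left u)" using left[OF 3(1)] by (simp add: continuous_within)
    moreover have "\<forall>\<^sub>F x in at_left u. R x \<le> c"
      using less 3 unfolding eventually_at_left_field by (intro exI[of _ 0]) auto
    ultimately show ?thesis by (rule tendsto_upperbound) simp
  qed (use less u R0 in auto)
qed

text \<open>The kernels enter only through \<open>p\<close> and \<open>q\<close>, the time densities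
  of the compensators of the positive and the negative part of \<open>exp (a x) - 1\<close>;
  \<open>ennreal\<close> performs the truncation at zero. \<open>\<Omega>\<close> collects paths
  that do not explode and along which these densities are integrable over bounded time
  intervals.\<close>

locale jump_price = square_integrable_martingale M F L
  for M :: "'a measure" and F :: "real \<Rightarrow> 'a measure" and L :: "real \<Rightarrow> 'a \<Rightarrow> real" +
  fixes T :: "nat \<Rightarrow> 'a \<Rightarrow> real" and U :: "nat \<Rightarrow> 'a \<Rightarrow> 'e::euclidean_space"
    and a :: "'e \<Rightarrow> real" and p q :: "'a \<times> real \<Rightarrow> ennreal" and \<Omega> :: "'a set"
  assumes mpp: "marked_point_process M F T U"
    and opt: "optional_random_measure M F (mpp_measure T U)"
    and a: "a \<in> borel_measurable borel"
    and p: "p \<in> borel_measurable (predictable_sigma M F)"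
    and q: "q \<in> borel_measurable (predictable_sigma M F)"
    and comp_p: "\<And>H. H \<in> borel_measurable (predictable_sigma M F) \<Longrightarrow>
      (\<integral>\<^sup>+\<omega>. (\<Sum>i. H (\<omega>, T i \<omega>) * ennreal (exp (a (U i \<omega>)) - 1)) \<partial>M)
      = (\<integral>\<^sup>+\<omega>. (\<integral>\<^sup>+u. H (\<omega>, u) * p (\<omega>, u) * indicator {0..} u \<partial>lborel) \<partial>M)"
    and comp_q: "\<And>H. H \<in> borel_measurable (predictable_sigma M F) \<Longrightarrow>
      (\<integral>\<^sup>+\<omega>. (\<Sum>i. H (\<omega>, T i \<omega>) * ennreal (1 - exp (a (U i \<omega>)))) \<partial>M)
      = (\<integral>\<^sup>+\<omega>. (\<integral>\<^sup>+u. H (\<omega>, u) * q (\<omega>, u) * indicator {0..} u \<partial>lborel) \<partial>M)"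
    and \<Omega>_subset: "\<Omega> \<subseteq> space M" and \<Omega>_AE: "AE \<omega> in M. \<omega> \<in> \<Omega>"
    and \<Omega>_lim: "\<And>\<omega>. \<omega> \<in> \<Omega> \<Longrightarrow> filterlim (\<lambda>i. T i \<omega>) at_top sequentially"
    and \<Omega>_fin: "\<And>\<omega> t. \<omega> \<in> \<Omega> \<Longrightarrow> 0 \<le> t \<Longrightarrow>
      (\<integral>\<^sup>+u. (p (\<omega>, u) + q (\<omega>, u)) * indicator {0..t} u \<partial>lborel) < \<top>"
begin

lemmas T = marked_point_process_facts[OF mpp]

lemma \<Omega>_F: "0 \<le> t \<Longrightarrow> \<Omega> \<in> sets (F t)"
  using AE_set_in_F[OF \<Omega>_AE] \<Omega>_subset by (simp add: Int_absorb1 Collect_conj_eq)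

lemma \<Omega>_jump_times: "\<omega> \<in> \<Omega> \<Longrightarrow> jump_times (\<lambda>i. T i \<omega>)"
  using T(2,3) \<Omega>_lim \<Omega>_subset by unfold_locales auto

definition h :: "'a \<Rightarrow> real \<Rightarrow> real" where
  "h \<omega> u = enn2real (p (\<omega>, u)) - enn2real (q (\<omega>, u))"

text \<open>Zero outside \<open>\<Omega>\<close>, like \<open>A\<close> and \<open>jsum\<close>
  below: \<open>left_process\<close> asks for regularity of every path, and \<open>\<Omega>\<close>
  belongs to \<open>F t\<close> for all \<open>t \<ge> 0\<close>, so the modification stays
  adapted.\<close>

definition K :: "real \<Rightarrow> 'a \<Rightarrow> real" where
  "K t \<omega> = (if \<omega> \<in> \<Omega> then LINT s:{0..t}|lborel. h \<omega> s else 0)"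

definition A :: "real \<Rightarrow> 'a \<Rightarrow> real" where
  "A t \<omega> = (if \<omega> \<in> \<Omega> then LINT s:{0..t}|lborel. enn2real (p (\<omega>, s)) + enn2real (q (\<omega>, s)) else 0)"

lemma \<Omega>_pq:
  assumes "\<omega> \<in> \<Omega>"
  shows "locally_integrable (\<lambda>u. enn2real (p (\<omega>, u)))" "locally_integrable (\<lambda>u. enn2real (q (\<omega>, u)))"
    "AE u in lborel. 0 \<le> u \<longrightarrow> p (\<omega>, u) < \<top>" "AE u in lborel. 0 \<le> u \<longrightarrow> q (\<omega>, u) < \<top>"
    "\<And>t. 0 \<le> t \<Longrightarrow> (LINT u:{0..t}|lborel. enn2real (p (\<omega>, u))) = enn2real (\<integral>\<^sup>+u. p (\<omega>, u) * indicator {0..t} u \<partial>lborel)"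
    "\<And>t. 0 \<le> t \<Longrightarrow> (LINT u:{0..t}|lborel. enn2real (q (\<omega>, u))) = enn2real (\<integral>\<^sup>+u. q (\<omega>, u) * indicator {0..t} u \<partial>lborel)"
proof -
  have w: "\<omega> \<in> space M" using assms \<Omega>_subset by auto
  have fin: "(\<integral>\<^sup>+u. f u * indicator {0..t} u \<partial>lborel) < \<top>"
    if "0 \<le> t" "\<And>u. f u \<le> p (\<omega>, u) + q (\<omega>, u)" for f t
  proof -
    have "(\<integral>\<^sup>+u. f u * indicator {0..t} u \<partial>lborel) \<le> (\<integral>\<^sup>+u. (p (\<omega>, u) + q (\<omega>, u)) * indicator {0..t} u \<partial>lborel)"
      using that(2) by (intro nn_integral_mono mult_right_mono) auto
    also have "\<dots> < \<top>" by (rule \<Omega>_fin[OF assms that(1)])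
    finally show ?thesis .
  qed
  note P = locally_integrable_enn2real[OF predictable_path[OF p w] fin]
  note Q = locally_integrable_enn2real[OF predictable_path[OF q w] fin]
  show "locally_integrable (\<lambda>u. enn2real (p (\<omega>, u)))" "AE u in lborel. 0 \<le> u \<longrightarrow> p (\<omega>, u) < \<top>"
    "\<And>t. 0 \<le> t \<Longrightarrow> (LINT u:{0..t}|lborel. enn2real (p (\<omega>, u))) = enn2real (\<integral>\<^sup>+u. p (\<omega>, u) * indicator {0..t} u \<partial>lborel)"
    using P by auto
  show "locally_integrable (\<lambda>u. enn2real (q (\<omega>, u)))" "AE u in lborel. 0 \<le> u \<longrightarrow> q (\<omega>, u) < \<top>"
    "\<And>t. 0 \<le> t \<Longrightarrow> (LINT u:{0..t}|lborel. enn2real (q (\<omega>, u))) = enn2real (\<integral>\<^sup>+u. q (\<omega>, u) * indicator {0..t} u \<partial>lborel)"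
    using Q by auto
qed

lemma \<Omega>_h: "\<omega> \<in> \<Omega> \<Longrightarrow> locally_integrable (h \<omega>)"
  using \<Omega>_pq(1,2) unfolding h_def locally_integrable_def by (auto intro: set_integral_diff)

lemma \<Omega>_abs: "\<omega> \<in> \<Omega> \<Longrightarrow> locally_integrable (\<lambda>u. enn2real (p (\<omega>, u)) + enn2real (q (\<omega>, u)))"
  using \<Omega>_pq(1,2) unfolding locally_integrable_def by (auto intro: set_integral_add)

section \<open>Adaptedness and path regularity of the drift and of the jump sums\<close>

lemma integral_adapted:
  assumes "f \<in> borel_measurable (predictable_sigma M F)"
  shows "(\<lambda>\<omega>. \<integral>\<^sup>+u. f (\<omega>, u) * indicator {0..t} u \<partial>lborel) \<in> borel_measurable (F t)"
  using predictable_progressive[OF assms, of t]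
  by (intro lborel.borel_measurable_nn_integral) (simp add: split_beta')

lemma If_\<Omega>_measurable:
  assumes "0 \<le> t" "f \<in> borel_measurable (F t)" "\<And>\<omega>. \<omega> \<in> \<Omega> \<Longrightarrow> f \<omega> = g \<omega>"
  shows "(\<lambda>\<omega>. if \<omega> \<in> \<Omega> then g \<omega> else (c::real)) \<in> borel_measurable (F t)"
proof -
  have "(\<lambda>\<omega>. if \<omega> \<in> \<Omega> then f \<omega> else c) \<in> borel_measurable (F t)"
    using assms(2) \<Omega>_F[OF assms(1)] by (intro measurable_If_set) (auto simp: Int_absorb2 \<Omega>_subset)
  then show ?thesis by (rule measurable_cong[THEN iffD1, rotated]) (simp add: assms(3))
qed

lemma K_adapted: "adapted F K"
  unfolding adapted_def K_def
proof (intro allI impI)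
  fix t :: real assume t: "0 \<le> t"
  show "(\<lambda>\<omega>. if \<omega> \<in> \<Omega> then LINT s:{0..t}|lborel. h \<omega> s else 0) \<in> borel_measurable (F t)"
  proof (rule If_\<Omega>_measurable[OF t])
    show "(\<lambda>\<omega>. enn2real (\<integral>\<^sup>+u. p (\<omega>, u) * indicator {0..t} u \<partial>lborel)
        - enn2real (\<integral>\<^sup>+u. q (\<omega>, u) * indicator {0..t} u \<partial>lborel)) \<in> borel_measurable (F t)"
      using integral_adapted[OF p] integral_adapted[OF q] by measurable
    show "enn2real (\<integral>\<^sup>+u. p (\<omega>, u) * indicator {0..t} u \<partial>lborel)
        - enn2real (\<integral>\<^sup>+u. q (\<omega>, u) * indicator {0..t} u \<partial>lborel) = (LINT s:{0..t}|lborel. h \<omega> s)" if "\<omega> \<in> \<Omega>" for \<omega>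
      using \<Omega>_pq(1,2,5,6)[OF that] t by (simp add: h_def locally_integrable_def set_integral_diff)
  qed
qed

lemma A_adapted: "adapted F A"
  unfolding adapted_def A_def
proof (intro allI impI)
  fix t :: real assume t: "0 \<le> t"
  show "(\<lambda>\<omega>. if \<omega> \<in> \<Omega> then LINT s:{0..t}|lborel. enn2real (p (\<omega>, s)) + enn2real (q (\<omega>, s)) else 0) \<in> borel_measurable (F t)"
  proof (rule If_\<Omega>_measurable[OF t])
    show "(\<lambda>\<omega>. enn2real (\<integral>\<^sup>+u. p (\<omega>, u) * indicator {0..t} u \<partial>lborel)
        + enn2real (\<integral>\<^sup>+u. q (\<omega>, u) * indicator {0..t} u \<partial>lborel)) \<in> borel_measurable (F t)"
      using integral_adapted[OF p] integral_adapted[OF q] by measurable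
    show "enn2real (\<integral>\<^sup>+u. p (\<omega>, u) * indicator {0..t} u \<partial>lborel)
        + enn2real (\<integral>\<^sup>+u. q (\<omega>, u) * indicator {0..t} u \<partial>lborel)
        = (LINT s:{0..t}|lborel. enn2real (p (\<omega>, s)) + enn2real (q (\<omega>, s)))" if "\<omega> \<in> \<Omega>" for \<omega>
      using \<Omega>_pq(1,2,5,6)[OF that] t by (simp add: locally_integrable_def set_integral_add)
  qed
qed

lemma K_cont: "continuous_on {0..} (\<lambda>t. K t \<omega>)"
  by (cases "\<omega> \<in> \<Omega>") (auto simp: K_def intro: locally_integrable_continuous \<Omega>_h)

lemma A_cont: "continuous_on {0..} (\<lambda>t. A t \<omega>)"
  by (cases "\<omega> \<in> \<Omega>") (auto simp: A_def intro: locally_integrable_continuous \<Omega>_abs)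

lemma K_0: "K 0 \<omega> = 0" and A_0: "A 0 \<omega> = 0"
  unfolding K_def A_def integral_point by simp_all

lemma A_mono: "0 \<le> s \<Longrightarrow> s \<le> t \<Longrightarrow> A s \<omega> \<le> A t \<omega>"
proof (cases "\<omega> \<in> \<Omega>")
  case True
  assume st: "0 \<le> s" "s \<le> t"
  have "0 \<le> (LINT u:{s<..t}|lborel. enn2real (p (\<omega>, u)) + enn2real (q (\<omega>, u)))"
    unfolding set_lebesgue_integral_def by (rule Bochner_Integration.integral_nonneg) simp
  then show ?thesis
    using locally_integrable_split[OF \<Omega>_abs[OF True] st] True by (simp add: A_def)
qed (simp add: A_def)

lemma K_le_A: "0 \<le> t \<Longrightarrow> - K t \<omega> \<le> A t \<omega>"
proof (cases "\<omega> \<in> \<Omega>")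
  case True
  assume t: "0 \<le> t"
  have "0 \<le> A t \<omega> + K t \<omega>"
  proof -
    have "A t \<omega> + K t \<omega> = (LINT s:{0..t}|lborel. (enn2real (p (\<omega>, s)) + enn2real (q (\<omega>, s))) + h \<omega> s)"
      using \<Omega>_abs[OF True] \<Omega>_h[OF True] t True
      by (simp add: A_def K_def locally_integrable_def set_integral_add)
    also have "\<dots> \<ge> 0"
      unfolding set_lebesgue_integral_def
      by (rule Bochner_Integration.integral_nonneg) (simp add: h_def)
    finally show ?thesis .
  qed
  then show ?thesis by simp
qed (simp add: A_def K_def)

text \<open>\<open>C t\<close> will be \<open>{..<t}\<close> or \<open>{..t}\<close>: the first
  gives the left limit of the jump sum, the second its current value.\<close>

definition jsum :: "('e \<Rightarrow> real) \<Rightarrow> (real \<Rightarrow> real set) \<Rightarrow> real \<Rightarrow> 'a \<Rightarrow> real" where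
  "jsum f C t \<omega> = (if \<omega> \<in> \<Omega> then \<Sum>i | T i \<omega> \<in> C t. f (U i \<omega>) else 0)"

text \<open>That the marks are known in time comes from optionality of the random measure: for fixed
  \<open>t\<close> the sum is its integral up to \<open>t\<close> of \<open>f\<close> times the
  indicator of the fixed time set \<open>C t\<close>. The sign condition is there because
  \<open>rm_integral\<close> takes values in \<open>ennreal\<close>.\<close>

lemma jsum_adapted_nonneg:
  assumes f: "f \<in> borel_measurable borel" "\<And>x. 0 \<le> f x"
    and C: "\<And>t. C t \<in> sets borel" "\<And>t. C t \<subseteq> {..t}"
  shows "adapted F (jsum f C)"
  unfolding adapted_def
proof (intro allI impI)
  fix t :: real assume t: "0 \<le> t"
  define V where "V z = ennreal (f (snd z)) * indicator (C t) (snd (fst z))" for z :: "('a \<times> real) \<times> 'e"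
  have "V \<in> borel_measurable (optional_sigma M F \<Otimes>\<^sub>M borel)"
  proof -
    have "snd \<in> borel_measurable (optional_sigma M F)"
      by (rule measurable_optional_if_predictable[OF measurable_snd_predictable])
    then have "(\<lambda>z. indicator (C t) (snd (fst z)) :: ennreal) \<in> borel_measurable (optional_sigma M F \<Otimes>\<^sub>M (borel :: 'e measure))"
      using C(1) by (intro measurable_compose[OF measurable_compose[OF measurable_fst]] borel_measurable_indicator)
    moreover have "(\<lambda>z. ennreal (f (snd z))) \<in> borel_measurable (optional_sigma M F \<Otimes>\<^sub>M (borel :: 'e measure))"
      using measurable_compose[OF measurable_snd f(1)] by measurable
    ultimately show ?thesis unfolding V_def by (intro borel_measurable_times_ennreal)
  qed
  then have "(\<lambda>(\<omega>, t). rm_integral (mpp_measure T U) V {0..t} \<omega>) \<in> borel_measurable (optional_sigma M F)"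
    using opt unfolding optional_random_measure_def by blast
  from measurable_compose[OF measurable_Pair_optional_time[OF t] this]
  have rm: "(\<lambda>\<omega>. rm_integral (mpp_measure T U) V {0..t} \<omega>) \<in> borel_measurable (F t)" by simp
  show "jsum f C t \<in> borel_measurable (F t)"
    unfolding jsum_def
  proof (rule If_\<Omega>_measurable[OF t])
    show "(\<lambda>\<omega>. enn2real (rm_integral (mpp_measure T U) V {0..t} \<omega>)) \<in> borel_measurable (F t)"
      using rm by measurable
    fix \<omega> assume w: "\<omega> \<in> \<Omega>"
    interpret jump_times "\<lambda>i. T i \<omega>" by (rule \<Omega>_jump_times[OF w])
    have fin: "finite {i. T i \<omega> \<in> C t}"
      using C(2) by (intro finite_subset[OF _ finite_jumps(1)[of t]]) auto
    have eq: "(\<lambda>(s, x). V ((\<omega>, s), x) * indicator {0..t} s)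
        = (\<lambda>z. ennreal (f (snd z)) * indicator (C t) (fst z) * indicator {0..t} (fst z))"
      by (auto simp: V_def)
    have "(\<lambda>(s, x). V ((\<omega>, s), x) * indicator {0..t} s) \<in> borel_measurable borel"
      unfolding eq borel_prod[symmetric] using C(1) f(1)
      by (intro borel_measurable_times_ennreal measurable_compose[OF measurable_fst borel_measurable_indicator]
          measurable_compose[OF measurable_snd]) auto
    then have "rm_integral (mpp_measure T U) V {0..t} \<omega> = (\<Sum>j. V ((\<omega>, T j \<omega>), U j \<omega>) * indicator {0..t} (T j \<omega>))"
      by (rule rm_integral_mpp)
    also have "\<dots> = (\<Sum>j | T j \<omega> \<in> C t. V ((\<omega>, T j \<omega>), U j \<omega>) * indicator {0..t} (T j \<omega>))"
      using fin by (intro suminf_finite) (auto simp: V_def)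
    also have "\<dots> = (\<Sum>j | T j \<omega> \<in> C t. ennreal (f (U j \<omega>)))"
      using C(2) T_pos by (intro sum.cong) (auto simp: V_def indicator_def less_imp_le)
    also have "\<dots> = ennreal (\<Sum>j | T j \<omega> \<in> C t. f (U j \<omega>))" using f(2) by simp
    finally show "enn2real (rm_integral (mpp_measure T U) V {0..t} \<omega>) = (\<Sum>i | T i \<omega> \<in> C t. f (U i \<omega>))"
      using f(2) by (simp add: sum_nonneg)
  qed
qed

lemma jsum_adapted:
  assumes f: "f \<in> borel_measurable borel" and C: "\<And>t. C t \<in> sets borel" "\<And>t. C t \<subseteq> {..t}"
  shows "adapted F (jsum f C)"
proof -
  have "jsum f C t \<omega> = jsum (\<lambda>x. max (f x) 0) C t \<omega> - jsum (\<lambda>x. max (- f x) 0) C t \<omega>" for t \<omega>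
    unfolding jsum_def by (auto simp: sum_subtractf[symmetric] intro!: sum.cong)
  then have "jsum f C t = (\<lambda>\<omega>. jsum (\<lambda>x. max (f x) 0) C t \<omega> - jsum (\<lambda>x. max (- f x) 0) C t \<omega>)" for t
    by (rule ext)
  moreover have "adapted F (jsum (\<lambda>x. max (f x) 0) C)" "adapted F (jsum (\<lambda>x. max (- f x) 0) C)"
    using f by (auto intro!: jsum_adapted_nonneg C)
  ultimately show ?thesis unfolding adapted_def by (simp only:) (intro allI impI borel_measurable_diff; simp)
qed

text \<open>The summand \<open>t\<close> forces \<open>\<tau> n \<omega> \<le> n\<close>. Summing
  over \<open>lessThan\<close> leaves out a jump at \<open>t\<close> itself and keeps
  \<open>R\<close> left-continuous, at the price that the jump at the localizing time is not
  controlled.\<close>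

definition R :: "real \<Rightarrow> 'a \<Rightarrow> real" where
  "R t \<omega> = t + A t \<omega> + jsum (\<lambda>x. \<bar>a x\<bar>) lessThan t \<omega>"

text \<open>The left limit of \<open>S\<close>, and the predictable integrand in the equation for
  \<open>S\<close>.\<close>

definition H :: "real \<Rightarrow> 'a \<Rightarrow> real" where
  "H t \<omega> = exp (jsum a lessThan t \<omega> - K t \<omega>)"

definition S :: "real \<Rightarrow> 'a \<Rightarrow> real" where
  "S t \<omega> = exp (jsum a atMost t \<omega> - K t \<omega>)"

lemma jsum_left_cont: "continuous (at_left t) (\<lambda>s. jsum f lessThan s \<omega>)"
proof (cases "\<omega> \<in> \<Omega>")
  case True
  interpret jump_times "\<lambda>i. T i \<omega>" by (rule \<Omega>_jump_times[OF True])
  have "\<forall>\<^sub>F s in at_left t. jsum f lessThan s \<omega> = jsum f lessThan t \<omega>"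
    using eventually_jumps_left[of t] by eventually_elim (simp add: jsum_def True)
  then show ?thesis unfolding continuous_within by (rule tendsto_eventually)
qed (simp add: jsum_def)

lemma jsum_right_cont: "continuous (at_right t) (\<lambda>s. jsum f atMost s \<omega>)"
proof (cases "\<omega> \<in> \<Omega>")
  case True
  interpret jump_times "\<lambda>i. T i \<omega>" by (rule \<Omega>_jump_times[OF True])
  have "\<forall>\<^sub>F s in at_right t. jsum f atMost s \<omega> = jsum f atMost t \<omega>"
    using eventually_jumps_right[of t] by eventually_elim (simp add: jsum_def True)
  then show ?thesis unfolding continuous_within by (rule tendsto_eventually)
qed (simp add: jsum_def)

lemma jsum_left_limit: "((\<lambda>s. jsum f atMost s \<omega>) \<longlongrightarrow> jsum f lessThan t \<omega>) (at_left t)"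
proof (cases "\<omega> \<in> \<Omega>")
  case True
  interpret jump_times "\<lambda>i. T i \<omega>" by (rule \<Omega>_jump_times[OF True])
  have "\<forall>\<^sub>F s in at_left t. jsum f atMost s \<omega> = jsum f lessThan t \<omega>"
    using eventually_jumps_left[of t] by eventually_elim (simp add: jsum_def True)
  then show ?thesis by (rule tendsto_eventually)
qed (simp add: jsum_def)

lemma jsum_lessThan_adapted: "f \<in> borel_measurable borel \<Longrightarrow> adapted F (jsum f lessThan)"
  by (rule jsum_adapted) auto

lemma jsum_atMost_adapted: "f \<in> borel_measurable borel \<Longrightarrow> adapted F (jsum f atMost)"
  by (rule jsum_adapted) auto

lemma H_left_process: "left_process M F H"
  unfolding left_process_def
proof (intro conjI ballI allI impI)
  show "adapted F H"
    using jsum_lessThan_adapted[OF a] K_adapted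
    unfolding adapted_def H_def by (auto intro!: measurable_compose[OF _ borel_measurable_exp] borel_measurable_diff)
  show "continuous (at_left t) (\<lambda>s. H s \<omega>)" if "0 < t" for t \<omega>
    unfolding H_def
    by (intro continuous_exp continuous_diff jsum_left_cont continuous_on_sides(1)[OF K_cont that])
qed

lemma R_left_cont: "0 < t \<Longrightarrow> continuous (at_left t) (\<lambda>s. R s \<omega>)"
  unfolding R_def
  by (intro continuous_add continuous_ident jsum_left_cont continuous_on_sides(1)[OF A_cont])

lemma R_left_process: "left_process M F R"
  unfolding left_process_def
proof (intro conjI ballI allI impI)
  have "adapted F (jsum (\<lambda>x. \<bar>a x\<bar>) lessThan)" using a by (intro jsum_lessThan_adapted) measurable
  then show "adapted F R"
    using A_adapted unfolding adapted_def R_def by (auto intro!: borel_measurable_add)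
qed (rule R_left_cont)

lemma S_adapted: "adapted F S"
  using jsum_atMost_adapted[OF a] K_adapted
  unfolding adapted_def S_def by (auto intro!: measurable_compose[OF _ borel_measurable_exp] borel_measurable_diff)

lemma S_right_cont: "0 \<le> t \<Longrightarrow> continuous (at_right t) (\<lambda>s. S s \<omega>)"
  unfolding S_def
  by (intro continuous_exp continuous_diff jsum_right_cont continuous_on_sides(2)[OF K_cont])

lemma S_left_limit: "0 < t \<Longrightarrow> ((\<lambda>s. S s \<omega>) \<longlongrightarrow> H t \<omega>) (at_left t)"
  unfolding S_def H_def using continuous_on_sides(1)[OF K_cont]
  by (intro tendsto_exp tendsto_diff jsum_left_limit) (simp add: continuous_within)

lemma S_0: "\<omega> \<in> space M \<Longrightarrow> S 0 \<omega> = 1"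
proof -
  assume "\<omega> \<in> space M"
  then have "{i. T i \<omega> \<le> 0} = {}" using T(2)[of \<omega>] by (auto simp: not_le)
  then show ?thesis by (simp add: S_def K_0 jsum_def)
qed

section \<open>Localizing times\<close>

lemma jsum_abs_mono: "s \<le> t \<Longrightarrow> jsum (\<lambda>x. \<bar>a x\<bar>) lessThan s \<omega> \<le> jsum (\<lambda>x. \<bar>a x\<bar>) lessThan t \<omega>"
proof (cases "\<omega> \<in> \<Omega>")
  case True
  assume "s \<le> t"
  interpret jump_times "\<lambda>i. T i \<omega>" by (rule \<Omega>_jump_times[OF True])
  show ?thesis using True \<open>s \<le> t\<close> finite_jumps(2)[of t] by (auto simp: jsum_def intro!: sum_mono2)
qed (simp add: jsum_def)

lemma jsum_abs_nonneg: "0 \<le> jsum (\<lambda>x. \<bar>a x\<bar>) C t \<omega>"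
  by (simp add: jsum_def sum_nonneg)

lemma R_mono: "0 \<le> s \<Longrightarrow> s \<le> t \<Longrightarrow> R s \<omega> \<le> R t \<omega>"
  unfolding R_def using A_mono[of s t \<omega>] jsum_abs_mono[of s t \<omega>] by simp

lemma A_nonneg: "0 \<le> t \<Longrightarrow> 0 \<le> A t \<omega>"
  using A_mono[of 0 t \<omega>] A_0[of \<omega>] by simp

lemma R_ge: "0 \<le> t \<Longrightarrow> t \<le> R t \<omega>" "0 \<le> t \<Longrightarrow> A t \<omega> \<le> R t \<omega>"
  using A_nonneg[of t \<omega>] jsum_abs_nonneg[of lessThan t \<omega>] by (auto simp: R_def)

lemma R_0: "\<omega> \<in> space M \<Longrightarrow> R 0 \<omega> = 0"
proof -
  assume "\<omega> \<in> space M"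
  then have "{i. T i \<omega> < 0} = {}" using T(2)[of \<omega>] by (auto simp: not_less less_imp_le)
  then show ?thesis by (simp add: R_def A_0 jsum_def)
qed

lemma H_le: "0 \<le> t \<Longrightarrow> H t \<omega> \<le> exp (R t \<omega>)"
proof -
  assume t: "0 \<le> t"
  have "jsum a lessThan t \<omega> \<le> jsum (\<lambda>x. \<bar>a x\<bar>) lessThan t \<omega>"
    by (auto simp: jsum_def intro!: sum_mono)
  with K_le_A[OF t, of \<omega>] t show ?thesis by (simp add: H_def R_def)
qed

definition \<tau> :: "nat \<Rightarrow> 'a \<Rightarrow> real" where
  "\<tau> n \<omega> = Sup {u. 0 \<le> u \<and> R u \<omega> \<le> real n}"

lemma le_\<tau>_iff: "\<omega> \<in> space M \<Longrightarrow> 0 \<le> u \<Longrightarrow> u \<le> \<tau> n \<omega> \<longleftrightarrow> R u \<omega> \<le> real n"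
  unfolding \<tau>_def by (intro le_Sup_sublevel_iff) (auto simp: R_0 R_mono R_left_cont R_ge)

lemma \<tau>_nonneg: "\<omega> \<in> space M \<Longrightarrow> 0 \<le> \<tau> n \<omega>"
  using le_\<tau>_iff[of \<omega> 0 n] by (simp add: R_0)

text \<open>\<open>\<tau> n \<omega> \<le> t\<close> means that \<open>R\<close> exceeds
  \<open>n\<close> at every time after \<open>t\<close>, or along \<open>b j\<close> decreasing to
  \<open>t\<close>. Since \<open>R\<close> may rise immediately after \<open>t\<close>, a jump at
  \<open>t\<close> being counted only later, the event is first placed in each \<open>F s\<close>
  with \<open>s > t\<close>; right continuity of the filtration brings it into
  \<open>F t\<close>.\<close>

lemma \<tau>_stopping: "stopping_time F (\<tau> n)"
proof
  fix t
  show "Measurable.pred (F t) (\<lambda>\<omega>. \<tau> n \<omega> \<le> t)"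
  proof (cases "0 \<le> t")
    case False
    then have "{\<omega> \<in> space (F t). \<tau> n \<omega> \<le> t} = {}" using \<tau>_nonneg[of _ n] by force
    then show ?thesis unfolding pred_def by (simp only: sets.empty_sets)
  next
    case True
    have "{\<omega> \<in> space M. \<tau> n \<omega> \<le> t} \<in> sets (F t)"
    proof (rule sets_F_rightI[OF True])
      fix s assume s: "t < s"
      define b where "b j = t + (s - t) / real (Suc j)" for j
      have b: "t < b j" "b j \<le> s" for j
        using s mult_right_mono[of t s "real j"] by (auto simp: b_def field_simps)
      have "{\<omega> \<in> space M. real n < R (b j) \<omega>} \<in> sets (F s)" for j
      proof -
        have "R (b j) \<in> borel_measurable (F (b j))"
          using R_left_process b(1)[of j] True by (simp add: left_process_def adapted_def)
        then have "R (b j) \<in> borel_measurable (F s)" by (rule measurable_F_mono[OF _ b(2)])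
        then have "{\<omega> \<in> space (F s). real n < R (b j) \<omega>} \<in> sets (F s)" by measurable
        then show ?thesis by simp
      qed
      then have "(\<Inter>j. {\<omega> \<in> space M. real n < R (b j) \<omega>}) \<in> sets (F s)" by (intro sets.countable_INT) auto
      moreover have "(\<Inter>j. {\<omega> \<in> space M. real n < R (b j) \<omega>}) = {\<omega> \<in> space M. \<tau> n \<omega> \<le> t}"
      proof safe
        fix \<omega> assume w: "\<omega> \<in> (\<Inter>j. {\<omega> \<in> space M. real n < R (b j) \<omega>})"
        then have wM: "\<omega> \<in> space M" by blast
        then show "\<omega> \<in> space M" .
        have "\<tau> n \<omega> \<le> b j" for j
        proof -
          have "real n < R (b j) \<omega>" using w by blast
          then show ?thesis using le_\<tau>_iff[OF wM, of "b j" n] b(1)[of j] True by linarith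
        qed
        moreover have "b \<longlonglongrightarrow> t + (s - t) * 0"
          unfolding b_def divide_inverse by (intro tendsto_intros LIMSEQ_inverse_real_of_nat)
        ultimately show "\<tau> n \<omega> \<le> t" by (intro LIMSEQ_le_const[of b]) auto
      next
        fix \<omega> j assume w: "\<omega> \<in> space M" "\<tau> n \<omega> \<le> t"
        then show "real n < R (b j) \<omega>"
          using le_\<tau>_iff[OF w(1), of "b j" n] b(1)[of j] True by linarith
      qed
      ultimately show "{\<omega> \<in> space M. \<tau> n \<omega> \<le> t} \<in> sets (F s)" by simp
    qed
    then show ?thesis by (simp add: pred_def)
  qed
qed

lemma \<tau>_incseq: "\<omega> \<in> space M \<Longrightarrow> incseq (\<lambda>n. \<tau> n \<omega>)"
proof (rule incseq_SucI)
  fix n assume w: "\<omega> \<in> space M"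
  have "R (\<tau> n \<omega>) \<omega> \<le> real n" using le_\<tau>_iff[OF w \<tau>_nonneg[OF w], of n n] by simp
  then show "\<tau> n \<omega> \<le> \<tau> (Suc n) \<omega>" using le_\<tau>_iff[OF w \<tau>_nonneg[OF w], of n "Suc n"] by simp
qed

lemma \<tau>_lim: "\<omega> \<in> space M \<Longrightarrow> filterlim (\<lambda>n. \<tau> n \<omega>) at_top sequentially"
  unfolding filterlim_at_top
proof
  fix Z assume w: "\<omega> \<in> space M"
  obtain N where N: "R (max 0 Z) \<omega> \<le> real N" using real_arch_simple by blast
  show "\<forall>\<^sub>F n in sequentially. Z \<le> \<tau> n \<omega>"
    unfolding eventually_sequentially
  proof (intro exI allI impI)
    fix n assume "N \<le> n"
    then have "R (max 0 Z) \<omega> \<le> real n" using N by linarith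
    then show "Z \<le> \<tau> n \<omega>" using le_\<tau>_iff[OF w, of "max 0 Z" n] by simp
  qed
qed

end


section \<open>The price as a local martingale\<close>

context jump_price
begin

lemma H_pos: "0 < H t \<omega>" and S_pos: "0 < S t \<omega>"
  by (simp_all add: H_def S_def)

text \<open>\<open>H\<close> is at most \<open>exp (R v)\<close> on the interval, so
  \<open>r\<close> weighted with \<open>H\<close> stays integrable and its \<open>ennreal\<close>
  and real integrals agree; \<open>r\<close> stands for \<open>p\<close> or
  \<open>q\<close>.\<close>

lemma weighted_integral:
  assumes w: "\<omega> \<in> \<Omega>" and sv: "0 \<le> s" "s \<le> v"
    and r: "r \<in> borel_measurable (predictable_sigma M F)"
      "locally_integrable (\<lambda>u. enn2real (r (\<omega>, u)))" "AE u in lborel. 0 \<le> u \<longrightarrow> r (\<omega>, u) < \<top>"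
  shows "set_integrable lborel {s<..v} (\<lambda>u. enn2real (r (\<omega>, u)) * H u \<omega>)"
    and "(\<integral>\<^sup>+u. ennreal (indicator {s<..v} u * H u \<omega>) * r (\<omega>, u) * indicator {0..} u \<partial>lborel)
      = ennreal (LINT u:{s<..v}|lborel. enn2real (r (\<omega>, u)) * H u \<omega>)"
proof -
  have wM: "\<omega> \<in> space M" using w \<Omega>_subset by auto
  have "(\<lambda>(\<omega>, u). ennreal (H u \<omega>)) \<in> borel_measurable (predictable_sigma M F)"
    using left_process_predictable[OF H_left_process] by (simp add: split_beta')
  from predictable_path[OF this wM]
  have "(\<lambda>u. enn2real (ennreal (H u \<omega>) * indicator {0..} u)) \<in> borel_measurable borel" by simp
  then have Hm: "(\<lambda>u. indicator {0..} u * H u \<omega>) \<in> borel_measurable borel"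
    by (rule measurable_cong[THEN iffD1, rotated]) (auto simp: indicator_def H_pos less_imp_le)
  have rm: "integrable lborel (\<lambda>u. indicator {s<..v} u *\<^sub>R enn2real (r (\<omega>, u)))"
    using locally_integrable_subset(1)[OF r(2) sv(1), of v] by (simp add: set_integrable_def)
  show int: "set_integrable lborel {s<..v} (\<lambda>u. enn2real (r (\<omega>, u)) * H u \<omega>)"
    unfolding set_integrable_def
  proof (rule Bochner_Integration.integrable_bound)
    show "integrable lborel (\<lambda>u. exp (R v \<omega>) * (indicator {s<..v} u *\<^sub>R enn2real (r (\<omega>, u))))"
      using rm by simp
    have "(\<lambda>u. (indicator {s<..v} u *\<^sub>R enn2real (r (\<omega>, u))) * (indicator {0..} u * H u \<omega>)) \<in> borel_measurable lborel"
      using borel_measurable_integrable[OF rm] Hm by measurable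
    then show "(\<lambda>u. indicator {s<..v} u *\<^sub>R (enn2real (r (\<omega>, u)) * H u \<omega>)) \<in> borel_measurable lborel"
      by (rule measurable_cong[THEN iffD1, rotated]) (use sv in \<open>auto simp: indicator_def\<close>)
    show "AE u in lborel. norm (indicator {s<..v} u *\<^sub>R (enn2real (r (\<omega>, u)) * H u \<omega>))
        \<le> norm (exp (R v \<omega>) * (indicator {s<..v} u *\<^sub>R enn2real (r (\<omega>, u))))"
    proof (rule AE_I2)
      fix u :: real
      show "norm (indicator {s<..v} u *\<^sub>R (enn2real (r (\<omega>, u)) * H u \<omega>))
        \<le> norm (exp (R v \<omega>) * (indicator {s<..v} u *\<^sub>R enn2real (r (\<omega>, u))))"
      proof (cases "u \<in> {s<..v}")
        case True
        then have "H u \<omega> \<le> exp (R v \<omega>)"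
          using H_le[of u \<omega>] R_mono[of u v \<omega>] sv by (auto intro: order_trans)
        then have "enn2real (r (\<omega>, u)) * H u \<omega> \<le> enn2real (r (\<omega>, u)) * exp (R v \<omega>)"
          by (rule mult_left_mono) simp
        then show ?thesis using True H_pos[of u \<omega>] by (simp add: abs_mult mult.commute)
      qed simp
    qed
  qed
  have "(\<integral>\<^sup>+u. ennreal (indicator {s<..v} u * H u \<omega>) * r (\<omega>, u) * indicator {0..} u \<partial>lborel)
      = (\<integral>\<^sup>+u. ennreal (indicator {s<..v} u *\<^sub>R (enn2real (r (\<omega>, u)) * H u \<omega>)) \<partial>lborel)"
  proof (rule nn_integral_cong_AE)
    show "AE u in lborel. ennreal (indicator {s<..v} u * H u \<omega>) * r (\<omega>, u) * indicator {0..} u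
        = ennreal (indicator {s<..v} u *\<^sub>R (enn2real (r (\<omega>, u)) * H u \<omega>))"
      using r(3)
    proof eventually_elim
      case (elim u)
      show ?case
      proof (cases "s < u \<and> u \<le> v")
        case True
        then have "r (\<omega>, u) = ennreal (enn2real (r (\<omega>, u)))" using elim sv by simp
        moreover have "ennreal (H u \<omega>) * ennreal (enn2real (r (\<omega>, u))) = ennreal (enn2real (r (\<omega>, u)) * H u \<omega>)"
          using H_pos[of u \<omega>] by (simp add: ennreal_mult[symmetric] less_imp_le mult.commute)
        ultimately show ?thesis using True sv by simp
      qed (auto simp: indicator_def)
    qed
  qed
  also have "\<dots> = ennreal (LINT u:{s<..v}|lborel. enn2real (r (\<omega>, u)) * H u \<omega>)"
    unfolding set_lebesgue_integral_def using int H_pos[THEN less_imp_le]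
    by (intro nn_integral_eq_integral) (auto simp: set_integrable_def)
  finally show "(\<integral>\<^sup>+u. ennreal (indicator {s<..v} u * H u \<omega>) * r (\<omega>, u) * indicator {0..} u \<partial>lborel)
      = ennreal (LINT u:{s<..v}|lborel. enn2real (r (\<omega>, u)) * H u \<omega>)" .
qed

text \<open>This is \<open>exp_jump_identity\<close> for the path, with jumps and drift split by
  sign and every subtracted term moved to the other side, so that it holds in \<open>ennreal\<close>
  and can be integrated before any expectation is known to be finite.\<close>

lemma price_identity:
  assumes w: "\<omega> \<in> \<Omega>" and sv: "0 \<le> s" "s \<le> v"
  shows "ennreal (S v \<omega>)
      + (\<Sum>i. ennreal (indicator {s<..v} (T i \<omega>) * H (T i \<omega>) \<omega>) * ennreal (1 - exp (a (U i \<omega>))))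
      + (\<integral>\<^sup>+u. ennreal (indicator {s<..v} u * H u \<omega>) * p (\<omega>, u) * indicator {0..} u \<partial>lborel)
    = ennreal (S s \<omega>)
      + (\<Sum>i. ennreal (indicator {s<..v} (T i \<omega>) * H (T i \<omega>) \<omega>) * ennreal (exp (a (U i \<omega>)) - 1))
      + (\<integral>\<^sup>+u. ennreal (indicator {s<..v} u * H u \<omega>) * q (\<omega>, u) * indicator {0..} u \<partial>lborel)"
proof -
  interpret jump_times "\<lambda>i. T i \<omega>" by (rule \<Omega>_jump_times[OF w])
  let ?I = "{i. s < T i \<omega> \<and> T i \<omega> \<le> v}"
  have fin: "finite ?I" by (rule finite_subset[OF _ finite_jumps(1)[of v]]) auto
  have jumps: "(\<Sum>i. ennreal (indicator {s<..v} (T i \<omega>) * H (T i \<omega>) \<omega>) * ennreal (b i))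
      = ennreal (\<Sum>i\<in>?I. H (T i \<omega>) \<omega> * max (b i) 0)" for b :: "nat \<Rightarrow> real"
  proof -
    have "(\<Sum>i. ennreal (indicator {s<..v} (T i \<omega>) * H (T i \<omega>) \<omega>) * ennreal (b i))
        = (\<Sum>i\<in>?I. ennreal (indicator {s<..v} (T i \<omega>) * H (T i \<omega>) \<omega>) * ennreal (b i))"
      using fin by (intro suminf_finite) (auto simp: indicator_def)
    also have "\<dots> = (\<Sum>i\<in>?I. ennreal (H (T i \<omega>) \<omega> * max (b i) 0))"
    proof (rule sum.cong[OF refl])
      fix i assume "i \<in> ?I"
      \<comment> \<open>\<open>ennreal\<close> sends negative numbers to \<open>0\<close>, so each
        of the two sums retains jumps of one sign.\<close>
      moreover have "ennreal (b i) = ennreal (max (b i) 0)" by (simp add: max_def ennreal_neg)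
      ultimately show "ennreal (indicator {s<..v} (T i \<omega>) * H (T i \<omega>) \<omega>) * ennreal (b i)
          = ennreal (H (T i \<omega>) \<omega> * max (b i) 0)"
        using H_pos[of "T i \<omega>" \<omega>] by (simp add: ennreal_mult less_imp_le)
    qed
    also have "\<dots> = ennreal (\<Sum>i\<in>?I. H (T i \<omega>) \<omega> * max (b i) 0)"
      using H_pos[THEN less_imp_le] by (intro sum_ennreal) simp
    finally show ?thesis .
  qed
  define jp where "jp = (\<Sum>i\<in>?I. H (T i \<omega>) \<omega> * max (exp (a (U i \<omega>)) - 1) 0)"
  define jq where "jq = (\<Sum>i\<in>?I. H (T i \<omega>) \<omega> * max (1 - exp (a (U i \<omega>))) 0)"
  define ip where "ip = (LINT u:{s<..v}|lborel. enn2real (p (\<omega>, u)) * H u \<omega>)"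
  define iq where "iq = (LINT u:{s<..v}|lborel. enn2real (q (\<omega>, u)) * H u \<omega>)"
  note P = weighted_integral[OF w sv p \<Omega>_pq(1,3)[OF w]]
  note Q = weighted_integral[OF w sv q \<Omega>_pq(2,4)[OF w]]
  have nonneg: "0 \<le> jp" "0 \<le> jq" "0 \<le> ip" "0 \<le> iq"
    unfolding jp_def jq_def ip_def iq_def set_lebesgue_integral_def
    using H_pos[THEN less_imp_le] by (auto intro!: sum_nonneg Bochner_Integration.integral_nonneg)
  have K: "(LINT s:{0..t}|lborel. h \<omega> s) = K t \<omega>" for t using w by (simp add: K_def)
  have Jm: "exp (- K u \<omega>) * exp (\<Sum>i | T i \<omega> < u. a (U i \<omega>)) = H u \<omega>" for u
    using w by (simp add: H_def jsum_def exp_add[symmetric])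
  have J: "exp (\<Sum>i | T i \<omega> \<le> u. a (U i \<omega>)) * exp (- K u \<omega>) = S u \<omega>" for u
    using w by (simp add: S_def jsum_def exp_add[symmetric])
  have "S v \<omega> - S s \<omega> = (\<Sum>i\<in>?I. H (T i \<omega>) \<omega> * (exp (a (U i \<omega>)) - 1)) - (LINT u:{s<..v}|lborel. h \<omega> u * H u \<omega>)"
    using exp_jump_identity(2)[OF \<Omega>_h[OF w] sv, of "\<lambda>i. a (U i \<omega>)"] unfolding K Jm J .
  also have "(\<Sum>i\<in>?I. H (T i \<omega>) \<omega> * (exp (a (U i \<omega>)) - 1)) = jp - jq"
    unfolding jp_def jq_def sum_subtractf[symmetric]
    by (intro sum.cong refl) (auto simp: max_def algebra_simps)
  also have "(LINT u:{s<..v}|lborel. h \<omega> u * H u \<omega>) = ip - iq"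
    unfolding ip_def iq_def h_def left_diff_distrib by (rule set_integral_diff(2)[OF P(1) Q(1)])
  finally have "S v \<omega> + jq + ip = S s \<omega> + jp + iq" by simp
  then have "ennreal (S v \<omega>) + ennreal jq + ennreal ip = ennreal (S s \<omega>) + ennreal jp + ennreal iq"
    using nonneg S_pos[THEN less_imp_le] by (simp add: ennreal_plus[symmetric] del: ennreal_plus)
  then show ?thesis
    unfolding jumps P(2) Q(2) jp_def[symmetric] jq_def[symmetric] ip_def[symmetric] iq_def[symmetric] .
qed

lemma L_finite: "0 \<le> t \<Longrightarrow> (\<integral>\<^sup>+\<omega>. ennreal (L t \<omega>) \<partial>M) < \<top>"
proof -
  assume t: "0 \<le> t"
  have "(\<integral>\<^sup>+\<omega>. ennreal (L t \<omega>) \<partial>M) \<le> (\<integral>\<^sup>+\<omega>. 1 + ennreal ((L t \<omega>)\<^sup>2) \<partial>M)"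
  proof (rule nn_integral_mono)
    fix \<omega>
    have "2 * L t \<omega> \<le> 1 + (L t \<omega>)\<^sup>2" using sum_squares_bound[of 1 "L t \<omega>"] by simp
    then have "ennreal (L t \<omega>) \<le> ennreal (1 + (L t \<omega>)\<^sup>2)" using L_nonneg[of t \<omega>] by (intro ennreal_leI) linarith
    then show "ennreal (L t \<omega>) \<le> 1 + ennreal ((L t \<omega>)\<^sup>2)" by (simp add: ennreal_plus)
  qed
  also have "\<dots> = 1 + (\<integral>\<^sup>+\<omega>. ennreal ((L t \<omega>)\<^sup>2) \<partial>M)"
    using L_measurable[OF t] by (subst nn_integral_add) (auto simp: emeasure_space_1)
  also have "\<dots> < \<top>" using L_square_finite[OF t] by simp
  finally show ?thesis .
qed

lemma integral_le_R:
  assumes w: "\<omega> \<in> \<Omega>" and v: "0 \<le> v"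
  shows "(\<integral>\<^sup>+u. p (\<omega>, u) * indicator {0..v} u \<partial>lborel) \<le> ennreal (R v \<omega>)"
    and "(\<integral>\<^sup>+u. q (\<omega>, u) * indicator {0..v} u \<partial>lborel) \<le> ennreal (R v \<omega>)"
proof -
  have fin: "(\<integral>\<^sup>+u. f u * indicator {0..v} u \<partial>lborel) < \<top>" if "\<And>u. f u \<le> p (\<omega>, u) + q (\<omega>, u)" for f
  proof -
    have "(\<integral>\<^sup>+u. f u * indicator {0..v} u \<partial>lborel) \<le> (\<integral>\<^sup>+u. (p (\<omega>, u) + q (\<omega>, u)) * indicator {0..v} u \<partial>lborel)"
      using that by (intro nn_integral_mono mult_right_mono) auto
    also have "\<dots> < \<top>" by (rule \<Omega>_fin[OF w v])
    finally show ?thesis .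
  qed
  have A: "A v \<omega> = (LINT u:{0..v}|lborel. enn2real (p (\<omega>, u))) + (LINT u:{0..v}|lborel. enn2real (q (\<omega>, u)))"
    using \<Omega>_pq(1,2)[OF w] v w by (simp add: A_def locally_integrable_def set_integral_add)
  have sum_le: "enn2real (\<integral>\<^sup>+u. p (\<omega>, u) * indicator {0..v} u \<partial>lborel)
      + enn2real (\<integral>\<^sup>+u. q (\<omega>, u) * indicator {0..v} u \<partial>lborel) \<le> R v \<omega>"
    using R_ge(2)[OF v, of \<omega>] by (simp only: A \<Omega>_pq(5,6)[OF w v])
  have le: "enn2real (\<integral>\<^sup>+u. p (\<omega>, u) * indicator {0..v} u \<partial>lborel) \<le> R v \<omega>"
    "enn2real (\<integral>\<^sup>+u. q (\<omega>, u) * indicator {0..v} u \<partial>lborel) \<le> R v \<omega>"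
    using sum_le enn2real_nonneg[of "\<integral>\<^sup>+u. p (\<omega>, u) * indicator {0..v} u \<partial>lborel"]
      enn2real_nonneg[of "\<integral>\<^sup>+u. q (\<omega>, u) * indicator {0..v} u \<partial>lborel"] by linarith+
  have *: "x \<le> ennreal y" if "x < \<top>" "enn2real x \<le> y" for x y
    using that ennreal_leI[of "enn2real x" y] by simp
  show "(\<integral>\<^sup>+u. p (\<omega>, u) * indicator {0..v} u \<partial>lborel) \<le> ennreal (R v \<omega>)"
    by (rule *[OF fin le(1)]) simp
  show "(\<integral>\<^sup>+u. q (\<omega>, u) * indicator {0..v} u \<partial>lborel) \<le> ennreal (R v \<omega>)"
    by (rule *[OF fin le(2)]) simp
qed

text \<open>On \<open>\<tau> n \<omega> \<le> t\<close> optional sampling replaces \<open>L\<close>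
  at the time \<open>\<tau> n\<close> by \<open>L t\<close>; elsewhere the minimum is
  \<open>t\<close> already. The weight must be known at \<open>\<tau> n\<close>: for
  \<open>u \<le> s\<close> this holds because \<open>\<tau> n\<close> exceeds \<open>s\<close> on
  \<open>B\<close>, for later \<open>u\<close> because \<open>B\<close> belongs to
  \<open>F s\<close>.\<close>

lemma stop_martingale:
  assumes st: "0 \<le> s" "s \<le> t" and B: "B \<in> sets (F s)" and lt: "\<And>\<omega>. \<omega> \<in> B \<Longrightarrow> s < \<tau> n \<omega>"
  shows "(\<integral>\<^sup>+\<omega>. ennreal (L (min t (\<tau> n \<omega>)) \<omega> * S (min t (\<tau> n \<omega>)) \<omega>) * indicator B \<omega> \<partial>M)
    = (\<integral>\<^sup>+\<omega>. ennreal (L t \<omega>) * (ennreal (S (min t (\<tau> n \<omega>)) \<omega>) * indicator B \<omega>) \<partial>M)"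
proof -
  have t: "0 \<le> t" using st by simp
  define Y where "Y \<omega> = ennreal (S (\<tau> n \<omega>) \<omega>) * indicator B \<omega>" for \<omega>
  have Y: "(\<lambda>\<omega>. Y \<omega> * indicator {\<omega>. \<tau> n \<omega> \<le> u} \<omega>) \<in> borel_measurable (F u)" if u: "0 \<le> u" for u
  proof (cases "u \<le> s")
    case True
    then have "(\<lambda>\<omega>. Y \<omega> * indicator {\<omega>. \<tau> n \<omega> \<le> u} \<omega>) = (\<lambda>\<omega>. 0)"
      using lt by (force simp: Y_def indicator_def fun_eq_iff)
    then show ?thesis by simp
  next
    case False
    have "(\<lambda>\<omega>. S (min u (\<tau> n \<omega>)) \<omega>) \<in> borel_measurable (F u)"
      by (rule measurable_stopped[OF S_adapted S_right_cont \<tau>_stopping \<tau>_nonneg u])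
    moreover have "(indicator B :: 'a \<Rightarrow> ennreal) \<in> borel_measurable (F u)"
      using B sets_F_mono[of s u] False by (intro borel_measurable_indicator) auto
    moreover have "(indicator {\<omega>. \<tau> n \<omega> \<le> u} :: 'a \<Rightarrow> ennreal) \<in> borel_measurable (F u)"
      using stopping_timeD[OF \<tau>_stopping[of n], of u] by (intro borel_measurable_indicator') (simp add: pred_def)
    ultimately have "(\<lambda>\<omega>. ennreal (S (min u (\<tau> n \<omega>)) \<omega>) * indicator B \<omega> * indicator {\<omega>. \<tau> n \<omega> \<le> u} \<omega>) \<in> borel_measurable (F u)"
      by (intro borel_measurable_times_ennreal measurable_compose[OF _ measurable_ennreal])
    then show ?thesis by (rule measurable_cong[THEN iffD1, rotated]) (auto simp: Y_def indicator_def min_def)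
  qed
  let ?Z = "\<lambda>\<omega>. Y \<omega> * indicator {\<omega>. \<tau> n \<omega> \<le> t} \<omega>"
  let ?E = "\<lambda>\<omega>. ennreal (L t \<omega>) * (ennreal (S t \<omega>) * indicator B \<omega> * indicator {\<omega>. t < \<tau> n \<omega>} \<omega>)"
  have Z: "?Z \<in> borel_measurable M" by (rule measurable_F_M[OF Y[OF t]])
  have Lt: "(\<lambda>\<omega>. ennreal (L t \<omega>)) \<in> borel_measurable M" using L_measurable[OF t] by simp
  have L\<tau>: "(\<lambda>\<omega>. ennreal (L (\<tau> n \<omega>) \<omega>)) \<in> borel_measurable M"
    by (rule L_sampled_measurable[OF \<tau>_stopping \<tau>_nonneg])
  have E: "?E \<in> borel_measurable M"
  proof -
    have "S t \<in> borel_measurable M" using S_adapted t by (auto simp: adapted_def intro: measurable_F_M)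
    moreover have "(indicator B :: 'a \<Rightarrow> ennreal) \<in> borel_measurable M"
      using B sets_F_subset[of s] by (intro borel_measurable_indicator) auto
    moreover have "(indicator {\<omega>. t < \<tau> n \<omega>} :: 'a \<Rightarrow> ennreal) \<in> borel_measurable M"
      using measurable_F_M[OF stopping_timeD2[OF \<tau>_stopping[of n], of t]]
      by (intro borel_measurable_indicator') (simp add: pred_def)
    ultimately show ?thesis
      by (intro borel_measurable_times_ennreal measurable_compose[OF _ measurable_ennreal] L_measurable t)
  qed
  have "(\<integral>\<^sup>+\<omega>. ennreal (L (min t (\<tau> n \<omega>)) \<omega> * S (min t (\<tau> n \<omega>)) \<omega>) * indicator B \<omega> \<partial>M)
      = (\<integral>\<^sup>+\<omega>. ennreal (L (\<tau> n \<omega>) \<omega>) * ?Z \<omega> + ?E \<omega> \<partial>M)"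
    using L_nonneg S_pos[THEN less_imp_le]
    by (intro nn_integral_cong) (auto simp: Y_def indicator_def min_def ennreal_mult)
  also have "\<dots> = (\<integral>\<^sup>+\<omega>. ennreal (L (\<tau> n \<omega>) \<omega>) * ?Z \<omega> \<partial>M) + (\<integral>\<^sup>+\<omega>. ?E \<omega> \<partial>M)"
    by (rule nn_integral_add[OF borel_measurable_times_ennreal[OF L\<tau> Z] E])
  also have "(\<integral>\<^sup>+\<omega>. ennreal (L (\<tau> n \<omega>) \<omega>) * ?Z \<omega> \<partial>M) = (\<integral>\<^sup>+\<omega>. ennreal (L t \<omega>) * ?Z \<omega> \<partial>M)"
    by (rule optional_sampling[symmetric, OF \<tau>_stopping \<tau>_nonneg Y t])
  also have "\<dots> + (\<integral>\<^sup>+\<omega>. ?E \<omega> \<partial>M) = (\<integral>\<^sup>+\<omega>. ennreal (L t \<omega>) * ?Z \<omega> + ?E \<omega> \<partial>M)"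
    by (rule nn_integral_add[symmetric, OF borel_measurable_times_ennreal[OF Lt Z] E])
  also have "\<dots> = (\<integral>\<^sup>+\<omega>. ennreal (L t \<omega>) * (ennreal (S (min t (\<tau> n \<omega>)) \<omega>) * indicator B \<omega>) \<partial>M)"
    by (intro nn_integral_cong) (auto simp: Y_def indicator_def min_def)
  finally show ?thesis .
qed

text \<open>Weighted with \<open>L t\<close>, the jump sums and the time integrals in
  \<open>price_identity\<close> have equal expectations by \<open>jump_compensation\<close>, so the
  same two numbers are added on both sides. They can be cancelled since up to
  \<open>\<tau> n\<close> the integrand \<open>H\<close> is at most \<open>exp n\<close> and the
  integrals of \<open>p\<close> and \<open>q\<close> are at most \<open>n\<close>.\<close>

lemma drift_cancels:
  assumes st: "0 \<le> s" "s \<le> t" and B: "B \<in> sets (F s)" "B \<subseteq> \<Omega>" and lt: "\<And>\<omega>. \<omega> \<in> B \<Longrightarrow> s < \<tau> n \<omega>"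
  shows "(\<integral>\<^sup>+\<omega>. ennreal (L t \<omega>) * (ennreal (S (min t (\<tau> n \<omega>)) \<omega>) * indicator B \<omega>) \<partial>M)
    = (\<integral>\<^sup>+\<omega>. ennreal (L t \<omega>) * (ennreal (S s \<omega>) * indicator B \<omega>) \<partial>M)"
proof -
  have t: "0 \<le> t" using st by simp
  \<comment> \<open>\<open>H\<close> on the event \<open>B\<close> and the interval from
    \<open>s\<close>, exclusive, to \<open>min t (\<tau> n \<omega>)\<close>, in a visibly
    predictable form: \<open>B\<close> is known from \<open>s\<close> on, and
    \<open>R u \<omega> \<le> n\<close> replaces \<open>u \<le> \<tau> n \<omega>\<close>.\<close>
  define \<Theta> where "\<Theta> z = (case z of (\<omega>, u) \<Rightarrow>
      ennreal (indicator B \<omega> * indicator {s<..} u * indicator {..t} u * indicator {..real n} (R u \<omega>) * H u \<omega>))" for z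
  have \<Theta>: "\<Theta> \<in> borel_measurable (predictable_sigma M F)"
  proof -
    have "left_process M F (\<lambda>u \<omega>. indicator B \<omega> * indicator {s<..} u)"
      unfolding left_process_def adapted_def
    proof (intro conjI allI impI ballI)
      fix u :: real
      show "(\<lambda>\<omega>. indicator B \<omega> * indicator {s<..} u :: real) \<in> borel_measurable (F u)"
      proof (cases "s < u")
        case True
        then have "B \<in> sets (F u)" using B sets_F_mono[of s u] by auto
        then show ?thesis by simp
      qed simp
      fix \<omega>
      have "\<forall>\<^sub>F v in at_left u. indicator {s<..} v = (indicator {s<..} u :: real)"
      proof (cases "s < u")
        case True
        then show ?thesis by (auto simp: eventually_at_left_field intro!: exI[of _ s])
      next
        case False
        then show ?thesis by (auto simp: eventually_at_left_field intro!: exI[of _ "u - 1"])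
      qed
      then have "\<forall>\<^sub>F v in at_left u. indicator B \<omega> * indicator {s<..} v = (indicator B \<omega> * indicator {s<..} u :: real)"
        by eventually_elim simp
      then show "continuous (at_left u) (\<lambda>v. indicator B \<omega> * indicator {s<..} v :: real)"
        unfolding continuous_within by (rule tendsto_eventually)
    qed
    note 1 = left_process_predictable[OF this]
    have 2: "(\<lambda>z. indicator {..t} (snd z) :: real) \<in> borel_measurable (predictable_sigma M F)"
      by (rule measurable_compose[OF measurable_snd_predictable]) simp
    have 3: "(\<lambda>z. indicator {..real n} ((\<lambda>(\<omega>, u). R u \<omega>) z) :: real) \<in> borel_measurable (predictable_sigma M F)"
      by (rule measurable_compose[OF left_process_predictable[OF R_left_process]]) simp
    note 4 = left_process_predictable[OF H_left_process]
    show ?thesis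
      unfolding \<Theta>_def split_beta'
      using borel_measurable_times[OF borel_measurable_times[OF borel_measurable_times[OF 1 2] 3] 4]
      by (intro measurable_compose[OF _ measurable_ennreal]) (simp add: split_beta')
  qed
  have \<Theta>_t: "\<Theta> (\<omega>, u) = 0" if "t < u" for \<omega> u using that by (simp add: \<Theta>_def)
  have \<Theta>_B: "\<Theta> (\<omega>, u) = ennreal (indicator {s<..min t (\<tau> n \<omega>)} u * H u \<omega>)" if "\<omega> \<in> B" for \<omega> u
  proof (cases "s < u")
    case True
    have "\<omega> \<in> space M" using that B sets.sets_into_space[OF B(1)] by auto
    then have "u \<le> \<tau> n \<omega> \<longleftrightarrow> R u \<omega> \<le> real n" using True st by (intro le_\<tau>_iff) auto
    then show ?thesis using True that by (auto simp: \<Theta>_def indicator_def)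
  qed (simp add: \<Theta>_def)
  have \<Theta>_nB: "\<Theta> (\<omega>, u) = 0" if "\<omega> \<notin> B" for \<omega> u using that by (simp add: \<Theta>_def)
  let ?fp = "\<lambda>x. ennreal (exp (a x) - 1)" and ?fq = "\<lambda>x. ennreal (1 - exp (a x))"
  let ?J = "\<lambda>f \<omega>. \<Sum>i. \<Theta> (\<omega>, T i \<omega>) * f (U i \<omega>)"
  let ?I = "\<lambda>r \<omega>. \<integral>\<^sup>+u. \<Theta> (\<omega>, u) * r (\<omega>, u) * indicator {0..} u \<partial>lborel"
  let ?D = "\<lambda>\<omega>. ennreal (S (min t (\<tau> n \<omega>)) \<omega>) * indicator B \<omega>"
  let ?D' = "\<lambda>\<omega>. ennreal (S s \<omega>) * indicator B \<omega>"
  have identity: "?D \<omega> + ?J ?fq \<omega> + ?I p \<omega> = ?D' \<omega> + ?J ?fp \<omega> + ?I q \<omega>" for \<omega>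
  proof (cases "\<omega> \<in> B")
    case True
    have "s \<le> min t (\<tau> n \<omega>)" using st lt[OF True] by simp
    from price_identity[OF _ st(1) this, of \<omega>] True B show ?thesis by (auto simp: \<Theta>_B)
  qed (simp add: \<Theta>_nB)
  have fm: "?fp \<in> borel_measurable borel" "?fq \<in> borel_measurable borel" using a by measurable
  have Lt: "(\<lambda>\<omega>. ennreal (L t \<omega>)) \<in> borel_measurable M" using L_measurable[OF t] by simp
  have Jm: "?J f \<in> borel_measurable M" if f: "f \<in> borel_measurable borel" for f :: "'e \<Rightarrow> ennreal"
  proof (rule borel_measurable_suminf_order)
    fix i
    have "T i \<in> borel_measurable M"
      using measurable_stopping_time[OF T(1)] sets_F_subset by auto
    then have "(\<lambda>\<omega>. (\<omega>, T i \<omega>)) \<in> measurable M (M \<Otimes>\<^sub>M borel)" by measurable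
    from measurable_compose[OF this predictable_joint[OF \<Theta>]]
    have "(\<lambda>\<omega>. \<Theta> (\<omega>, T i \<omega>) * indicator {0..} (T i \<omega>)) \<in> borel_measurable M" by simp
    then have "(\<lambda>\<omega>. \<Theta> (\<omega>, T i \<omega>)) \<in> borel_measurable M"
      by (rule measurable_cong[THEN iffD1, rotated]) (use T(2) in \<open>auto simp: indicator_def less_imp_le\<close>)
    moreover have "U i \<in> borel_measurable M" using mpp by (simp add: marked_point_process_def)
    ultimately show "(\<lambda>\<omega>. \<Theta> (\<omega>, T i \<omega>) * f (U i \<omega>)) \<in> borel_measurable M"
      by (intro borel_measurable_times_ennreal measurable_compose[OF _ f])
  qed
  have Im: "?I r \<in> borel_measurable M" if r: "r \<in> borel_measurable (predictable_sigma M F)" for r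
    using predictable_joint[OF borel_measurable_times_ennreal[OF \<Theta> r]]
    by (intro lborel.borel_measurable_nn_integral) (simp add: split_beta')
  have Dm: "?D \<in> borel_measurable M" "?D' \<in> borel_measurable M"
  proof -
    have m1: "(\<lambda>\<omega>. S (min t (\<tau> n \<omega>)) \<omega>) \<in> borel_measurable M"
      by (rule measurable_F_M[OF measurable_stopped[OF S_adapted S_right_cont \<tau>_stopping \<tau>_nonneg t]])
    have m2: "S s \<in> borel_measurable M" using S_adapted st by (auto simp: adapted_def intro: measurable_F_M)
    have m3: "(indicator B :: 'a \<Rightarrow> ennreal) \<in> borel_measurable M"
      using B sets_F_subset[of s] by (intro borel_measurable_indicator) auto
    show "?D \<in> borel_measurable M" "?D' \<in> borel_measurable M"
      by (intro borel_measurable_times_ennreal measurable_compose[OF _ measurable_ennreal] m1 m2 m3)+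
  qed
  have sum: "(\<integral>\<^sup>+\<omega>. ennreal (L t \<omega>) * (x \<omega> + y \<omega> + z \<omega>) \<partial>M)
      = (\<integral>\<^sup>+\<omega>. ennreal (L t \<omega>) * x \<omega> \<partial>M) + (\<integral>\<^sup>+\<omega>. ennreal (L t \<omega>) * y \<omega> \<partial>M) + (\<integral>\<^sup>+\<omega>. ennreal (L t \<omega>) * z \<omega> \<partial>M)"
    if "x \<in> borel_measurable M" "y \<in> borel_measurable M" "z \<in> borel_measurable M" for x y z
    using that Lt by (simp add: distrib_left nn_integral_add)
  have compP: "(\<integral>\<^sup>+\<omega>. ennreal (L t \<omega>) * ?J ?fp \<omega> \<partial>M) = (\<integral>\<^sup>+\<omega>. ennreal (L t \<omega>) * ?I p \<omega> \<partial>M)"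
    by (rule jump_compensation[OF mpp opt fm(1) p comp_p \<Theta> \<Theta>_t t])
  have compQ: "(\<integral>\<^sup>+\<omega>. ennreal (L t \<omega>) * ?J ?fq \<omega> \<partial>M) = (\<integral>\<^sup>+\<omega>. ennreal (L t \<omega>) * ?I q \<omega> \<partial>M)"
    by (rule jump_compensation[OF mpp opt fm(2) q comp_q \<Theta> \<Theta>_t t])
  \<comment> \<open>Only the time integrals are estimated; the expected jump sums inherit finiteness
    through \<open>compP\<close> and \<open>compQ\<close>, although the jump at
    \<open>\<tau> n\<close> has no bound.\<close>
  have I_bound: "(\<integral>\<^sup>+\<omega>. ennreal (L t \<omega>) * ?I r \<omega> \<partial>M) < \<top>"
    if r: "r \<in> borel_measurable (predictable_sigma M F)"
      and le: "\<And>\<omega> v. \<omega> \<in> \<Omega> \<Longrightarrow> 0 \<le> v \<Longrightarrow> (\<integral>\<^sup>+u. r (\<omega>, u) * indicator {0..v} u \<partial>lborel) \<le> ennreal (R v \<omega>)" for r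
  proof -
    have "?I r \<omega> \<le> ennreal (exp n) * ennreal n" for \<omega>
    proof (cases "\<omega> \<in> B")
      case True
      let ?v = "min t (\<tau> n \<omega>)"
      have w: "\<omega> \<in> \<Omega>" "\<omega> \<in> space M" using True B \<Omega>_subset by auto
      have v: "0 \<le> ?v" using t \<tau>_nonneg[OF w(2)] by simp
      have Rv: "R ?v \<omega> \<le> real n" using le_\<tau>_iff[OF w(2) v, of n] by simp
      have "?I r \<omega> \<le> (\<integral>\<^sup>+u. ennreal (exp n) * (r (\<omega>, u) * indicator {0..?v} u) \<partial>lborel)"
      proof (rule nn_integral_mono)
        fix u :: real
        show "\<Theta> (\<omega>, u) * r (\<omega>, u) * indicator {0..} u \<le> ennreal (exp n) * (r (\<omega>, u) * indicator {0..?v} u)"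
        proof (cases "s < u \<and> u \<le> ?v")
          case uv: True
          then have "H u \<omega> \<le> exp n"
            using H_le[of u \<omega>] R_mono[of u ?v \<omega>] st Rv by (auto intro: order_trans)
          then show ?thesis using uv st True
            by (auto simp: \<Theta>_B indicator_def intro!: mult_right_mono ennreal_leI)
        qed (use True in \<open>auto simp: \<Theta>_B indicator_def\<close>)
      qed
      also have "\<dots> = ennreal (exp n) * (\<integral>\<^sup>+u. r (\<omega>, u) * indicator {0..?v} u \<partial>lborel)"
      proof (rule nn_integral_cmult)
        have "(\<lambda>u. (r (\<omega>, u) * indicator {0..} u) * indicator {..?v} u) \<in> borel_measurable borel"
          using predictable_path[OF r w(2)] by measurable
        then show "(\<lambda>u. r (\<omega>, u) * indicator {0..?v} u) \<in> borel_measurable lborel"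
          by (simp, rule measurable_cong[THEN iffD1, rotated]) (auto simp: indicator_def)
      qed
      also have "\<dots> \<le> ennreal (exp n) * ennreal n"
        using le[OF w(1) v] Rv by (intro mult_left_mono) (auto intro: order_trans ennreal_leI)
      finally show ?thesis .
    qed (simp add: \<Theta>_nB)
    then have "(\<integral>\<^sup>+\<omega>. ennreal (L t \<omega>) * ?I r \<omega> \<partial>M) \<le> (\<integral>\<^sup>+\<omega>. ennreal (L t \<omega>) * (ennreal (exp n) * ennreal n) \<partial>M)"
      by (intro nn_integral_mono mult_left_mono) auto
    also have "\<dots> = (\<integral>\<^sup>+\<omega>. ennreal (L t \<omega>) \<partial>M) * (ennreal (exp n) * ennreal n)"
      using Lt by (rule nn_integral_multc)
    also have "\<dots> < \<top>" using L_finite[OF t] by (simp add: ennreal_mult_less_top)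
    finally show ?thesis .
  qed
  have "(\<integral>\<^sup>+\<omega>. ennreal (L t \<omega>) * ?D \<omega> \<partial>M) + (\<integral>\<^sup>+\<omega>. ennreal (L t \<omega>) * ?I q \<omega> \<partial>M) + (\<integral>\<^sup>+\<omega>. ennreal (L t \<omega>) * ?I p \<omega> \<partial>M)
      = (\<integral>\<^sup>+\<omega>. ennreal (L t \<omega>) * ?D' \<omega> \<partial>M) + (\<integral>\<^sup>+\<omega>. ennreal (L t \<omega>) * ?I p \<omega> \<partial>M) + (\<integral>\<^sup>+\<omega>. ennreal (L t \<omega>) * ?I q \<omega> \<partial>M)"
    using sum[OF Dm(1) Jm[OF fm(2)] Im[OF p]] sum[OF Dm(2) Jm[OF fm(1)] Im[OF q]]
    unfolding identity compP compQ by (rule trans[OF sym])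
  moreover have "(\<integral>\<^sup>+\<omega>. ennreal (L t \<omega>) * ?I p \<omega> \<partial>M) < \<top>" "(\<integral>\<^sup>+\<omega>. ennreal (L t \<omega>) * ?I q \<omega> \<partial>M) < \<top>"
    using I_bound[OF p integral_le_R(1)] I_bound[OF q integral_le_R(2)] by auto
  \<comment> \<open>Cancellation in \<open>ennreal\<close> is valid for finite terms only.\<close>
  moreover have "x = y" if "x + cq + cp = y + cp + cq" "cp < \<top>" "cq < \<top>" for x y cp cq :: ennreal
    using that by (metis add.commute add.left_commute ennreal_add_left_cancel infinity_ennreal_def less_irrefl)
  ultimately show ?thesis by blast
qed

text \<open>On \<open>\<tau> n \<omega> \<le> s\<close> both sides are already frozen at
  \<open>\<tau> n\<close>. On the rest \<open>L\<close> is moved to time \<open>t\<close>, there the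
  drift cancels, and the martingale property brings \<open>L\<close> back to \<open>s\<close>.
  Intersecting with \<open>\<Omega>\<close> costs a null set.\<close>

lemma stopped_expectation:
  assumes st: "0 \<le> s" "s \<le> t" and B: "B \<in> sets (F s)"
  shows "(\<integral>\<^sup>+\<omega>. ennreal (L (min t (\<tau> n \<omega>)) \<omega> * S (min t (\<tau> n \<omega>)) \<omega>) * indicator B \<omega> \<partial>M)
    = (\<integral>\<^sup>+\<omega>. ennreal (L (min s (\<tau> n \<omega>)) \<omega> * S (min s (\<tau> n \<omega>)) \<omega>) * indicator B \<omega> \<partial>M)"
proof -
  have t: "0 \<le> t" using st by simp
  let ?Z = "\<lambda>u \<omega>. ennreal (L (min u (\<tau> n \<omega>)) \<omega> * S (min u (\<tau> n \<omega>)) \<omega>)"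
  define B1 where "B1 = B \<inter> {\<omega> \<in> space M. \<tau> n \<omega> \<le> s}"
  define B2 where "B2 = B \<inter> \<Omega> \<inter> (space M - {\<omega> \<in> space M. \<tau> n \<omega> \<le> s})"
  have \<tau>F: "{\<omega> \<in> space M. \<tau> n \<omega> \<le> s} \<in> sets (F s)"
    using stopping_timeD[OF \<tau>_stopping[of n], of s] by (simp add: pred_def)
  have B1: "B1 \<in> sets (F s)" unfolding B1_def using B \<tau>F by (rule sets.Int)
  have B2: "B2 \<in> sets (F s)"
  proof -
    have "space (F s) - {\<omega> \<in> space M. \<tau> n \<omega> \<le> s} \<in> sets (F s)" using \<tau>F by (rule sets.compl_sets)
    then show ?thesis unfolding B2_def using sets.Int[OF sets.Int[OF B \<Omega>_F[OF st(1)]]] by simp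
  qed
  have LS: "adapted F (\<lambda>t \<omega>. L t \<omega> * S t \<omega>)"
    using L_adapted S_adapted by (auto simp: adapted_def intro!: borel_measurable_times)
  have LS_right: "continuous (at_right u) (\<lambda>u. L u \<omega> * S u \<omega>)" if "\<omega> \<in> space M" "0 \<le> u" for \<omega> u
    by (intro continuous_mult S_right_cont continuous_on_sides(2)[OF L_cont] that)
  have Zm: "?Z u \<in> borel_measurable M" if "0 \<le> u" for u
    using measurable_F_M[OF measurable_stopped[OF LS LS_right \<tau>_stopping \<tau>_nonneg that]] by measurable
  have split: "(\<integral>\<^sup>+\<omega>. ?Z u \<omega> * indicator B \<omega> \<partial>M)
      = (\<integral>\<^sup>+\<omega>. ?Z u \<omega> * indicator B1 \<omega> \<partial>M) + (\<integral>\<^sup>+\<omega>. ?Z u \<omega> * indicator B2 \<omega> \<partial>M)" if u: "0 \<le> u" for u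
  proof -
    have "(\<integral>\<^sup>+\<omega>. ?Z u \<omega> * indicator B \<omega> \<partial>M) = (\<integral>\<^sup>+\<omega>. ?Z u \<omega> * indicator B1 \<omega> + ?Z u \<omega> * indicator B2 \<omega> \<partial>M)"
    proof (rule nn_integral_cong_AE)
      show "AE \<omega> in M. ?Z u \<omega> * indicator B \<omega> = ?Z u \<omega> * indicator B1 \<omega> + ?Z u \<omega> * indicator B2 \<omega>"
        using \<Omega>_AE AE_space by eventually_elim (auto simp: B1_def B2_def indicator_def)
    qed
    also have "\<dots> = (\<integral>\<^sup>+\<omega>. ?Z u \<omega> * indicator B1 \<omega> \<partial>M) + (\<integral>\<^sup>+\<omega>. ?Z u \<omega> * indicator B2 \<omega> \<partial>M)"
      using Zm[OF u] B1 B2 sets_F_subset[of s]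
      by (intro nn_integral_add borel_measurable_times_ennreal borel_measurable_indicator) auto
    finally show ?thesis .
  qed
  have "(\<integral>\<^sup>+\<omega>. ?Z t \<omega> * indicator B1 \<omega> \<partial>M) = (\<integral>\<^sup>+\<omega>. ?Z s \<omega> * indicator B1 \<omega> \<partial>M)"
    using st by (intro nn_integral_cong) (auto simp: B1_def indicator_def min_def)
  moreover have "(\<integral>\<^sup>+\<omega>. ?Z t \<omega> * indicator B2 \<omega> \<partial>M) = (\<integral>\<^sup>+\<omega>. ?Z s \<omega> * indicator B2 \<omega> \<partial>M)"
  proof -
    have lt: "s < \<tau> n \<omega>" if "\<omega> \<in> B2" for \<omega> using that by (auto simp: B2_def)
    have "B2 \<subseteq> \<Omega>" by (auto simp: B2_def)
    have "(\<integral>\<^sup>+\<omega>. ?Z t \<omega> * indicator B2 \<omega> \<partial>M) = (\<integral>\<^sup>+\<omega>. ennreal (L t \<omega>) * (ennreal (S s \<omega>) * indicator B2 \<omega>) \<partial>M)"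
      using stop_martingale[OF st B2 lt] drift_cancels[OF st B2 \<open>B2 \<subseteq> \<Omega>\<close> lt] by simp
    also have "\<dots> = (\<integral>\<^sup>+\<omega>. ennreal (L s \<omega>) * (ennreal (S s \<omega>) * indicator B2 \<omega>) \<partial>M)"
    proof (rule L_mart[OF st])
      have "S s \<in> borel_measurable (F s)" using S_adapted st by (simp add: adapted_def)
      then show "(\<lambda>\<omega>. ennreal (S s \<omega>) * indicator B2 \<omega>) \<in> borel_measurable (F s)"
        using B2 by (intro borel_measurable_times_ennreal measurable_compose[OF _ measurable_ennreal]) auto
    qed
    also have "\<dots> = (\<integral>\<^sup>+\<omega>. ?Z s \<omega> * indicator B2 \<omega> \<partial>M)"
      using lt L_nonneg S_pos[THEN less_imp_le]
      by (intro nn_integral_cong) (auto simp: indicator_def min_def ennreal_mult dest!: lt)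
    finally show ?thesis .
  qed
  ultimately show ?thesis using split[OF t] split[OF st(1)] by simp
qed

theorem price_local_martingale: "local_martingale M F (\<lambda>t \<omega>. L t \<omega> * S t \<omega>)"
  unfolding local_martingale_def
proof (intro conjI exI[of _ \<tau>] allI ballI)
  show LS: "adapted F (\<lambda>t \<omega>. L t \<omega> * S t \<omega>)"
    using L_adapted S_adapted by (auto simp: adapted_def intro!: borel_measurable_times)
  have LS_right: "continuous (at_right u) (\<lambda>u. L u \<omega> * S u \<omega>)" if "\<omega> \<in> space M" "0 \<le> u" for \<omega> u
    by (intro continuous_mult S_right_cont continuous_on_sides(2)[OF L_cont] that)
  show "AE \<omega> in M. cadlag (\<lambda>t. L t \<omega> * S t \<omega>)"
  proof (rule AE_I2)
    fix \<omega> assume w: "\<omega> \<in> space M"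
    have "((\<lambda>t. L t \<omega> * S t \<omega>) \<longlongrightarrow> L t \<omega> * H t \<omega>) (at_left t)" if "0 < t" for t
      using continuous_on_sides(1)[OF L_cont[OF w] that]
      by (intro tendsto_mult S_left_limit that) (simp add: continuous_within)
    then show "cadlag (\<lambda>t. L t \<omega> * S t \<omega>)"
      using LS_right[OF w] unfolding cadlag_def by blast
  qed
  show "stopping_time F (\<tau> n)" for n by (rule \<tau>_stopping)
  show "0 \<le> \<tau> n \<omega>" if "\<omega> \<in> space M" for n \<omega> using \<tau>_nonneg that .
  show "AE \<omega> in M. incseq (\<lambda>n. \<tau> n \<omega>) \<and> filterlim (\<lambda>n. \<tau> n \<omega>) at_top sequentially"
    by (rule AE_I2) (simp add: \<tau>_incseq \<tau>_lim)
  fix n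
  let ?Z = "\<lambda>t \<omega>. L (min t (\<tau> n \<omega>)) \<omega> * S (min t (\<tau> n \<omega>)) \<omega>"
  have ZF: "?Z t \<in> borel_measurable (F t)" if "0 \<le> t" for t
    by (rule measurable_stopped[OF LS LS_right \<tau>_stopping \<tau>_nonneg that])
  have Z_nonneg: "0 \<le> ?Z t \<omega>" for t \<omega> using L_nonneg S_pos[THEN less_imp_le] by (intro mult_nonneg_nonneg)
  have Zint: "integrable M (?Z t)" if t: "0 \<le> t" for t
  proof (rule integrableI_nonneg)
    show "?Z t \<in> borel_measurable M" by (rule measurable_F_M[OF ZF[OF t]])
    have "(\<integral>\<^sup>+\<omega>. ennreal (?Z t \<omega>) \<partial>M) = (\<integral>\<^sup>+\<omega>. ennreal (?Z t \<omega>) * indicator (space M) \<omega> \<partial>M)"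
      by (intro nn_integral_cong) simp
    \<comment> \<open>Integrability comes from \<open>stopped_expectation\<close> with start time
      \<open>0\<close> and the whole space: since \<open>S 0\<close> is \<open>1\<close>, the
      expectation at any time is that of \<open>L 0\<close>.\<close>
    also have "\<dots> = (\<integral>\<^sup>+\<omega>. ennreal (?Z 0 \<omega>) * indicator (space M) \<omega> \<partial>M)"
      using sets.top[of "F 0"] by (intro stopped_expectation t) simp_all
    also have "\<dots> = (\<integral>\<^sup>+\<omega>. ennreal (L 0 \<omega>) \<partial>M)"
      using \<tau>_nonneg[of _ n] by (intro nn_integral_cong) (simp add: min_def S_0)
    also have "\<dots> < \<infinity>" using L_finite[of 0] by simp
    finally show "(\<integral>\<^sup>+\<omega>. ennreal (?Z t \<omega>) \<partial>M) < \<infinity>" .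
  qed (use Z_nonneg in simp)
  show "martingale M F ?Z"
    unfolding martingale_def
  proof (intro conjI allI impI)
    show "adapted F ?Z" using ZF by (simp add: adapted_def)
    show "integrable M (?Z t)" if "0 \<le> t" for t using Zint that .
    fix s t :: real assume st: "0 \<le> s \<and> s \<le> t"
    interpret sigma_finite_subalgebra M "F s"
      by (rule finite_measure_subalgebra_is_sigma_finite) (simp_all add: subalgebra_F finite_measure_subalgebra_def finite_measure_axioms finite_measure_subalgebra_axioms_def)
    show "AE \<omega> in M. real_cond_exp M (F s) (?Z t) \<omega> = ?Z s \<omega>"
    proof (rule real_cond_exp_charact)
      fix B assume B: "B \<in> sets (F s)"
      have BM: "B \<in> sets M" using B sets_F_subset[of s] by auto
      have eq: "(LINT \<omega>:B|M. ?Z u \<omega>) = enn2real (\<integral>\<^sup>+\<omega>. ennreal (?Z u \<omega>) * indicator B \<omega> \<partial>M)" if "0 \<le> u" for u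
      proof -
        have "(LINT \<omega>:B|M. ?Z u \<omega>) = enn2real (\<integral>\<^sup>+\<omega>. ennreal (indicator B \<omega> *\<^sub>R ?Z u \<omega>) \<partial>M)"
          unfolding set_lebesgue_integral_def using measurable_F_M[OF ZF[OF that]] BM Z_nonneg
          by (intro integral_eq_nn_integral borel_measurable_scaleR borel_measurable_indicator) (auto simp: indicator_def)
        also have "(\<integral>\<^sup>+\<omega>. ennreal (indicator B \<omega> *\<^sub>R ?Z u \<omega>) \<partial>M) = (\<integral>\<^sup>+\<omega>. ennreal (?Z u \<omega>) * indicator B \<omega> \<partial>M)"
          by (intro nn_integral_cong) (auto simp: indicator_def)
        finally show ?thesis .
      qed
      show "(LINT \<omega>:B|M. ?Z t \<omega>) = (LINT \<omega>:B|M. ?Z s \<omega>)"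
        using eq[of s] eq[of t] stopped_expectation[of s t B n] st B by simp
    qed (use st Zint ZF in auto)
  qed
qed

end


section \<open>Exponential martingale, kernels and shot noise\<close>

context stochastic_basis
begin

text \<open>Paths on which \<open>B\<close> is discontinuous form a null set; there the process is
  the constant \<open>c\<close>, so that continuity holds on every path while adaptedness survives
  by the usual conditions. Both moments come from \<open>brownian_exp\<close>, with
  \<open>\<sigma>\<close> for the process and \<open>2 * \<sigma>\<close> for its square.\<close>

lemma exponential_martingale:
  assumes B: "brownian_motion M F B" and c: "0 < c"
  shows "square_integrable_martingale M F (\<lambda>t \<omega>. if \<omega> \<in> space M \<and> continuous_on {0..} (\<lambda>t. B t \<omega>)
    then c * exp (\<sigma> * B t \<omega> - \<sigma>\<^sup>2 * t / 2) else c)"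
proof -
  define \<Omega> where "\<Omega> = {\<omega> \<in> space M. continuous_on {0..} (\<lambda>t. B t \<omega>)}"
  define L where "L t \<omega> = (if \<omega> \<in> \<Omega> then c * exp (\<sigma> * B t \<omega> - \<sigma>\<^sup>2 * t / 2) else c)" for t \<omega>
  have ae: "AE \<omega> in M. continuous_on {0..} (\<lambda>t. B t \<omega>)" using B by (simp add: brownian_motion_def)
  have \<Omega>F: "\<Omega> \<in> sets (F t)" if "0 \<le> t" for t
    unfolding \<Omega>_def by (rule AE_set_in_F[OF ae that])
  have BF: "B t \<in> borel_measurable (F t)" if "0 \<le> t" for t
    using B that by (simp add: brownian_motion_def adapted_def)
  have L1: "AE \<omega> in M. ennreal (L t \<omega>) = ennreal (c * exp (- (\<sigma>\<^sup>2 * t / 2))) * ennreal (exp (\<sigma> * B t \<omega>))" for t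
    using ae AE_space
  proof eventually_elim
    case (elim \<omega>)
    then show ?case using c by (simp add: L_def \<Omega>_def ennreal_mult'[symmetric] exp_add[symmetric] mult.assoc)
  qed
  have L2: "AE \<omega> in M. ennreal ((L t \<omega>)\<^sup>2) = ennreal (c\<^sup>2 * exp (- (\<sigma>\<^sup>2 * t))) * ennreal (exp (2 * \<sigma> * B t \<omega>))" for t
    using ae AE_space
  proof eventually_elim
    case (elim \<omega>)
    have "(exp (\<sigma> * B t \<omega> - \<sigma>\<^sup>2 * t / 2))\<^sup>2 = exp (- (\<sigma>\<^sup>2 * t)) * exp (2 * \<sigma> * B t \<omega>)"
      by (simp add: power2_eq_square exp_add[symmetric] algebra_simps)
    then show ?case using elim by (simp add: L_def \<Omega>_def ennreal_mult'[symmetric] power_mult_distrib mult.assoc)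
  qed
  have E1: "(\<integral>\<^sup>+\<omega>. ennreal (L t \<omega>) * Y \<omega> \<partial>M)
      = ennreal (c * exp (- (\<sigma>\<^sup>2 * t / 2))) * (\<integral>\<^sup>+\<omega>. ennreal (exp (\<sigma> * B t \<omega>)) * Y \<omega> \<partial>M)"
    if "0 \<le> t" "Y \<in> borel_measurable M" for t Y
  proof -
    have "(\<integral>\<^sup>+\<omega>. ennreal (L t \<omega>) * Y \<omega> \<partial>M)
        = (\<integral>\<^sup>+\<omega>. ennreal (c * exp (- (\<sigma>\<^sup>2 * t / 2))) * (ennreal (exp (\<sigma> * B t \<omega>)) * Y \<omega>) \<partial>M)"
    proof (rule nn_integral_cong_AE)
      show "AE \<omega> in M. ennreal (L t \<omega>) * Y \<omega> = ennreal (c * exp (- (\<sigma>\<^sup>2 * t / 2))) * (ennreal (exp (\<sigma> * B t \<omega>)) * Y \<omega>)"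
        using L1[of t] by eventually_elim (simp only: mult.assoc)
    qed
    also have "\<dots> = ennreal (c * exp (- (\<sigma>\<^sup>2 * t / 2))) * (\<integral>\<^sup>+\<omega>. ennreal (exp (\<sigma> * B t \<omega>)) * Y \<omega> \<partial>M)"
      using measurable_F_M[OF BF[OF that(1)]] that(2) by (intro nn_integral_cmult) auto
    finally show ?thesis .
  qed
  have E2: "(\<integral>\<^sup>+\<omega>. ennreal ((L t \<omega>)\<^sup>2) * Y \<omega> \<partial>M)
      = ennreal (c\<^sup>2 * exp (- (\<sigma>\<^sup>2 * t))) * (\<integral>\<^sup>+\<omega>. ennreal (exp (2 * \<sigma> * B t \<omega>)) * Y \<omega> \<partial>M)"
    if "0 \<le> t" "Y \<in> borel_measurable M" for t Y
  proof -
    have "(\<integral>\<^sup>+\<omega>. ennreal ((L t \<omega>)\<^sup>2) * Y \<omega> \<partial>M)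
        = (\<integral>\<^sup>+\<omega>. ennreal (c\<^sup>2 * exp (- (\<sigma>\<^sup>2 * t))) * (ennreal (exp (2 * \<sigma> * B t \<omega>)) * Y \<omega>) \<partial>M)"
    proof (rule nn_integral_cong_AE)
      show "AE \<omega> in M. ennreal ((L t \<omega>)\<^sup>2) * Y \<omega> = ennreal (c\<^sup>2 * exp (- (\<sigma>\<^sup>2 * t))) * (ennreal (exp (2 * \<sigma> * B t \<omega>)) * Y \<omega>)"
        using L2[of t] by eventually_elim (simp only: mult.assoc)
    qed
    also have "\<dots> = ennreal (c\<^sup>2 * exp (- (\<sigma>\<^sup>2 * t))) * (\<integral>\<^sup>+\<omega>. ennreal (exp (2 * \<sigma> * B t \<omega>)) * Y \<omega> \<partial>M)"
      using measurable_F_M[OF BF[OF that(1)]] that(2) by (intro nn_integral_cmult) auto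
    finally show ?thesis .
  qed
  \<comment> \<open>The exponent \<open>\<sigma>\<^sup>2 * (t - s)\<close> arises as half of
    \<open>(2 * \<sigma>)\<^sup>2\<close> minus \<open>\<sigma>\<^sup>2\<close>, times
    \<open>t - s\<close>. The factor is at least one, which gives the submartingale inequality, and
    with \<open>s = 0\<close> it gives finiteness.\<close>
  have E2': "(\<integral>\<^sup>+\<omega>. ennreal ((L t \<omega>)\<^sup>2) * Y \<omega> \<partial>M)
      = ennreal (exp (\<sigma>\<^sup>2 * (t - s))) * (\<integral>\<^sup>+\<omega>. ennreal ((L s \<omega>)\<^sup>2) * Y \<omega> \<partial>M)"
    if st: "0 \<le> s" "s \<le> t" and Y: "Y \<in> borel_measurable (F s)" for s t Y
  proof -
    have t: "0 \<le> t" using st by simp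
    have "c\<^sup>2 * exp (- (\<sigma>\<^sup>2 * t)) * exp ((2 * \<sigma>)\<^sup>2 * (t - s) / 2) = exp (\<sigma>\<^sup>2 * (t - s)) * (c\<^sup>2 * exp (- (\<sigma>\<^sup>2 * s)))"
    proof -
      have "exp (- (\<sigma>\<^sup>2 * t)) * exp ((2 * \<sigma>)\<^sup>2 * (t - s) / 2) = exp (\<sigma>\<^sup>2 * (t - s)) * exp (- (\<sigma>\<^sup>2 * s))"
        unfolding exp_add[symmetric] by (rule arg_cong[where f = exp]) (simp add: power2_eq_square field_simps)
      then have "c\<^sup>2 * (exp (- (\<sigma>\<^sup>2 * t)) * exp ((2 * \<sigma>)\<^sup>2 * (t - s) / 2))
          = c\<^sup>2 * (exp (\<sigma>\<^sup>2 * (t - s)) * exp (- (\<sigma>\<^sup>2 * s)))" by (rule arg_cong)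
      then show ?thesis by (simp only: ac_simps)
    qed
    then have "ennreal (c\<^sup>2 * exp (- (\<sigma>\<^sup>2 * t))) * ennreal (exp ((2 * \<sigma>)\<^sup>2 * (t - s) / 2))
        = ennreal (exp (\<sigma>\<^sup>2 * (t - s))) * ennreal (c\<^sup>2 * exp (- (\<sigma>\<^sup>2 * s)))"
      by (simp add: ennreal_mult'[symmetric])
    then show ?thesis
      unfolding E2[OF t measurable_F_M[OF Y]] E2[OF st(1) measurable_F_M[OF Y]] brownian_exp[OF B st Y]
      by (simp add: mult.assoc[symmetric])
  qed
  have "square_integrable_martingale M F L"
  proof unfold_locales
    show "adapted F L"
      unfolding adapted_def L_def
    proof (intro allI impI)
      fix t :: real assume t: "0 \<le> t"
      have "(\<lambda>\<omega>. c * exp (\<sigma> * B t \<omega> - \<sigma>\<^sup>2 * t / 2)) \<in> borel_measurable (F t)" using BF[OF t] by measurable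
      then show "(\<lambda>\<omega>. if \<omega> \<in> \<Omega> then c * exp (\<sigma> * B t \<omega> - \<sigma>\<^sup>2 * t / 2) else c) \<in> borel_measurable (F t)"
        using \<Omega>F[OF t] sets.sets_into_space[OF \<Omega>F[OF t]]
        by (intro measurable_If_set) (auto simp: Int_absorb2)
    qed
    show "continuous_on {0..} (\<lambda>t. L t \<omega>)" for \<omega>
      by (cases "\<omega> \<in> \<Omega>") (auto simp: L_def \<Omega>_def intro!: continuous_intros)
    show "0 \<le> L t \<omega>" for t \<omega> using c by (simp add: L_def)
    show "(\<integral>\<^sup>+\<omega>. ennreal (L t \<omega>) * Y \<omega> \<partial>M) = (\<integral>\<^sup>+\<omega>. ennreal (L s \<omega>) * Y \<omega> \<partial>M)"
      if st: "0 \<le> s" "s \<le> t" and Y: "Y \<in> borel_measurable (F s)" for s t Y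
    proof -
      have t: "0 \<le> t" using st by simp
      have "c * exp (- (\<sigma>\<^sup>2 * t / 2)) * exp (\<sigma>\<^sup>2 * (t - s) / 2) = c * exp (- (\<sigma>\<^sup>2 * s / 2))"
        by (simp add: exp_add[symmetric] mult.assoc algebra_simps diff_divide_distrib)
      then have "ennreal (c * exp (- (\<sigma>\<^sup>2 * t / 2))) * ennreal (exp (\<sigma>\<^sup>2 * (t - s) / 2)) = ennreal (c * exp (- (\<sigma>\<^sup>2 * s / 2)))"
        using c by (simp add: ennreal_mult'[symmetric])
      then show ?thesis
        unfolding E1[OF t measurable_F_M[OF Y]] E1[OF st(1) measurable_F_M[OF Y]] brownian_exp[OF B st Y]
        by (simp add: mult.assoc[symmetric])
    qed
    show "(\<integral>\<^sup>+\<omega>. ennreal ((L s \<omega>)\<^sup>2) * Y \<omega> \<partial>M) \<le> (\<integral>\<^sup>+\<omega>. ennreal ((L t \<omega>)\<^sup>2) * Y \<omega> \<partial>M)"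
      if st: "0 \<le> s" "s \<le> t" and Y: "Y \<in> borel_measurable (F s)" for s t Y
    proof -
      have "1 \<le> exp (\<sigma>\<^sup>2 * (t - s))" using st by simp
      from ennreal_leI[OF this] have "1 \<le> ennreal (exp (\<sigma>\<^sup>2 * (t - s)))" by (simp only: ennreal_1)
      then show ?thesis unfolding E2'[OF st Y] using mult_right_mono[of 1 "ennreal (exp (\<sigma>\<^sup>2 * (t - s)))"] by simp
    qed
    show "(\<integral>\<^sup>+\<omega>. ennreal ((L t \<omega>)\<^sup>2) \<partial>M) < \<infinity>" if t: "0 \<le> t" for t
    proof -
      have B0: "AE \<omega> in M. B 0 \<omega> = 0" using B by (simp add: brownian_motion_def)
      have "(\<integral>\<^sup>+\<omega>. ennreal ((L 0 \<omega>)\<^sup>2) \<partial>M) = (\<integral>\<^sup>+\<omega>. ennreal (c\<^sup>2) \<partial>M)"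
      proof (rule nn_integral_cong_AE)
        show "AE \<omega> in M. ennreal ((L 0 \<omega>)\<^sup>2) = ennreal (c\<^sup>2)" using B0 by eventually_elim (simp add: L_def)
      qed
      also have "\<dots> < \<infinity>" by (simp add: emeasure_space_1)
      finally show ?thesis
        using E2'[OF order_refl t, of "\<lambda>_. 1"] by (simp add: ennreal_mult_less_top)
    qed
  qed
  moreover have "L = (\<lambda>t \<omega>. if \<omega> \<in> space M \<and> continuous_on {0..} (\<lambda>t. B t \<omega>)
    then c * exp (\<sigma> * B t \<omega> - \<sigma>\<^sup>2 * t / 2) else c)"
    by (simp add: L_def \<Omega>_def fun_eq_iff)
  ultimately show ?thesis by simp
qed

end

text \<open>A predictable kernel may have values that are not even sigma-finite, and integrals against it
  need not be measurable; the compensator identity makes this a null set of times.\<close>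

definition finite_part :: "('a \<Rightarrow> real \<Rightarrow> 'e::euclidean_space measure) \<Rightarrow> 'a \<times> real \<Rightarrow> 'e measure" where
  "finite_part \<nu> z = (if emeasure (\<nu> (fst z) (snd z)) UNIV < \<top> then \<nu> (fst z) (snd z) else null_measure borel)"

section \<open>Integrals against predictable kernels\<close>

context stochastic_basis
begin

lemma finite_part_sets:
  "predictable_kernel M F \<nu> \<Longrightarrow> z \<in> space (predictable_sigma M F) \<Longrightarrow> sets (finite_part \<nu> z) = sets borel"
  by (auto simp: finite_part_def predictable_kernel_def)

lemma finite_part_measurable:
  fixes \<nu> :: "'a \<Rightarrow> real \<Rightarrow> 'e::euclidean_space measure"
  assumes \<nu>: "predictable_kernel M F \<nu>" and V: "V \<in> borel_measurable (predictable_sigma M F \<Otimes>\<^sub>M borel)"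
  shows "(\<lambda>z. \<integral>\<^sup>+x. V (z, x) \<partial>finite_part \<nu> z) \<in> borel_measurable (predictable_sigma M F)"
proof (rule finite_kernel_nn_integral_measurable)
  fix A :: "'e set" assume A: "A \<in> sets borel"
  have "(\<lambda>z. emeasure (\<nu> (fst z) (snd z)) A) \<in> borel_measurable (predictable_sigma M F)"
    "(\<lambda>z. emeasure (\<nu> (fst z) (snd z)) UNIV) \<in> borel_measurable (predictable_sigma M F)"
    using \<nu> A by (simp_all add: predictable_kernel_def split_beta')
  then have "(\<lambda>z. if emeasure (\<nu> (fst z) (snd z)) UNIV < \<top> then emeasure (\<nu> (fst z) (snd z)) A else 0)
      \<in> borel_measurable (predictable_sigma M F)" by measurable
  moreover have "emeasure (finite_part \<nu> z) A
      = (if emeasure (\<nu> (fst z) (snd z)) UNIV < \<top> then emeasure (\<nu> (fst z) (snd z)) A else 0)" for z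
    by (simp add: finite_part_def)
  ultimately show "(\<lambda>z. emeasure (finite_part \<nu> z) A) \<in> borel_measurable (predictable_sigma M F)" by simp
qed (use V finite_part_sets[OF \<nu>] in \<open>auto simp: finite_part_def\<close>)

text \<open>The density may turn a finite kernel into an infinite one, so \<open>y\<close> is moved
  into the integrand and only the finite part itself serves as kernel.\<close>

lemma weighted_kernel_measurable:
  fixes \<nu> :: "'a \<Rightarrow> real \<Rightarrow> 'e::euclidean_space measure"
  assumes \<nu>: "predictable_kernel M F \<nu>" and y: "y \<in> borel_measurable (predictable_sigma M F \<Otimes>\<^sub>M borel)"
    and V: "V \<in> borel_measurable (predictable_sigma M F \<Otimes>\<^sub>M borel)"
  shows "(\<lambda>z. \<integral>\<^sup>+x. V (z, x) \<partial>density (finite_part \<nu> z) (\<lambda>x. ennreal (y (z, x)))) \<in> borel_measurable (predictable_sigma M F)"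
proof -
  have "(\<lambda>w. ennreal (y w) * V w) \<in> borel_measurable (predictable_sigma M F \<Otimes>\<^sub>M borel)"
    using y V by measurable
  from finite_part_measurable[OF \<nu> this]
  show ?thesis
  proof (rule measurable_cong[THEN iffD1, rotated])
    fix z assume z: "z \<in> space (predictable_sigma M F)"
    have "(\<lambda>x. ennreal (y (z, x))) \<in> borel_measurable (finite_part \<nu> z)" "(\<lambda>x. V (z, x)) \<in> borel_measurable (finite_part \<nu> z)"
      using measurable_compose[OF measurable_Pair1'[OF z] y] measurable_compose[OF measurable_Pair1'[OF z] V]
        finite_part_sets[OF \<nu> z] by (auto cong: measurable_cong_sets)
    then show "(\<integral>\<^sup>+x. ennreal (y (z, x)) * V (z, x) \<partial>finite_part \<nu> z)
        = (\<integral>\<^sup>+x. V (z, x) \<partial>density (finite_part \<nu> z) (\<lambda>x. ennreal (y (z, x))))"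
      by (simp add: nn_integral_density)
  qed
qed

text \<open>Turns the abstract compensator identity into an iterated integral for product
  integrands, the form in which \<open>p\<close> and \<open>q\<close> appear.
  \<open>\<kappa>\<close> is a version of the kernel with measurable integrals; it has to reproduce
  the compensator on almost every path only.\<close>

lemma compensator_product:
  fixes U :: "nat \<Rightarrow> 'a \<Rightarrow> 'e::euclidean_space" and \<kappa> :: "'a \<times> real \<Rightarrow> 'e measure"
  assumes comp: "compensator M F (mpp_measure T U) N" and mpp: "marked_point_process M F T U"
    and N: "AE \<omega> in M. N \<omega> = kernel_dt (\<lambda>t. \<kappa> (\<omega>, t))"
    and sets: "\<And>z. z \<in> space (predictable_sigma M F) \<Longrightarrow> sets (\<kappa> z) = sets borel"
    and meas: "\<And>V. V \<in> borel_measurable (predictable_sigma M F \<Otimes>\<^sub>M borel) \<Longrightarrow>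
      (\<lambda>z. \<integral>\<^sup>+x. V (z, x) \<partial>\<kappa> z) \<in> borel_measurable (predictable_sigma M F)"
    and H: "H \<in> borel_measurable (predictable_sigma M F)" and f: "f \<in> borel_measurable borel"
  shows "(\<integral>\<^sup>+\<omega>. (\<Sum>i. H (\<omega>, T i \<omega>) * f (U i \<omega>)) \<partial>M)
    = (\<integral>\<^sup>+\<omega>. (\<integral>\<^sup>+u. H (\<omega>, u) * (\<integral>\<^sup>+x. f x \<partial>\<kappa> (\<omega>, u)) * indicator {0..} u \<partial>lborel) \<partial>M)"
proof -
  define V where "V w = H (fst w) * f (snd w)" for w
  have V: "V \<in> borel_measurable (predictable_sigma M F \<Otimes>\<^sub>M borel)"
    unfolding V_def
    by (intro borel_measurable_times_ennreal measurable_compose[OF measurable_fst H] measurable_compose[OF measurable_snd f])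
  have "(\<integral>\<^sup>+\<omega>. (\<Sum>i. H (\<omega>, T i \<omega>) * f (U i \<omega>)) \<partial>M) = (\<integral>\<^sup>+\<omega>. rm_integral (mpp_measure T U) V {0..} \<omega> \<partial>M)"
    by (intro nn_integral_cong) (simp add: rm_integral_mpp_predictable[OF V _ mpp] V_def)
  also have "\<dots> = (\<integral>\<^sup>+\<omega>. rm_integral N V {0..} \<omega> \<partial>M)"
    using comp V unfolding compensator_def by blast
  also have "\<dots> = (\<integral>\<^sup>+\<omega>. (\<integral>\<^sup>+u. H (\<omega>, u) * (\<integral>\<^sup>+x. f x \<partial>\<kappa> (\<omega>, u)) * indicator {0..} u \<partial>lborel) \<partial>M)"
  proof (rule nn_integral_cong_AE)
    show "AE \<omega> in M. rm_integral N V {0..} \<omega>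
        = (\<integral>\<^sup>+u. H (\<omega>, u) * (\<integral>\<^sup>+x. f x \<partial>\<kappa> (\<omega>, u)) * indicator {0..} u \<partial>lborel)"
      using compensator_pos[OF comp mpp] N AE_space
    proof eventually_elim
      case (elim \<omega>)
      have sets': "sets (\<kappa> (\<omega>, t)) = sets borel" if "0 \<le> t" for t
        using that elim(3) by (intro sets) simp
      \<comment> \<open>A function of time and mark alone is a predictable integrand that ignores
        the path, so \<open>meas\<close> applies to it; the section at \<open>\<omega>\<close> gives
        measurability in time.\<close>
      have meas': "(\<lambda>t. (\<integral>\<^sup>+x. v (t, x) \<partial>\<kappa> (\<omega>, t)) * indicator {0..} t) \<in> borel_measurable borel"
        if v: "v \<in> borel_measurable borel" for v
      proof -
        have "(\<lambda>w. (snd (fst w), snd w)) \<in> measurable (predictable_sigma M F \<Otimes>\<^sub>M borel) (borel \<Otimes>\<^sub>M (borel :: 'e measure))"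
          using measurable_compose[OF measurable_fst measurable_snd_predictable] by measurable
        then have "(\<lambda>w. v (snd (fst w), snd w)) \<in> borel_measurable (predictable_sigma M F \<Otimes>\<^sub>M borel)"
          using measurable_compose[OF _ v] by (simp add: borel_prod)
        from predictable_path[OF meas[OF this] elim(3)] show ?thesis by simp
      qed
      have "rm_integral N V {0..} \<omega>
          = (\<integral>\<^sup>+z. (\<lambda>(s, x). V ((\<omega>, s), x) * indicator {0..} s) z \<partial>kernel_dt (\<lambda>t. \<kappa> (\<omega>, t)))"
        unfolding rm_integral_def using elim(2) by simp
      also have "\<dots> = (\<integral>\<^sup>+t. (\<integral>\<^sup>+x. (\<lambda>(s, x). V ((\<omega>, s), x) * indicator {0..} s) (t, x) \<partial>\<kappa> (\<omega>, t)) * indicator {0..} t \<partial>lborel)"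
        using elim(1,2) sets' meas' predictable_section[OF V elim(3), of "{0..}"]
        by (intro nn_integral_kernel_dt) auto
      also have "\<dots> = (\<integral>\<^sup>+u. H (\<omega>, u) * (\<integral>\<^sup>+x. f x \<partial>\<kappa> (\<omega>, u)) * indicator {0..} u \<partial>lborel)"
      proof (rule nn_integral_cong)
        fix t :: real
        show "(\<integral>\<^sup>+x. (\<lambda>(s, x). V ((\<omega>, s), x) * indicator {0..} s) (t, x) \<partial>\<kappa> (\<omega>, t)) * indicator {0..} t
            = H (\<omega>, t) * (\<integral>\<^sup>+x. f x \<partial>\<kappa> (\<omega>, t)) * indicator {0..} t"
        proof (cases "0 \<le> t")
          case True
          then have "f \<in> borel_measurable (\<kappa> (\<omega>, t))" using f sets'[OF True] by (simp cong: measurable_cong_sets)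
          with True show ?thesis by (simp add: V_def nn_integral_cmult)
        qed simp
      qed
      finally show ?case .
    qed
  qed
  finally show ?thesis .
qed

end

section \<open>Change to an equivalent measure\<close>

lemma null_sets_equivalent: "equivalent_prob P P' \<Longrightarrow> null_sets P' = null_sets P"
  by (auto simp: equivalent_prob_def absolutely_continuous_def)

lemma AE_equivalent: "equivalent_prob P P' \<Longrightarrow> (AE \<omega> in P. Q \<omega>) \<Longrightarrow> (AE \<omega> in P'. Q \<omega>)"
  unfolding equivalent_prob_def using absolutely_continuous_AE[of P' P Q] by auto

lemma usual_filtration_equivalent:
  assumes eq: "equivalent_prob P P'" and usual: "usual_filtration P F"
  shows "usual_filtration P' F"
proof -
  have sets: "sets P = sets P'" and sp: "space P = space P'"
    using eq sets_eq_imp_space_eq[of P P'] by (auto simp: equivalent_prob_def)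
  have "complete_measure P" using usual unfolding usual_filtration_def by (elim conjE)
  then have "complete_measure P'"
    using sets null_sets_equivalent[OF eq] unfolding complete_measure_def by simp
  moreover have "filtration (space P) F" "\<forall>t. subalgebra P (F t)" "\<forall>t<0. sets (F t) = sets (F 0)"
    "null_sets P \<subseteq> sets (F 0)" "\<forall>t\<ge>0. sets (F t) = (\<Inter>s\<in>{t<..}. sets (F s))"
    using usual unfolding usual_filtration_def by - (elim conjE, assumption)+
  moreover have "\<forall>t. subalgebra P' (F t)"
    using \<open>\<forall>t. subalgebra P (F t)\<close> unfolding subalgebra_def sets sp .
  ultimately show ?thesis
    unfolding usual_filtration_def null_sets_equivalent[OF eq] sp[symmetric] by (intro conjI)
qed

section \<open>Shot noise along a path\<close>

context jump_times
begin

text \<open>For \<open>s\<close> up to \<open>t\<close> only the finitely many jumps up to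
  \<open>t\<close> contribute, each with a shifted copy of \<open>g\<close> that the indicator of
  \<open>{0..t - T i}\<close> switches on at \<open>T i\<close>.\<close>

lemma shot_noise_integrable:
  fixes g :: "real \<Rightarrow> 'e \<Rightarrow> real"
  assumes g: "\<And>x. locally_integrable (\<lambda>s. g s x)"
  shows "locally_integrable (\<lambda>s. \<Sum>i | T i \<le> s. g (s - T i) (U i))"
  unfolding locally_integrable_def set_integrable_def
proof (intro allI impI)
  fix t :: real assume "0 \<le> t"
  have "integrable lborel (\<lambda>s. indicator {0..t - T i} (- T i + 1 * s) *\<^sub>R g (- T i + 1 * s) (U i))" if "T i \<le> t" for i
    using g[of "U i"] that unfolding locally_integrable_def set_integrable_def
    by (intro lborel_integrable_real_affine) auto
  then have "integrable lborel (\<lambda>s. \<Sum>i | T i \<le> t. indicator {0..t - T i} (- T i + 1 * s) *\<^sub>R g (- T i + 1 * s) (U i))"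
    by (intro Bochner_Integration.integrable_sum) auto
  moreover have "(\<Sum>i | T i \<le> t. indicator {0..t - T i} (- T i + 1 * s) *\<^sub>R g (- T i + 1 * s) (U i))
      = indicator {0..t} s *\<^sub>R (\<Sum>i | T i \<le> s. g (s - T i) (U i))" for s
  proof (cases "0 \<le> s \<and> s \<le> t")
    case True
    then have "(\<Sum>i | T i \<le> t. indicator {0..t - T i} (- T i + 1 * s) *\<^sub>R g (- T i + 1 * s) (U i))
        = (\<Sum>i | T i \<le> s. g (s - T i) (U i))"
      using finite_jumps(1)[of t] by (intro sum.mono_neutral_cong_right) (auto simp: indicator_def)
    then show ?thesis using True by simp
  next
    case False
    have "(\<Sum>i | T i \<le> t. indicator {0..t - T i} (- T i + 1 * s) *\<^sub>R g (- T i + 1 * s) (U i)) = 0"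
    proof (intro sum.neutral ballI)
      fix i
      have "- T i + 1 * s \<notin> {0..t - T i}" using False T_pos[of i] by auto
      then have "indicator {0..t - T i} (- T i + 1 * s) = (0::real)" by (rule indicator_simps(2))
      then show "indicator {0..t - T i} (- T i + 1 * s) *\<^sub>R g (- T i + 1 * s) (U i) = 0"
        by (simp only: scaleR_zero_left)
    qed
    then show ?thesis using False by (auto simp: indicator_def)
  qed
  ultimately show "integrable lborel (\<lambda>s. indicator {0..t} s *\<^sub>R (\<Sum>i | T i \<le> s. g (s - T i) (U i)))" by simp
qed

end

text \<open>An integral against the point measure is a sum over its points, here one with finite
  support. Since \<open>g\<close> is measurable on non-negative times, the integrand is cut off to
  \<open>0 \<le> s \<le> t\<close> before it is transported along \<open>distr\<close>.\<close>

lemma shot_noise_eq_integral: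
  fixes g :: "real \<Rightarrow> 'e::euclidean_space \<Rightarrow> real"
  assumes g: "(\<lambda>(t, x). g t x) \<in> borel_measurable (restrict_space borel ({0..} \<times> UNIV))"
    and T: "jump_times (\<lambda>i. T i \<omega>)" and t: "0 \<le> t"
  shows "(LINT (s, x):({0..t} \<times> UNIV)|mpp_measure T U \<omega>. g (t - s) x) = (\<Sum>i | T i \<omega> \<le> t. g (t - T i \<omega>) (U i \<omega>))"
proof -
  interpret jump_times "\<lambda>i. T i \<omega>" by (rule T)
  have "{0..} \<times> UNIV \<in> sets (borel :: (real \<times> 'e) measure)" by (simp add: borel_prod[symmetric])
  then have m1: "(\<lambda>z. indicator ({0..} \<times> UNIV) z *\<^sub>R g (fst z) (snd z)) \<in> borel_measurable borel"
    using g by (subst (asm) borel_measurable_restrict_space_iff) (auto simp: split_beta')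
  have "(\<lambda>z. (t - fst z, snd z)) \<in> measurable borel (borel :: (real \<times> 'e) measure)"
    unfolding borel_prod[symmetric] by measurable
  from measurable_compose[OF this m1] have "(\<lambda>z. indicator ({0..} \<times> UNIV) (t - fst z, snd z) *\<^sub>R g (t - fst z) (snd z)) \<in> borel_measurable borel"
    by (simp only: fst_conv snd_conv)
  moreover have "(\<lambda>z. indicator {0..} (fst z) :: real) \<in> borel_measurable (borel :: (real \<times> 'e) measure)"
    unfolding borel_prod[symmetric] by (rule measurable_compose[OF measurable_fst]) simp
  ultimately have "(\<lambda>z. indicator {0..} (fst z) * (indicator ({0..} \<times> UNIV) (t - fst z, snd z) *\<^sub>R g (t - fst z) (snd z))) \<in> borel_measurable borel"
    by (intro borel_measurable_times)
  moreover have "(\<lambda>z. indicator {0..} (fst z) * (indicator ({0..} \<times> UNIV) (t - fst z, snd z) *\<^sub>R g (t - fst z) (snd z)))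
      = (\<lambda>z. indicator ({0..t} \<times> UNIV) z *\<^sub>R (case z of (s, x) \<Rightarrow> g (t - s) x))"
    by (auto simp: indicator_def fun_eq_iff)
  ultimately have m: "(\<lambda>z. indicator ({0..t} \<times> UNIV) z *\<^sub>R (case z of (s, x) \<Rightarrow> g (t - s) x)) \<in> borel_measurable borel"
    by simp
  have "(LINT (s, x):({0..t} \<times> UNIV)|mpp_measure T U \<omega>. g (t - s) x)
      = (LINT i|count_space UNIV. indicator {0..t} (T i \<omega>) * g (t - T i \<omega>) (U i \<omega>))"
    unfolding set_lebesgue_integral_def mpp_measure_def
    by (subst integral_distr[OF _ m]) (auto simp: indicator_def intro!: Bochner_Integration.integral_cong)
  also have "\<dots> = (\<Sum>i\<in>{i. T i \<omega> \<le> t}. indicator {0..t} (T i \<omega>) * g (t - T i \<omega>) (U i \<omega>))"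
  proof -
    let ?f = "\<lambda>i. indicator {0..t} (T i \<omega>) * g (t - T i \<omega>) (U i \<omega>)"
    have sub: "{i. ?f i \<noteq> 0} \<subseteq> {i. T i \<omega> \<le> t}" by (auto simp: indicator_def)
    then have "finite {i. ?f i \<noteq> 0}" by (rule finite_subset[OF _ finite_jumps(1)])
    then have "(LINT i|count_space UNIV. ?f i) = (\<Sum>i | ?f i \<noteq> 0. ?f i)"
      by (subst lebesgue_integral_count_space_finite_support) auto
    also have "\<dots> = (\<Sum>i\<in>{i. T i \<omega> \<le> t}. ?f i)"
      using sub by (intro sum.mono_neutral_left finite_jumps) auto
    finally show ?thesis .
  qed
  also have "\<dots> = (\<Sum>i | T i \<omega> \<le> t. g (t - T i \<omega>) (U i \<omega>))"
    using T_pos by (intro sum.cong) (auto simp: indicator_def less_imp_le)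
  finally show ?thesis .
qed


section \<open>The drift condition\<close>

lemma locally_integrable_const: "locally_integrable (\<lambda>s. c)"
proof -
  have "integrable lborel (indicator {0..t} :: real \<Rightarrow> real)" for t :: real
    by (rule integrable_real_indicator) (simp_all add: emeasure_lborel_Icc_eq)
  then show ?thesis by (simp add: locally_integrable_def set_integrable_def)
qed

lemma locally_integrable_nn_finite:
  assumes "locally_integrable f" "0 \<le> t"
  shows "(\<integral>\<^sup>+u. ennreal (f u) * indicator {0..t} u \<partial>lborel) < \<top>"
proof -
  have "integrable lborel (\<lambda>u. indicator {0..t} u *\<^sub>R f u)"
    using assms by (simp add: locally_integrable_def set_integrable_def)
  then have "(\<integral>\<^sup>+u. ennreal (norm (indicator {0..t} u *\<^sub>R f u)) \<partial>lborel) < \<top>"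
    by (simp add: integrable_iff_bounded)
  moreover have "(\<integral>\<^sup>+u. ennreal (f u) * indicator {0..t} u \<partial>lborel)
      \<le> (\<integral>\<^sup>+u. ennreal (norm (indicator {0..t} u *\<^sub>R f u)) \<partial>lborel)"
    by (intro nn_integral_mono) (auto simp: indicator_def intro!: ennreal_leI)
  ultimately show ?thesis by (rule le_less_trans[rotated])
qed

lemma integral_exp_minus_one:
  assumes "integrable N (\<lambda>x. exp (a x) - 1 :: real)"
  shows "(LINT x|N. exp (a x) - 1) = enn2real (\<integral>\<^sup>+x. ennreal (exp (a x) - 1) \<partial>N) - enn2real (\<integral>\<^sup>+x. ennreal (1 - exp (a x)) \<partial>N)"
    and "(\<integral>\<^sup>+x. ennreal (exp (a x) - 1) \<partial>N) < \<top>"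
proof -
  show "(LINT x|N. exp (a x) - 1) = enn2real (\<integral>\<^sup>+x. ennreal (exp (a x) - 1) \<partial>N) - enn2real (\<integral>\<^sup>+x. ennreal (1 - exp (a x)) \<partial>N)"
    using real_lebesgue_integral_def[OF assms] by simp
  have "(\<integral>\<^sup>+x. ennreal (exp (a x) - 1) \<partial>N) \<le> (\<integral>\<^sup>+x. ennreal (norm (exp (a x) - 1)) \<partial>N)"
    by (intro nn_integral_mono ennreal_leI) simp
  also have "\<dots> < \<top>" using assms by (simp add: integrable_iff_bounded)
  finally show "(\<integral>\<^sup>+x. ennreal (exp (a x) - 1) \<partial>N) < \<top>" .
qed

lemma kernel_dt_cong_AE:
  assumes "AE t in lborel. 0 \<le> t \<longrightarrow> k t = k' t"
  shows "kernel_dt k = kernel_dt k'"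
proof -
  have "(\<integral>\<^sup>+t. emeasure (k t) (Pair t -` B) * indicator {0..} t \<partial>lborel)
      = (\<integral>\<^sup>+t. emeasure (k' t) (Pair t -` B) * indicator {0..} t \<partial>lborel)" for B
  proof (rule nn_integral_cong_AE)
    show "AE t in lborel. emeasure (k t) (Pair t -` B) * indicator {0..} t = emeasure (k' t) (Pair t -` B) * indicator {0..} t"
      using assms by eventually_elim (auto simp: indicator_def)
  qed
  then show ?thesis by (simp add: kernel_dt_def)
qed

text \<open>The jump times tend to infinity, so every bounded time interval ends before one of
  them.\<close>

lemma (in jump_times) finite_up_to_jumps:
  assumes "\<And>n. (\<integral>\<^sup>+t. f t * indicator {0..T n} t \<partial>lborel) < \<infinity>"
  shows "(\<integral>\<^sup>+t. f t * indicator {0..c} t \<partial>lborel) < \<top>"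
proof -
  from T_lim obtain n where "c \<le> T n"
    unfolding filterlim_at_top eventually_sequentially by blast
  then have "(\<integral>\<^sup>+t. f t * indicator {0..c} t \<partial>lborel) \<le> (\<integral>\<^sup>+t. f t * indicator {0..T n} t \<partial>lborel)"
    by (intro nn_integral_mono) (auto simp: indicator_def)
  also have "\<dots> < \<top>" using assms[of n] by simp
  finally show ?thesis .
qed

text \<open>Fubini for null sets. Conditions that hold almost everywhere on the product become
  statements about almost every path, the form to which equivalence of \<open>P\<close> and
  \<open>P'\<close> applies.\<close>

lemma AE_path:
  assumes "prob_space M" "AE (\<omega>, t) in M \<Otimes>\<^sub>M restrict_space lborel {0..}. Q \<omega> t"
  shows "AE \<omega> in M. AE t in lborel. 0 \<le> t \<longrightarrow> Q \<omega> (t :: real)"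
proof -
  interpret M: prob_space M by (rule assms(1))
  interpret R: sigma_finite_measure "restrict_space lborel {0::real..}"
    by (rule sigma_finite_measure_restrict_space) (simp_all add: lborel.sigma_finite_measure_axioms)
  interpret pair_sigma_finite M "restrict_space lborel {0::real..}" ..
  have "AE \<omega> in M. AE t in restrict_space lborel {0..}. Q \<omega> t"
    using AE_pair[OF assms(2)] by simp
  then show ?thesis by (simp add: AE_restrict_space_iff)
qed

theorem theorem3p7:
  fixes P P' H :: "'a measure" and F :: "real \<Rightarrow> 'a measure"
    and T :: "nat \<Rightarrow> 'a \<Rightarrow> real" and U :: "nat \<Rightarrow> 'a \<Rightarrow> real ^ 'd"
    and W \<xi> r :: "real \<Rightarrow> 'a \<Rightarrow> real"
    and \<mu> :: "'a \<Rightarrow> (real \<times> (real ^ 'd)) measure"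
    and \<nu> \<nu>' :: "'a \<Rightarrow> real \<Rightarrow> (real ^ 'd) measure"
    and Y :: "'a \<Rightarrow> real \<Rightarrow> real ^ 'd \<Rightarrow> real"
    and G g :: "real \<Rightarrow> real ^ 'd \<Rightarrow> real"
    and X\<^sub>0 m \<sigma> :: real
  defines "\<mu> \<equiv> mpp_measure T U"
    and "\<nu>' \<equiv> (\<lambda>\<omega> t. density (\<nu> \<omega> t) (\<lambda>x. ennreal (Y \<omega> t x)))"
  assumes prob: "prob_space P"
    and usual: "usual_filtration P F"
    and terminal: "sets P = sigma_sets (space P) (\<Union>t\<in>{0..}. sets (F t))"
    and initial: "subalgebra P H"
    and generated: "smallest_filtration P F \<mu> W H"
    and mpp: "marked_point_process P F T U"
    and \<nu>_kernel: "predictable_kernel P F \<nu>"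
    and \<nu>_compensator: "compensator P F \<mu> (\<lambda>\<omega>. kernel_dt (\<nu> \<omega>))"
    and W_brownian: "brownian_motion P F W"
    and W_indep: "independent_of_mpp P W T U"
    and \<sigma>_pos: "\<sigma> > 0" and X0_pos: "X\<^sub>0 > 0"
    and g_measurable: "(\<lambda>(t, x). g t x) \<in> borel_measurable (restrict_space borel ({0..} \<times> UNIV))"
    and G_measurable: "(\<lambda>(t, x). G t x) \<in> borel_measurable (restrict_space borel ({0..} \<times> UNIV))"
    and g_integrable: "\<And>x. locally_integrable (\<lambda>s. g s x)"
    and G_eq: "\<And>t x. t \<ge> 0 \<Longrightarrow> G t x = G 0 x + (LINT s:{0..t}|lborel. g s x)"
    and r_progressive: "progressive F r"
    and r_integrable: "AE \<omega> in P. locally_integrable (\<lambda>s. r s \<omega>)"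
    and equivalent: "equivalent_prob P P'"
    and Y_measurable:
      "(\<lambda>((\<omega>, t), x). Y \<omega> t x) \<in> borel_measurable (predictable_sigma P F \<Otimes>\<^sub>M borel)"
    and Y_nonneg: "\<And>\<omega> t x. \<omega> \<in> space P \<Longrightarrow> t \<ge> 0 \<Longrightarrow> Y \<omega> t x \<ge> 0"
    and \<nu>'_compensator: "compensator P' F \<mu> (\<lambda>\<omega>. kernel_dt (\<nu>' \<omega>))"
    and \<xi>_measurable:
      "(\<lambda>(\<omega>, t). \<xi> t \<omega>) \<in> borel_measurable (P \<Otimes>\<^sub>M restrict_space borel {0..})"
    and \<xi>_integrable: "AE \<omega> in P. locally_integrable (\<lambda>s. \<xi> s \<omega>)"
    and W'_brownian: "brownian_motion P' F (\<lambda>t \<omega>. W t \<omega> + (LINT s:{0..t}|lborel. \<xi> s \<omega>))"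
    and jump_integrable: "AE (\<omega>, t) in P \<Otimes>\<^sub>M restrict_space lborel {0..}.
      integrable (\<nu>' \<omega> t) (\<lambda>x. exp (G 0 x) - 1)"
    and rate: "AE (\<omega>, t) in P \<Otimes>\<^sub>M restrict_space lborel {0..}.
      r t \<omega> = m - \<sigma> * \<xi> t \<omega>
        + (LINT (s, x):({0..t} \<times> UNIV)|\<mu> \<omega>. g (t - s) x)
        + (LINT x|\<nu>' \<omega> t. exp (G 0 x) - 1)"
  shows "local_martingale_measure P' F r (stock_price X\<^sub>0 m \<sigma> G g W T U)"
proof -
  \<comment> \<open>A version of \<open>\<nu>'\<close> whose integrals are measurable in path and
    time: infinite values of \<open>\<nu>\<close> are replaced by the null measure before the
    density is applied.\<close>
  let ?k = "\<lambda>z. density (finite_part \<nu> z) (\<lambda>x. ennreal (Y (fst z) (snd z) x))"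
  let ?p = "\<lambda>z. \<integral>\<^sup>+x. ennreal (exp (G 0 x) - 1) \<partial>?k z"
  let ?q = "\<lambda>z. \<integral>\<^sup>+x. ennreal (1 - exp (G 0 x)) \<partial>?k z"
  let ?B = "\<lambda>t \<omega>. W t \<omega> + (LINT s:{0..t}|lborel. \<xi> s \<omega>)"
  have prob': "prob_space P'" and sets': "sets P' = sets P"
    using equivalent by (simp_all add: equivalent_prob_def)
  have sp': "space P' = space P" by (rule sets_eq_imp_space_eq[OF sets'])
  interpret P: prob_space P by (rule prob)
  interpret P': prob_space P' by (rule prob')
  interpret P: stochastic_basis P F by unfold_locales (rule usual)
  interpret P': stochastic_basis P' F
    by unfold_locales (rule usual_filtration_equivalent[OF equivalent usual])
  note AE' = AE_equivalent[OF equivalent]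
  \<comment> \<open>Both sigma-fields depend on the measure through its space alone, so predictable
    and optional mean the same under \<open>P\<close> and \<open>P'\<close>.\<close>
  have pred: "predictable_sigma P' F = predictable_sigma P F"
    unfolding predictable_sigma_def sp' ..
  have optional: "optional_sigma P' F = optional_sigma P F"
    unfolding optional_sigma_def sp' ..
  have mpp': "marked_point_process P' F T U"
    using mpp AE' sets' unfolding marked_point_process_def sp' by (auto cong: measurable_cong_sets)
  have opt: "optional_random_measure P' F (mpp_measure T U)"
    using generated unfolding smallest_filtration_def Let_def optional_random_measure_def random_measure_def
      optional sp' \<mu>_def by blast
  have kernel': "predictable_kernel P' F \<nu>"
    using \<nu>_kernel unfolding predictable_kernel_def pred sp' .
  have y: "(\<lambda>(z, x). Y (fst z) (snd z) x) \<in> borel_measurable (predictable_sigma P' F \<Otimes>\<^sub>M borel)"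
    using Y_measurable unfolding pred by (simp add: split_beta')
  have k_sets: "sets (?k z) = sets borel" if "z \<in> space (predictable_sigma P' F)" for z
    using P'.finite_part_sets[OF kernel' that] by simp
  have k_meas: "(\<lambda>z. \<integral>\<^sup>+x. V (z, x) \<partial>?k z) \<in> borel_measurable (predictable_sigma P' F)"
    if "V \<in> borel_measurable (predictable_sigma P' F \<Otimes>\<^sub>M borel)" for V
    using P'.weighted_kernel_measurable[OF kernel' y that] by simp
  have G0: "G 0 \<in> borel_measurable borel"
  proof -
    have "(\<lambda>x :: real ^ 'd. (0::real, x)) \<in> measurable borel (restrict_space borel ({0..} \<times> UNIV))"
    proof (rule measurable_restrict_space2)
      show "(\<lambda>x :: real ^ 'd. (0::real, x)) \<in> measurable borel (borel :: (real \<times> (real ^ 'd)) measure)"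
        by (rule borel_measurable_Pair) simp_all
    qed simp
    from measurable_compose[OF this G_measurable] show ?thesis by simp
  qed
  have f_meas: "(\<lambda>w. f (snd w)) \<in> borel_measurable (predictable_sigma P' F \<Otimes>\<^sub>M borel)"
    if "f \<in> borel_measurable borel" for f :: "real ^ 'd \<Rightarrow> ennreal"
    by (rule measurable_compose[OF measurable_snd that])
  have fp: "(\<lambda>x. ennreal (exp (G 0 x) - 1)) \<in> borel_measurable borel"
    and fq: "(\<lambda>x. ennreal (1 - exp (G 0 x))) \<in> borel_measurable borel"
    using G0 by measurable
  have p: "?p \<in> borel_measurable (predictable_sigma P' F)" using k_meas[OF f_meas[OF fp]] by simp
  have q: "?q \<in> borel_measurable (predictable_sigma P' F)" using k_meas[OF f_meas[OF fq]] by simp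

  \<comment> \<open>Finiteness of the kernels along almost every path\<close>
  have lim: "AE \<omega> in P'. jump_times (\<lambda>i. T i \<omega>)"
    using marked_point_process_facts(4)[OF mpp'] AE_space
    by eventually_elim (use marked_point_process_facts(2,3)[OF mpp'] in \<open>unfold_locales, auto\<close>)
  \<comment> \<open>Finite mass of \<open>\<nu>\<close> is obtained under \<open>P\<close>, whose
    compensator it gives, and carried over by equivalence; finite mass of \<open>?k\<close> follows
    separately from the compensator under \<open>P'\<close>.\<close>
  have "AE \<omega> in P. \<forall>n. (\<integral>\<^sup>+t. emeasure (\<nu> \<omega> t) UNIV * indicator {0..T n \<omega>} t \<partial>lborel) < \<infinity>"
    by (rule P.compensator_kernel[OF \<nu>_compensator[unfolded \<mu>_def] mpp]) simp
  from AE'[OF this] lim AE_space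
  have finite_part: "AE \<omega> in P'. AE t in lborel. 0 \<le> t \<longrightarrow> ?k (\<omega>, t) = \<nu>' \<omega> t"
  proof eventually_elim
    case (elim \<omega>)
    interpret jump_times "\<lambda>i. T i \<omega>" by (rule elim(2))
    have "(\<lambda>z. emeasure (\<nu> (fst z) (snd z)) UNIV) \<in> borel_measurable (predictable_sigma P' F)"
      using kernel' by (simp add: predictable_kernel_def split_beta')
    from P'.predictable_path[OF this elim(3)]
    have "(\<lambda>t. emeasure (\<nu> \<omega> t) UNIV * indicator {0..} t) \<in> borel_measurable borel" by simp
    from locally_integrable_enn2real(2)[OF this finite_up_to_jumps] elim(1)
    have "AE t in lborel. 0 \<le> t \<longrightarrow> emeasure (\<nu> \<omega> t) UNIV < \<top>" by simp
    then show ?case by eventually_elim (simp add: finite_part_def \<nu>'_def)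
  qed
  \<comment> \<open>\<open>kernel_dt\<close> integrates over time, so agreement at almost every time
    is enough; from here on \<open>?k\<close> stands for \<open>\<nu>'\<close>.\<close>
  have N: "AE \<omega> in P'. kernel_dt (\<nu>' \<omega>) = kernel_dt (\<lambda>t. ?k (\<omega>, t))"
    using finite_part by eventually_elim (auto intro!: kernel_dt_cong_AE elim: eventually_mono)
  have comp: "(\<integral>\<^sup>+\<omega>. (\<Sum>i. H (\<omega>, T i \<omega>) * f (U i \<omega>)) \<partial>P')
      = (\<integral>\<^sup>+\<omega>. (\<integral>\<^sup>+u. H (\<omega>, u) * (\<integral>\<^sup>+x. f x \<partial>?k (\<omega>, u)) * indicator {0..} u \<partial>lborel) \<partial>P')"
    if "H \<in> borel_measurable (predictable_sigma P' F)" "f \<in> borel_measurable borel" for H f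
    by (rule P'.compensator_product[OF \<nu>'_compensator[unfolded \<mu>_def] mpp' N k_sets k_meas that])
  have k_finite: "AE \<omega> in P'. \<forall>n. (\<integral>\<^sup>+t. emeasure (?k (\<omega>, t)) UNIV * indicator {0..T n \<omega>} t \<partial>lborel) < \<infinity>"
    by (rule P'.compensator_kernel[OF \<nu>'_compensator[unfolded \<mu>_def] mpp' N])

  \<comment> \<open>The drift condition along almost every path\<close>
  define h where "h \<omega> t = enn2real (?p (\<omega>, t)) - enn2real (?q (\<omega>, t))" for \<omega> t
  define \<Gamma> where "\<Gamma> \<omega> s = (\<Sum>i | T i \<omega> \<le> s. g (s - T i \<omega>) (U i \<omega>))" for \<omega> s
  have drift: "AE \<omega> in P'. AE t in lborel. 0 \<le> t \<longrightarrow>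
      ?p (\<omega>, t) < \<top> \<and> r t \<omega> = m - \<sigma> * \<xi> t \<omega> + \<Gamma> \<omega> t + h \<omega> t"
    using AE'[OF AE_path[OF prob jump_integrable]] AE'[OF AE_path[OF prob rate]] finite_part lim
  proof eventually_elim
    case (elim \<omega>)
    from elim(1-3) show ?case
    proof eventually_elim
      case (elim t)
      show ?case
      proof
        assume t: "0 \<le> t"
        with elim have *: "integrable (?k (\<omega>, t)) (\<lambda>x. exp (G 0 x) - 1)" by simp
        have "r t \<omega> = m - \<sigma> * \<xi> t \<omega> + \<Gamma> \<omega> t + (LINT x|?k (\<omega>, t). exp (G 0 x) - 1)"
          using elim t shot_noise_eq_integral[where T = T and U = U and \<omega> = \<omega> and g = g,
              OF g_measurable \<open>jump_times (\<lambda>i. T i \<omega>)\<close> t]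
          by (simp add: \<Gamma>_def \<mu>_def)
        then show "?p (\<omega>, t) < \<top> \<and> r t \<omega> = m - \<sigma> * \<xi> t \<omega> + \<Gamma> \<omega> t + h \<omega> t"
          using integral_exp_minus_one[OF *] by (simp add: h_def)
      qed
    qed
  qed
  have \<Gamma>_int: "AE \<omega> in P'. locally_integrable (\<Gamma> \<omega>)"
    using lim unfolding \<Gamma>_def by eventually_elim (rule jump_times.shot_noise_integrable[OF _ g_integrable])
  define \<Omega> where "\<Omega> = {\<omega> \<in> space P'. jump_times (\<lambda>i. T i \<omega>) \<and>
      (\<forall>t\<ge>0. (\<integral>\<^sup>+u. (?p (\<omega>, u) + ?q (\<omega>, u)) * indicator {0..t} u \<partial>lborel) < \<top>)}"
  have "AE \<omega> in P'. \<forall>t\<ge>0. (\<integral>\<^sup>+u. (?p (\<omega>, u) + ?q (\<omega>, u)) * indicator {0..t} u \<partial>lborel) < \<top>"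
    using AE'[OF r_integrable] AE'[OF \<xi>_integrable] \<Gamma>_int drift k_finite lim AE_space
  proof eventually_elim
    case (elim \<omega>)
    interpret jump_times "\<lambda>i. T i \<omega>" by (rule elim(6))
    have qm: "(\<lambda>u. ?q (\<omega>, u) * indicator {0..} u) \<in> borel_measurable borel"
      by (rule P'.predictable_path[OF q elim(7)])
    have pm: "(\<lambda>u. ?p (\<omega>, u) * indicator {0..} u) \<in> borel_measurable borel"
      by (rule P'.predictable_path[OF p elim(7)])
    have q_fin: "(\<integral>\<^sup>+u. ?q (\<omega>, u) * indicator {0..t} u \<partial>lborel) < \<top>" for t
    proof -
      have "(\<integral>\<^sup>+u. ?q (\<omega>, u) * indicator {0..t} u \<partial>lborel) \<le> (\<integral>\<^sup>+u. emeasure (?k (\<omega>, u)) UNIV * indicator {0..t} u \<partial>lborel)"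
      proof (intro nn_integral_mono)
        fix u :: real
        show "?q (\<omega>, u) * indicator {0..t} u \<le> emeasure (?k (\<omega>, u)) UNIV * indicator {0..t} u"
        proof (cases "0 \<le> u")
          case True
          then have "space (?k (\<omega>, u)) = UNIV"
            using sets_eq_imp_space_eq[OF k_sets[of "(\<omega>, u)"]] elim(7) by simp
          moreover have "?q (\<omega>, u) \<le> (\<integral>\<^sup>+x. 1 \<partial>?k (\<omega>, u))"
            by (intro nn_integral_mono) (simp add: ennreal_le_1)
          ultimately show ?thesis by (intro mult_right_mono) auto
        qed simp
      qed
      also have "\<dots> < \<top>" using elim(5) by (intro finite_up_to_jumps) blast
      finally show ?thesis .
    qed
    have q_int: "locally_integrable (\<lambda>u. enn2real (?q (\<omega>, u)))"
      by (rule locally_integrable_enn2real(1)[OF qm q_fin])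
    show ?case
    proof (intro allI impI)
      fix t :: real assume t: "0 \<le> t"
      \<comment> \<open>The drift condition solved for the positive part: \<open>b\<close> contains
        only terms already known to be locally integrable, and at almost every non-negative time it
        equals the real value of \<open>?p\<close>.\<close>
      define b where "b u = r u \<omega> - m + \<sigma> * \<xi> u \<omega> - \<Gamma> \<omega> u + enn2real (?q (\<omega>, u))" for u
      have "locally_integrable b"
        using elim(1-3) q_int locally_integrable_const[of m] unfolding locally_integrable_def b_def
        by (auto intro!: set_integral_add(1) set_integral_diff(1) set_integrable_mult_right)
      from locally_integrable_nn_finite[OF this t]
      have "(\<integral>\<^sup>+u. ennreal (b u) * indicator {0..t} u \<partial>lborel) < \<top>" .
      moreover have "(\<integral>\<^sup>+u. ?p (\<omega>, u) * indicator {0..t} u \<partial>lborel) = (\<integral>\<^sup>+u. ennreal (b u) * indicator {0..t} u \<partial>lborel)"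
      proof (rule nn_integral_cong_AE)
        show "AE u in lborel. ?p (\<omega>, u) * indicator {0..t} u = ennreal (b u) * indicator {0..t} u"
          using elim(4)
        proof eventually_elim
          case (elim u)
          show ?case
          proof (cases "0 \<le> u")
            case True
            with elim have "?p (\<omega>, u) < \<top>" "enn2real (?p (\<omega>, u)) = b u"
              by (auto simp: b_def h_def)
            then have "?p (\<omega>, u) = ennreal (b u)" by (metis ennreal_enn2real)
            then show ?thesis by simp
          qed simp
        qed
      qed
      moreover have "(\<integral>\<^sup>+u. (?p (\<omega>, u) + ?q (\<omega>, u)) * indicator {0..t} u \<partial>lborel)
          = (\<integral>\<^sup>+u. ?p (\<omega>, u) * indicator {0..t} u \<partial>lborel) + (\<integral>\<^sup>+u. ?q (\<omega>, u) * indicator {0..t} u \<partial>lborel)"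
      proof -
        have *: "(\<lambda>u. f u * indicator {0..t} u) \<in> borel_measurable lborel"
          if "(\<lambda>u. f u * indicator {0..} u) \<in> borel_measurable borel" for f :: "real \<Rightarrow> ennreal"
        proof -
          have "(\<lambda>u. (f u * indicator {0..} u) * indicator {..t} u) \<in> borel_measurable lborel"
            using that by measurable
          then show ?thesis by (rule measurable_cong[THEN iffD1, rotated]) (auto simp: indicator_def)
        qed
        show ?thesis unfolding distrib_right by (rule nn_integral_add[OF *[OF pm] *[OF qm]])
      qed
      ultimately show "(\<integral>\<^sup>+u. (?p (\<omega>, u) + ?q (\<omega>, u)) * indicator {0..t} u \<partial>lborel) < \<top>"
        using q_fin by simp
    qed
  qed
  with lim AE_space have \<Omega>_AE: "AE \<omega> in P'. \<omega> \<in> \<Omega>"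
    by eventually_elim (simp only: \<Omega>_def mem_Collect_eq simp_thms)

  \<comment> \<open>The discounted price as a product\<close>
  define L where "L t \<omega> = (if \<omega> \<in> space P' \<and> continuous_on {0..} (\<lambda>t. ?B t \<omega>)
    then X\<^sub>0 * exp (\<sigma> * ?B t \<omega> - \<sigma>\<^sup>2 * t / 2) else X\<^sub>0)" for t \<omega>
  \<comment> \<open>The initial price is carried by \<open>L\<close>, so that \<open>S\<close>
    starts at one.\<close>
  have "square_integrable_martingale P' F L"
    unfolding L_def by (rule P'.exponential_martingale[OF W'_brownian X0_pos])
  then interpret L: square_integrable_martingale P' F L .
  interpret J: jump_price P' F L T U "G 0" ?p ?q \<Omega>
  proof unfold_locales
    show "filterlim (\<lambda>i. T i \<omega>) at_top sequentially" if "\<omega> \<in> \<Omega>" for \<omega>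
      using that by (simp add: \<Omega>_def jump_times_def)
    show "(\<integral>\<^sup>+u. (?p (\<omega>, u) + ?q (\<omega>, u)) * indicator {0..t} u \<partial>lborel) < \<top>" if "\<omega> \<in> \<Omega>" "0 \<le> t" for \<omega> t
      using that unfolding \<Omega>_def by blast
    show "\<Omega> \<subseteq> space P'" unfolding \<Omega>_def by blast
  qed (fact mpp' opt G0 p q \<Omega>_AE | erule comp[OF _ fp] | erule comp[OF _ fq])+
  have Jh: "J.h \<omega> = h \<omega>" for \<omega> by (simp add: J.h_def h_def fun_eq_iff)
  \<comment> \<open>In the exponent \<open>m * t\<close> and the integral of the shot noise
    \<open>\<Gamma>\<close> cancel, while the term \<open>- \<sigma> * \<xi>\<close> of the rate
    supplies the drift that turns \<open>W\<close> into the Brownian motion of \<open>P'\<close>.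
    What remains of the rate is the integral of \<open>h\<close>, which is \<open>K\<close>.\<close>
  have price: "AE \<omega> in P'. \<forall>t\<ge>0. L t \<omega> * J.S t \<omega>
      = exp (- (LINT s:{0..t}|lborel. r s \<omega>)) * stock_price X\<^sub>0 m \<sigma> G g W T U t \<omega>"
    using \<Omega>_AE drift \<Gamma>_int AE'[OF \<xi>_integrable] AE'[OF r_integrable] AE_space
      W'_brownian[unfolded brownian_motion_def, THEN conjunct2, THEN conjunct2, THEN conjunct1]
  proof eventually_elim
    case (elim \<omega>)
    show ?case
    proof (intro allI impI)
      fix t :: real assume t: "0 \<le> t"
      have int: "set_integrable lborel {0..t} (\<lambda>s. m)" "set_integrable lborel {0..t} (\<lambda>s. \<sigma> * \<xi> s \<omega>)"
        "set_integrable lborel {0..t} (\<Gamma> \<omega>)" "set_integrable lborel {0..t} (h \<omega>)"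
        "set_integrable lborel {0..t} (\<lambda>s. r s \<omega>)"
      proof -
        show "set_integrable lborel {0..t} (\<lambda>s. m)"
          using locally_integrable_const t by (simp add: locally_integrable_def)
        show "set_integrable lborel {0..t} (\<lambda>s. \<sigma> * \<xi> s \<omega>)" "set_integrable lborel {0..t} (\<Gamma> \<omega>)"
          "set_integrable lborel {0..t} (\<lambda>s. r s \<omega>)"
          using elim(3-5) t by (auto simp: locally_integrable_def)
        show "set_integrable lborel {0..t} (h \<omega>)"
          using J.\<Omega>_h[OF elim(1)] t by (simp add: locally_integrable_def Jh)
      qed
      have "(LINT s:{0..t}|lborel. r s \<omega>) = (LINT s:{0..t}|lborel. m - \<sigma> * \<xi> s \<omega> + \<Gamma> \<omega> s + h \<omega> s)"
        unfolding set_lebesgue_integral_def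
      proof (rule integral_cong_AE)
        show "(\<lambda>s. indicator {0..t} s *\<^sub>R r s \<omega>) \<in> borel_measurable lborel"
          using int(5) by (simp add: set_integrable_def)
        have "set_integrable lborel {0..t} (\<lambda>s. m - \<sigma> * \<xi> s \<omega> + \<Gamma> \<omega> s + h \<omega> s)"
          using int by (intro set_integral_add(1) set_integral_diff(1))
        then show "(\<lambda>s. indicator {0..t} s *\<^sub>R (m - \<sigma> * \<xi> s \<omega> + \<Gamma> \<omega> s + h \<omega> s)) \<in> borel_measurable lborel"
          by (simp add: set_integrable_def)
        show "AE s in lborel. indicator {0..t} s *\<^sub>R r s \<omega> = indicator {0..t} s *\<^sub>R (m - \<sigma> * \<xi> s \<omega> + \<Gamma> \<omega> s + h \<omega> s)"
          using elim(2) by eventually_elim (auto simp: indicator_def)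
      qed
      also have "\<dots> = (LINT s:{0..t}|lborel. m) - (LINT s:{0..t}|lborel. \<sigma> * \<xi> s \<omega>)
          + (LINT s:{0..t}|lborel. \<Gamma> \<omega> s) + (LINT s:{0..t}|lborel. h \<omega> s)"
        using int by (simp add: set_integral_add set_integral_diff)
      also have "(LINT s:{0..t}|lborel. m) = m * t"
        using t by (simp add: set_lebesgue_integral_def)
      finally have r: "(LINT s:{0..t}|lborel. r s \<omega>) = m * t - \<sigma> * (LINT s:{0..t}|lborel. \<xi> s \<omega>)
          + (LINT s:{0..t}|lborel. \<Gamma> \<omega> s) + (LINT s:{0..t}|lborel. h \<omega> s)" by simp
      have K: "J.K t \<omega> = (LINT s:{0..t}|lborel. h \<omega> s)"
        using elim(1) by (simp add: J.K_def Jh)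
      have jumps: "J.jsum (G 0) atMost t \<omega> = (\<Sum>i | T i \<omega> \<le> t. G 0 (U i \<omega>))"
        using elim(1) by (simp add: J.jsum_def)
      have "L t \<omega> * J.S t \<omega> = X\<^sub>0 * exp ((\<sigma> * ?B t \<omega> - \<sigma>\<^sup>2 * t / 2)
          + ((\<Sum>i | T i \<omega> \<le> t. G 0 (U i \<omega>)) - (LINT s:{0..t}|lborel. h \<omega> s)))"
        using elim(6,7) unfolding L_def J.S_def K jumps exp_add by simp
      also have "(\<sigma> * ?B t \<omega> - \<sigma>\<^sup>2 * t / 2) + ((\<Sum>i | T i \<omega> \<le> t. G 0 (U i \<omega>)) - (LINT s:{0..t}|lborel. h \<omega> s))
          = - (LINT s:{0..t}|lborel. r s \<omega>) + (m * t + \<sigma> * W t \<omega> - \<sigma>\<^sup>2 * t / 2 + (LINT s:{0..t}|lborel. \<Gamma> \<omega> s)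
            + (\<Sum>i | T i \<omega> \<le> t. G 0 (U i \<omega>)))"
        unfolding r by (simp add: algebra_simps)
      also have "X\<^sub>0 * exp \<dots> = exp (- (LINT s:{0..t}|lborel. r s \<omega>)) * stock_price X\<^sub>0 m \<sigma> G g W T U t \<omega>"
        unfolding exp_add stock_price_def \<Gamma>_def by simp
      finally show "L t \<omega> * J.S t \<omega> = exp (- (LINT s:{0..t}|lborel. r s \<omega>)) * stock_price X\<^sub>0 m \<sigma> G g W T U t \<omega>" .
    qed
  qed
  show ?thesis
    unfolding local_martingale_measure_def
    by (rule P'.local_martingale_AE_cong[OF J.price_local_martingale price])
qed

end
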